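(* Let $\mathbb{D}$ be a derivator and let $X\in\mathbb{D}([2]\times[1])$. (i) If $d_2(X)\in\mathbb{D}(\square)$ is coCartesian, then $d_0(X)$ is coCartesian if and only if $d_1(X)$ is coCartesian. (ii) If $d_0(X)\in\mathbb{D}(\square)$ is Cartesian, then $d_2(X)$ is Cartesian if and only if $d_1(X)$ is Cartesian.
   Context: $\mathsf{Cat}$ is the 2-category of small categories, $\mathsf{CAT}$ that of not necessarily small categories, $e$ the terminal category. A prederivator is a strict 2-functor $\mathbb{D}\colon\mathsf{Cat}^{op}\to\mathsf{CAT}$ (contravariant on functors, covariant on natural transformations). Write $u^\ast=\mathbb{D}(u)\colon\mathbb{D}(K)\to\mathbb{D}(J)$ for $u\colon J\to K$, and $\alpha^\ast=\mathbb{D}(\alpha)$. For $k\in K$, viewed as $k\colon e\to K$, write $X_k=k^\ast X\in\mathbb{D}(e)$, $f_k=k^\ast f$. $\mathbb{D}$ is a derivator if: (Der1) for all $J_1,J_2$ the functor $\mathbb{D}(J_1\sqcup J_2)\to\mathbb{D}(J_1)\times\mathbb{D}(J_2)$ induced by the inclusions is an equivalence, and $\mathbb{D}(\emptyset)$ is not the empty category; (Der2) a morphism $f$ in $\mathbb{D}(J)$ is an isomorphism iff $f_j$ is an isomorphism in $\mathbb{D}(e)$ for all $j\in J$; (Der3) every $u^\ast$ has a left adjoint $u_!$ and a right adjoint $u_\ast$ (homotopy left/right Kan extension); (Der4) for $u\colon J\to K$ and $k\in K$ let $J_{/k}$ be the category of pairs $(j,f\colon u(j)\to k)$ and $J_{k/}$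 that of pairs $(j,f\colon k\to u(j))$, with projections $\mathrm{pr}$ to $J$ and $p$ to $e$, and let $\alpha\colon u\circ\mathrm{pr}\to k\circ p$, resp. $\alpha\colon k\circ p\to u\circ\mathrm{pr}$, be the transformation with components $f$. Then the maps $p_!\mathrm{pr}^\ast\xrightarrow{\eta}p_!\mathrm{pr}^\ast u^\ast u_!\xrightarrow{\alpha^\ast}p_!p^\ast k^\ast u_!\xrightarrow{\epsilon}k^\ast u_!$ and $k^\ast u_\ast\xrightarrow{\eta}p_\ast p^\ast k^\ast u_\ast\xrightarrow{\alpha^\ast}p_\ast\mathrm{pr}^\ast u^\ast u_\ast\xrightarrow{\epsilon}p_\ast\mathrm{pr}^\ast$ are isomorphisms. $[n]$ is the poset $0<\dots<n$ as a category, and $\square=[1]\times[1]$. $i_{\ulcorner}\colon\ulcorner\to\square$ is the inclusion of the full subposet on $(0,0),(1,0),(0,1)$ and $i_{\lrcorner}\colon\lrcorner\to\square$ that of the full subposet on $(1,0),(0,1),(1,1)$. $Y\in\mathbb{D}(\square)$ is coCartesian if it lies in the essential image of $(i_{\ulcorner})_!\colon\mathbb{D}(\ulcorner)\to\mathbb{D}(\square)$, and Cartesian if it lies in the essential image of $(i_{\lrcorner})_\ast\colon\mathbb{D}(\lrcorner)\to\mathbb{D}(\square)$. Let $d^i\colon[1]\to[2]$ be the monotone injection omitting $i$. For $X\in\mathbb{D}([2]\times[1])$ put $d_i(X)=(d^i\times\mathrm{id}_{[1]})^\ast X\in\mathbb{D}(\square)$. Thus, drawing the first coordinate horizontally, $d_2(X)$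 is the left square, $d_0(X)$ the right square, and $d_1(X)$ the composite square. *)

theory Defs
  imports Main "HOL-Library.FuncSet"
begin

section \<open>Categories, functors, natural transformations\<close>

record ('o, 'a) cat =
  Obj :: "'o set"
  Arr :: "'a set"
  Dom :: "'a \<Rightarrow> 'o"
  Cod :: "'a \<Rightarrow> 'o"
  Idn :: "'o \<Rightarrow> 'a"
  Cmp :: "'a \<Rightarrow> 'a \<Rightarrow> 'a"

definition hom :: "('o, 'a) cat \<Rightarrow> 'o \<Rightarrow> 'o \<Rightarrow> 'a set" where
  "hom C a b = {f \<in> Arr C. Dom C f = a \<and> Cod C f = b}"

text \<open>\<open>Cmp C g f\<close> is the composite \<open>g\<close> after \<open>f\<close>. All structure maps take the value
  \<open>undefined\<close> outside their domains, and likewise for functors and transformations below, so that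
  equality in HOL is equality of categories, functors and transformations. This is what makes
  strict 2-functoriality expressible by equations.\<close>

locale category =
  fixes C :: "('o, 'a) cat"
  assumes Dom_type: "Dom C \<in> Arr C \<rightarrow>\<^sub>E Obj C"
    and Cod_type: "Cod C \<in> Arr C \<rightarrow>\<^sub>E Obj C"
    and Idn_ext: "Idn C \<in> extensional (Obj C)"
    and Idn_hom: "a \<in> Obj C \<Longrightarrow> Idn C a \<in> hom C a a"
    and Cmp_hom: "f \<in> hom C a b \<Longrightarrow> g \<in> hom C b c \<Longrightarrow> Cmp C g f \<in> hom C a c"
    and Cmp_ext: "\<not> (g \<in> Arr C \<and> f \<in> Arr C \<and> Cod C f = Dom C g) \<Longrightarrow> Cmp C g f = undefined"
    and Cmp_Idn_right: "f \<in> hom C a b \<Longrightarrow> Cmp C f (Idn C a) = f"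
    and Cmp_Idn_left: "f \<in> hom C a b \<Longrightarrow> Cmp C (Idn C b) f = f"
    and Cmp_assoc: "f \<in> hom C a b \<Longrightarrow> g \<in> hom C b c \<Longrightarrow> h \<in> hom C c d \<Longrightarrow>
      Cmp C h (Cmp C g f) = Cmp C (Cmp C h g) f"

definition mk_cat ::
  "'o set \<Rightarrow> 'a set \<Rightarrow> ('a \<Rightarrow> 'o) \<Rightarrow> ('a \<Rightarrow> 'o) \<Rightarrow> ('o \<Rightarrow> 'a) \<Rightarrow> ('a \<Rightarrow> 'a \<Rightarrow> 'a) \<Rightarrow> ('o, 'a) cat" where
  "mk_cat Ob Ar d c i m =
     \<lparr>Obj = Ob, Arr = Ar, Dom = restrict d Ar, Cod = restrict c Ar, Idn = restrict i Ob,
      Cmp = (\<lambda>g f. if g \<in> Ar \<and> f \<in> Ar \<and> c f = d g then m g f else undefined)\<rparr>"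

definition iso :: "('o, 'a) cat \<Rightarrow> 'a \<Rightarrow> bool" where
  "iso C f \<longleftrightarrow> f \<in> Arr C \<and>
     (\<exists>g \<in> hom C (Cod C f) (Dom C f).
        Cmp C g f = Idn C (Dom C f) \<and> Cmp C f g = Idn C (Cod C f))"

definition isomorphic :: "('o, 'a) cat \<Rightarrow> 'o \<Rightarrow> 'o \<Rightarrow> bool" where
  "isomorphic C a b \<longleftrightarrow> (\<exists>f \<in> hom C a b. iso C f)"

definition prod_cat ::
  "('o, 'a) cat \<Rightarrow> ('p, 'b) cat \<Rightarrow> ('o \<times> 'p, 'a \<times> 'b) cat" where
  "prod_cat C D = mk_cat (Obj C \<times> Obj D) (Arr C \<times> Arr D)
     (map_prod (Dom C) (Dom D)) (map_prod (Cod C) (Cod D)) (map_prod (Idn C) (Idn D))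
     (\<lambda>g f. (Cmp C (fst g) (fst f), Cmp D (snd g) (snd f)))"

record ('o, 'a, 'p, 'b) functr =
  Src :: "('o, 'a) cat"
  Trg :: "('p, 'b) cat"
  onObj :: "'o \<Rightarrow> 'p"
  onArr :: "'a \<Rightarrow> 'b"

definition Fun :: "('o, 'a) cat \<Rightarrow> ('p, 'b) cat \<Rightarrow> ('o, 'a, 'p, 'b) functr set" where
  "Fun C D = {F. Src F = C \<and> Trg F = D \<and> category C \<and> category D \<and>
     onObj F \<in> Obj C \<rightarrow>\<^sub>E Obj D \<and> onArr F \<in> extensional (Arr C) \<and>
     (\<forall>f \<in> Arr C. onArr F f \<in> hom D (onObj F (Dom C f)) (onObj F (Cod C f))) \<and>
     (\<forall>a \<in> Obj C. onArr F (Idn C a) = Idn D (onObj F a)) \<and>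
     (\<forall>a b c. \<forall>f \<in> hom C a b. \<forall>g \<in> hom C b c.
        onArr F (Cmp C g f) = Cmp D (onArr F g) (onArr F f))}"

definition mk_fun ::
  "('o, 'a) cat \<Rightarrow> ('p, 'b) cat \<Rightarrow> ('o \<Rightarrow> 'p) \<Rightarrow> ('a \<Rightarrow> 'b) \<Rightarrow> ('o, 'a, 'p, 'b) functr" where
  "mk_fun C D F0 F1 =
     \<lparr>Src = C, Trg = D, onObj = restrict F0 (Obj C), onArr = restrict F1 (Arr C)\<rparr>"

definition id_fun :: "('o, 'a) cat \<Rightarrow> ('o, 'a, 'o, 'a) functr" where
  "id_fun C = mk_fun C C (\<lambda>a. a) (\<lambda>f. f)"

definition comp_fun ::
  "('p, 'b, 'q, 'c) functr \<Rightarrow> ('o, 'a, 'p, 'b) functr \<Rightarrow> ('o, 'a, 'q, 'c) functr"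
  (infixr "\<odot>" 75) where
  "G \<odot> F = mk_fun (Src F) (Trg G) (\<lambda>a. onObj G (onObj F a)) (\<lambda>f. onArr G (onArr F f))"

record ('o, 'a, 'p, 'b) nattrans =
  NSrc :: "('o, 'a, 'p, 'b) functr"
  NTrg :: "('o, 'a, 'p, 'b) functr"
  component :: "'o \<Rightarrow> 'b"

definition Nat ::
  "('o, 'a, 'p, 'b) functr \<Rightarrow> ('o, 'a, 'p, 'b) functr \<Rightarrow> ('o, 'a, 'p, 'b) nattrans set" where
  "Nat F G = {\<alpha>. NSrc \<alpha> = F \<and> NTrg \<alpha> = G \<and>
     Src F = Src G \<and> Trg F = Trg G \<and> F \<in> Fun (Src F) (Trg F) \<and> G \<in> Fun (Src G) (Trg G) \<and>
     component \<alpha> \<in> extensional (Obj (Src F)) \<and>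
     (\<forall>a \<in> Obj (Src F). component \<alpha> a \<in> hom (Trg F) (onObj F a) (onObj G a)) \<and>
     (\<forall>f \<in> Arr (Src F).
        Cmp (Trg F) (onArr G f) (component \<alpha> (Dom (Src F) f)) =
        Cmp (Trg F) (component \<alpha> (Cod (Src F) f)) (onArr F f))}"

definition mk_nat ::
  "('o, 'a, 'p, 'b) functr \<Rightarrow> ('o, 'a, 'p, 'b) functr \<Rightarrow> ('o \<Rightarrow> 'b) \<Rightarrow> ('o, 'a, 'p, 'b) nattrans" where
  "mk_nat F G c = \<lparr>NSrc = F, NTrg = G, component = restrict c (Obj (Src F))\<rparr>"

definition id_nat :: "('o, 'a, 'p, 'b) functr \<Rightarrow> ('o, 'a, 'p, 'b) nattrans" where
  "id_nat F = mk_nat F F (\<lambda>a. Idn (Trg F) (onObj F a))"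

definition vcomp ::
  "('o, 'a, 'p, 'b) nattrans \<Rightarrow> ('o, 'a, 'p, 'b) nattrans \<Rightarrow> ('o, 'a, 'p, 'b) nattrans"
  (infixr "\<bullet>" 65) where
  "\<beta> \<bullet> \<alpha> = mk_nat (NSrc \<alpha>) (NTrg \<beta>)
     (\<lambda>a. Cmp (Trg (NSrc \<alpha>)) (component \<beta> a) (component \<alpha> a))"

definition whisker_left ::
  "('p, 'b, 'q, 'c) functr \<Rightarrow> ('o, 'a, 'p, 'b) nattrans \<Rightarrow> ('o, 'a, 'q, 'c) nattrans"
  (infixr "\<triangleright>" 70) where
  "H \<triangleright> \<alpha> = mk_nat (H \<odot> NSrc \<alpha>) (H \<odot> NTrg \<alpha>) (\<lambda>a. onArr H (component \<alpha> a))"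

definition whisker_right ::
  "('p, 'b, 'q, 'c) nattrans \<Rightarrow> ('o, 'a, 'p, 'b) functr \<Rightarrow> ('o, 'a, 'q, 'c) nattrans"
  (infixl "\<triangleleft>" 72) where
  "\<beta> \<triangleleft> F = mk_nat (NSrc \<beta> \<odot> F) (NTrg \<beta> \<odot> F) (\<lambda>a. component \<beta> (onObj F a))"

definition nat_iso :: "('o, 'a, 'p, 'b) nattrans \<Rightarrow> bool" where
  "nat_iso \<alpha> \<longleftrightarrow> \<alpha> \<in> Nat (NSrc \<alpha>) (NTrg \<alpha>) \<and>
     (\<forall>a \<in> Obj (Src (NSrc \<alpha>)). iso (Trg (NSrc \<alpha>)) (component \<alpha> a))"

definition equivalence :: "('o, 'a, 'p, 'b) functr \<Rightarrow> bool" where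
  "equivalence F \<longleftrightarrow> F \<in> Fun (Src F) (Trg F) \<and>
     (\<exists>G \<in> Fun (Trg F) (Src F).
        (\<exists>\<alpha> \<in> Nat (id_fun (Src F)) (G \<odot> F). nat_iso \<alpha>) \<and>
        (\<exists>\<beta> \<in> Nat (F \<odot> G) (id_fun (Trg F)). nat_iso \<beta>))"

text \<open>\<open>adjunction L R \<eta> \<epsilon>\<close>: \<open>L\<close> is left adjoint to \<open>R\<close>, with unit \<open>\<eta>\<close> and counit \<open>\<epsilon>\<close>.\<close>

definition adjunction ::
  "('o, 'a, 'p, 'b) functr \<Rightarrow> ('p, 'b, 'o, 'a) functr \<Rightarrow>
   ('o, 'a, 'o, 'a) nattrans \<Rightarrow> ('p, 'b, 'p, 'b) nattrans \<Rightarrow> bool" where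
  "adjunction L R \<eta> \<epsilon> \<longleftrightarrow>
     L \<in> Fun (Src L) (Trg L) \<and> R \<in> Fun (Trg L) (Src L) \<and>
     \<eta> \<in> Nat (id_fun (Src L)) (R \<odot> L) \<and> \<epsilon> \<in> Nat (L \<odot> R) (id_fun (Trg L)) \<and>
     (\<epsilon> \<triangleleft> L) \<bullet> (L \<triangleright> \<eta>) = id_nat L \<and> (R \<triangleright> \<epsilon>) \<bullet> (\<eta> \<triangleleft> R) = id_nat R"

definition ess_image :: "('o, 'a, 'p, 'b) functr \<Rightarrow> 'p set" where
  "ess_image F = {Y \<in> Obj (Trg F). \<exists>Z \<in> Obj (Src F). isomorphic (Trg F) (onObj F Z) Y}"


section \<open>Small categories\<close>

text \<open>The objects and arrows of small categories are elements of the following type, which closes an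
  arbitrary type \<open>'x\<close> under pairing, and adds the natural numbers as names for the objects of the
  standard posets.\<close>

datatype 'x code = Base 'x | Num nat | Pr (pfst: "'x code") (psnd: "'x code")

type_synonym 'x scat = "('x code, 'x code) cat"
type_synonym 'x sfun = "('x code, 'x code, 'x code, 'x code) functr"
type_synonym 'x snat = "('x code, 'x code, 'x code, 'x code) nattrans"

text \<open>\<open>small\<close> stands for membership in a fixed Grothendieck universe, up to bijection: if \<open>'x\<close> is the
  type of elements of a universe \<open>U\<close>, then the sets of codes equinumerous to elements of \<open>U\<close> satisfy the
  axioms. Infinity is not required, so that on every type the finite sets are an instance too.\<close>

locale universe =
  fixes small :: "'u set \<Rightarrow> bool"
  assumes small_finite: "finite A \<Longrightarrow> small A"
    and small_subset: "small A \<Longrightarrow> A' \<subseteq> A \<Longrightarrow> small A'"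
    and small_image: "small A \<Longrightarrow> small (f ` A)"
    and small_UN: "small I \<Longrightarrow> (\<And>i. i \<in> I \<Longrightarrow> small (B i)) \<Longrightarrow> small (\<Union>i\<in>I. B i)"
    and small_Pow: "small A \<Longrightarrow> \<exists>f :: 'u set \<Rightarrow> 'u. inj_on f (Pow A) \<and> small (f ` Pow A)"

definition small_cat :: "('x code set \<Rightarrow> bool) \<Rightarrow> 'x scat \<Rightarrow> bool" where
  "small_cat small J \<longleftrightarrow> category J \<and> small (Obj J) \<and> small (Arr J)"

subsection \<open>Posets\<close>

fun code_le :: "'x code \<Rightarrow> 'x code \<Rightarrow> bool" where
  "code_le (Num m) (Num n) \<longleftrightarrow> m \<le> n"
| "code_le (Pr a b) (Pr c d) \<longleftrightarrow> code_le a c \<and> code_le b d"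
| "code_le _ _ \<longleftrightarrow> False"

text \<open>The unique arrow from \<open>x\<close> to \<open>y \<ge> x\<close> is \<open>Pr x y\<close>.\<close>

definition poset :: "'x code set \<Rightarrow> 'x scat" where
  "poset P = mk_cat P {Pr x y | x y. x \<in> P \<and> y \<in> P \<and> code_le x y} pfst psnd (\<lambda>x. Pr x x)
     (\<lambda>g f. Pr (pfst f) (psnd g))"

definition monotone_fun :: "'x code set \<Rightarrow> 'x code set \<Rightarrow> ('x code \<Rightarrow> 'x code) \<Rightarrow> 'x sfun" where
  "monotone_fun P Q h = mk_fun (poset P) (poset Q) h (\<lambda>f. Pr (h (pfst f)) (h (psnd f)))"

definition chain :: "nat \<Rightarrow> 'x code set" where
  "chain n = Num ` {0..n}"

definition prod_poset :: "'x code set \<Rightarrow> 'x code set \<Rightarrow> 'x code set" where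
  "prod_poset P Q = {Pr x y | x y. x \<in> P \<and> y \<in> Q}"

definition square :: "'x code set" where
  "square = prod_poset (chain 1) (chain 1)"

definition ul_corner :: "'x code set" where
  "ul_corner = {Pr (Num 0) (Num 0), Pr (Num 1) (Num 0), Pr (Num 0) (Num 1)}"

definition lr_corner :: "'x code set" where
  "lr_corner = {Pr (Num 1) (Num 0), Pr (Num 0) (Num 1), Pr (Num 1) (Num 1)}"

definition incl_ul :: "'x sfun" where
  "incl_ul = monotone_fun ul_corner square (\<lambda>x. x)"

definition incl_lr :: "'x sfun" where
  "incl_lr = monotone_fun lr_corner square (\<lambda>x. x)"

fun coface :: "nat \<Rightarrow> 'x code \<Rightarrow> 'x code" where
  "coface i (Num a) = Num (if a < i then a else Suc a)"
| "coface i x = undefined"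

text \<open>The functor \<open>d\<^sup>i \<times> id : [1] \<times> [1] \<rightarrow> [2] \<times> [1]\<close>.\<close>

definition coface_times_id :: "nat \<Rightarrow> 'x sfun" where
  "coface_times_id i = monotone_fun square (prod_poset (chain 2) (chain 1))
     (\<lambda>x. Pr (coface i (pfst x)) (psnd x))"

subsection \<open>The terminal category, coproducts, slices\<close>

definition term_cat :: "'x scat" where
  "term_cat = poset (chain 0)"

definition to_term :: "'x scat \<Rightarrow> 'x sfun" where
  "to_term J = mk_fun J term_cat (\<lambda>_. Num 0) (\<lambda>_. Pr (Num 0) (Num 0))"

definition point :: "'x scat \<Rightarrow> 'x code \<Rightarrow> 'x sfun" where
  "point K k = mk_fun term_cat K (\<lambda>_. k) (\<lambda>_. Idn K k)"

text \<open>An object or arrow \<open>x\<close> of the first (second) summand is tagged as \<open>Pr (Num 0) x\<close>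
  (\<open>Pr (Num 1) x\<close>).\<close>

definition coprod :: "'x scat \<Rightarrow> 'x scat \<Rightarrow> 'x scat" where
  "coprod J1 J2 = (let J = (\<lambda>t. if t = Num 0 then J1 else J2) in
     mk_cat (Pr (Num 0) ` Obj J1 \<union> Pr (Num 1) ` Obj J2)
       (Pr (Num 0) ` Arr J1 \<union> Pr (Num 1) ` Arr J2)
       (\<lambda>f. Pr (pfst f) (Dom (J (pfst f)) (psnd f)))
       (\<lambda>f. Pr (pfst f) (Cod (J (pfst f)) (psnd f)))
       (\<lambda>a. Pr (pfst a) (Idn (J (pfst a)) (psnd a)))
       (\<lambda>g f. Pr (pfst f) (Cmp (J (pfst f)) (psnd g) (psnd f))))"

definition inj1 :: "'x scat \<Rightarrow> 'x scat \<Rightarrow> 'x sfun" where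
  "inj1 J1 J2 = mk_fun J1 (coprod J1 J2) (Pr (Num 0)) (Pr (Num 0))"

definition inj2 :: "'x scat \<Rightarrow> 'x scat \<Rightarrow> 'x sfun" where
  "inj2 J1 J2 = mk_fun J2 (coprod J1 J2) (Pr (Num 1)) (Pr (Num 1))"

text \<open>Objects are pairs \<open>Pr j f\<close> from \<open>obs\<close>; an arrow from \<open>a\<close> to \<open>b\<close> is \<open>Pr (Pr a b) g\<close>, where \<open>g\<close> is
  an arrow of \<open>J\<close> between the first components that satisfies \<open>ok a b g\<close>.\<close>

definition pair_cat ::
  "'x scat \<Rightarrow> 'x code set \<Rightarrow> ('x code \<Rightarrow> 'x code \<Rightarrow> 'x code \<Rightarrow> bool) \<Rightarrow> 'x scat" where
  "pair_cat J obs ok = mk_cat obs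
     {Pr (Pr a b) g | a b g. a \<in> obs \<and> b \<in> obs \<and> g \<in> hom J (pfst a) (pfst b) \<and> ok a b g}
     (\<lambda>t. pfst (pfst t)) (\<lambda>t. psnd (pfst t)) (\<lambda>a. Pr (Pr a a) (Idn J (pfst a)))
     (\<lambda>s t. Pr (Pr (pfst (pfst t)) (psnd (pfst s))) (Cmp J (psnd s) (psnd t)))"

definition slice :: "'x sfun \<Rightarrow> 'x code \<Rightarrow> 'x scat" where
  "slice u k = pair_cat (Src u)
     {Pr j f | j f. j \<in> Obj (Src u) \<and> f \<in> hom (Trg u) (onObj u j) k}
     (\<lambda>a b g. Cmp (Trg u) (psnd b) (onArr u g) = psnd a)"

definition coslice :: "'x sfun \<Rightarrow> 'x code \<Rightarrow> 'x scat" where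
  "coslice u k = pair_cat (Src u)
     {Pr j f | j f. j \<in> Obj (Src u) \<and> f \<in> hom (Trg u) k (onObj u j)}
     (\<lambda>a b g. Cmp (Trg u) (onArr u g) (psnd a) = psnd b)"

definition slice_proj :: "'x sfun \<Rightarrow> 'x code \<Rightarrow> 'x sfun" where
  "slice_proj u k = mk_fun (slice u k) (Src u) pfst psnd"

definition coslice_proj :: "'x sfun \<Rightarrow> 'x code \<Rightarrow> 'x sfun" where
  "coslice_proj u k = mk_fun (coslice u k) (Src u) pfst psnd"

definition slice_nat :: "'x sfun \<Rightarrow> 'x code \<Rightarrow> 'x snat" where
  "slice_nat u k =
     mk_nat (u \<odot> slice_proj u k) (point (Trg u) k \<odot> to_term (slice u k)) psnd"

definition coslice_nat :: "'x sfun \<Rightarrow> 'x code \<Rightarrow> 'x snat" where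
  "coslice_nat u k =
     mk_nat (point (Trg u) k \<odot> to_term (coslice u k)) (u \<odot> coslice_proj u k) psnd"


section \<open>Derivators\<close>

text \<open>All categories \<open>\<D>(J)\<close> have objects in one type \<open>'o\<close> and arrows in one type \<open>'a\<close>; they need not
  be small. Only the values at small categories, and at functors and transformations between them,
  are constrained.\<close>

record ('x, 'o, 'a) prederiv =
  at_cat :: "'x scat \<Rightarrow> ('o, 'a) cat"
  at_fun :: "'x sfun \<Rightarrow> ('o, 'a, 'o, 'a) functr"
  at_nat :: "'x snat \<Rightarrow> ('o, 'a, 'o, 'a) nattrans"

text \<open>Preservation of horizontal composition is expressed through whiskering, which together with
  vertical composition generates it.\<close>

locale prederivator = universe small
  for small :: "'x code set \<Rightarrow> bool" +
  fixes \<D> :: "('x, 'o, 'a) prederiv"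
  assumes at_cat: "small_cat small J \<Longrightarrow> category (at_cat \<D> J)"
    and at_fun: "small_cat small J \<Longrightarrow> small_cat small K \<Longrightarrow> u \<in> Fun J K \<Longrightarrow>
      at_fun \<D> u \<in> Fun (at_cat \<D> K) (at_cat \<D> J)"
    and at_nat: "small_cat small J \<Longrightarrow> small_cat small K \<Longrightarrow> u \<in> Fun J K \<Longrightarrow> v \<in> Fun J K \<Longrightarrow>
      \<alpha> \<in> Nat u v \<Longrightarrow> at_nat \<D> \<alpha> \<in> Nat (at_fun \<D> u) (at_fun \<D> v)"
    and at_id_fun: "small_cat small J \<Longrightarrow> at_fun \<D> (id_fun J) = id_fun (at_cat \<D> J)"
    and at_comp_fun: "small_cat small J \<Longrightarrow> small_cat small K \<Longrightarrow> small_cat small L \<Longrightarrow>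
      u \<in> Fun J K \<Longrightarrow> v \<in> Fun K L \<Longrightarrow> at_fun \<D> (v \<odot> u) = at_fun \<D> u \<odot> at_fun \<D> v"
    and at_id_nat: "small_cat small J \<Longrightarrow> small_cat small K \<Longrightarrow> u \<in> Fun J K \<Longrightarrow>
      at_nat \<D> (id_nat u) = id_nat (at_fun \<D> u)"
    and at_vcomp: "small_cat small J \<Longrightarrow> small_cat small K \<Longrightarrow>
      u \<in> Fun J K \<Longrightarrow> v \<in> Fun J K \<Longrightarrow> w \<in> Fun J K \<Longrightarrow> \<alpha> \<in> Nat u v \<Longrightarrow> \<beta> \<in> Nat v w \<Longrightarrow>
      at_nat \<D> (\<beta> \<bullet> \<alpha>) = at_nat \<D> \<beta> \<bullet> at_nat \<D> \<alpha>"
    and at_whisker_left: "small_cat small J \<Longrightarrow> small_cat small K \<Longrightarrow> small_cat small L \<Longrightarrow>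
      u \<in> Fun J K \<Longrightarrow> v \<in> Fun J K \<Longrightarrow> \<alpha> \<in> Nat u v \<Longrightarrow> w \<in> Fun K L \<Longrightarrow>
      at_nat \<D> (w \<triangleright> \<alpha>) = at_nat \<D> \<alpha> \<triangleleft> at_fun \<D> w"
    and at_whisker_right: "small_cat small J \<Longrightarrow> small_cat small K \<Longrightarrow> small_cat small L \<Longrightarrow>
      u \<in> Fun K L \<Longrightarrow> v \<in> Fun K L \<Longrightarrow> \<alpha> \<in> Nat u v \<Longrightarrow> w \<in> Fun J K \<Longrightarrow>
      at_nat \<D> (\<alpha> \<triangleleft> w) = at_fun \<D> w \<triangleright> at_nat \<D> \<alpha>"

definition coprod_comparison ::
  "('x, 'o, 'a) prederiv \<Rightarrow> 'x scat \<Rightarrow> 'x scat \<Rightarrow> ('o, 'a, 'o \<times> 'o, 'a \<times> 'a) functr" where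
  "coprod_comparison \<D> J1 J2 = (let i1 = at_fun \<D> (inj1 J1 J2); i2 = at_fun \<D> (inj2 J1 J2) in
     mk_fun (at_cat \<D> (coprod J1 J2)) (prod_cat (at_cat \<D> J1) (at_cat \<D> J2))
       (\<lambda>X. (onObj i1 X, onObj i2 X)) (\<lambda>f. (onArr i1 f, onArr i2 f)))"

text \<open>The maps of (Der4), for given left adjoints \<open>ul\<close> of \<open>u\<^sup>*\<close> and \<open>pl\<close> of \<open>p\<^sup>*\<close> (right adjoints \<open>ur\<close>
  and \<open>pr\<close>), where \<open>\<eta>\<close> is the unit and \<open>\<epsilon>\<close> the counit that occurs in the composite.\<close>

definition slice_mate ::
  "('x, 'o, 'a) prederiv \<Rightarrow> 'x sfun \<Rightarrow> 'x code \<Rightarrow>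
   ('o, 'a, 'o, 'a) functr \<Rightarrow> ('o, 'a, 'o, 'a) nattrans \<Rightarrow>
   ('o, 'a, 'o, 'a) functr \<Rightarrow> ('o, 'a, 'o, 'a) nattrans \<Rightarrow> ('o, 'a, 'o, 'a) nattrans" where
  "slice_mate \<D> u k ul \<eta> pl \<epsilon> =
     (\<epsilon> \<triangleleft> (at_fun \<D> (point (Trg u) k) \<odot> ul)) \<bullet>
     (pl \<triangleright> (at_nat \<D> (slice_nat u k) \<triangleleft> ul)) \<bullet>
     ((pl \<odot> at_fun \<D> (slice_proj u k)) \<triangleright> \<eta>)"

definition coslice_mate ::
  "('x, 'o, 'a) prederiv \<Rightarrow> 'x sfun \<Rightarrow> 'x code \<Rightarrow>
   ('o, 'a, 'o, 'a) functr \<Rightarrow> ('o, 'a, 'o, 'a) nattrans \<Rightarrow>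
   ('o, 'a, 'o, 'a) functr \<Rightarrow> ('o, 'a, 'o, 'a) nattrans \<Rightarrow> ('o, 'a, 'o, 'a) nattrans" where
  "coslice_mate \<D> u k ur \<epsilon> pr \<eta> =
     ((pr \<odot> at_fun \<D> (coslice_proj u k)) \<triangleright> \<epsilon>) \<bullet>
     (pr \<triangleright> (at_nat \<D> (coslice_nat u k) \<triangleleft> ur)) \<bullet>
     (\<eta> \<triangleleft> (at_fun \<D> (point (Trg u) k) \<odot> ur))"

text \<open>(Der4) is required for every choice of the adjoints and of their units and counits; by uniqueness
  of adjoints this is independent of the choice.\<close>

locale derivator = prederivator small \<D>
  for small :: "'x code set \<Rightarrow> bool" and \<D> :: "('x, 'o, 'a) prederiv" +
  assumes Der1_coprod: "small_cat small J1 \<Longrightarrow> small_cat small J2 \<Longrightarrow>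
      equivalence (coprod_comparison \<D> J1 J2)"
    and Der1_empty: "Obj (at_cat \<D> (poset {})) \<noteq> {}"
    and Der2: "small_cat small J \<Longrightarrow> f \<in> Arr (at_cat \<D> J) \<Longrightarrow>
      iso (at_cat \<D> J) f \<longleftrightarrow>
      (\<forall>j \<in> Obj J. iso (at_cat \<D> term_cat) (onArr (at_fun \<D> (point J j)) f))"
    and Der3_left: "small_cat small J \<Longrightarrow> small_cat small K \<Longrightarrow> u \<in> Fun J K \<Longrightarrow>
      \<exists>ul \<eta> \<epsilon>. adjunction ul (at_fun \<D> u) \<eta> \<epsilon>"
    and Der3_right: "small_cat small J \<Longrightarrow> small_cat small K \<Longrightarrow> u \<in> Fun J K \<Longrightarrow>
      \<exists>ur \<eta> \<epsilon>. adjunction (at_fun \<D> u) ur \<eta> \<epsilon>"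
    and Der4_left: "small_cat small J \<Longrightarrow> small_cat small K \<Longrightarrow> u \<in> Fun J K \<Longrightarrow> k \<in> Obj K \<Longrightarrow>
      adjunction ul (at_fun \<D> u) \<eta> \<epsilon> \<Longrightarrow>
      adjunction pl (at_fun \<D> (to_term (slice u k))) \<eta>' \<epsilon>' \<Longrightarrow>
      nat_iso (slice_mate \<D> u k ul \<eta> pl \<epsilon>')"
    and Der4_right: "small_cat small J \<Longrightarrow> small_cat small K \<Longrightarrow> u \<in> Fun J K \<Longrightarrow> k \<in> Obj K \<Longrightarrow>
      adjunction (at_fun \<D> u) ur \<eta> \<epsilon> \<Longrightarrow>
      adjunction (at_fun \<D> (to_term (coslice u k))) pr \<eta>' \<epsilon>' \<Longrightarrow>
      nat_iso (coslice_mate \<D> u k ur \<epsilon> pr \<eta>')"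

definition coCartesian :: "('x, 'o, 'a) prederiv \<Rightarrow> 'o \<Rightarrow> bool" where
  "coCartesian \<D> Y \<longleftrightarrow>
     (\<exists>L \<eta> \<epsilon>. adjunction L (at_fun \<D> incl_ul) \<eta> \<epsilon> \<and> Y \<in> ess_image L)"

definition Cartesian :: "('x, 'o, 'a) prederiv \<Rightarrow> 'o \<Rightarrow> bool" where
  "Cartesian \<D> Y \<longleftrightarrow>
     (\<exists>R \<eta> \<epsilon>. adjunction (at_fun \<D> incl_lr) R \<eta> \<epsilon> \<and> Y \<in> ess_image R)"

definition face :: "('x, 'o, 'a) prederiv \<Rightarrow> nat \<Rightarrow> 'o \<Rightarrow> 'o" where
  "face \<D> i X = onObj (at_fun \<D> (coface_times_id i)) X"

end

theory Submission
  imports Defs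
begin

text \<open>Whether a square is coCartesian is a colimit condition. For a diagram \<open>X\<close> over \<open>Q\<close>, a functor
\<open>w : S \<rightarrow> Q\<close> and \<open>k \<in> Q\<close> with \<open>w s \<le> k\<close> for all \<open>s\<close>, there is a cocone \<open>w\<^sup>* X \<rightarrow> p\<^sup>* X\<^sub>k\<close>, where
\<open>p : S \<rightarrow> e\<close>; it is a homotopy colimit if it is a universal arrow from \<open>w\<^sup>* X\<close> to \<open>p\<^sup>*\<close>
(\<open>univ_cocone\<close>). By (Der4), (Der2) and the fact that the slice of a full subposet \<open>J\<close> over a
point of \<open>J\<close> has a greatest element, a diagram over \<open>Q \<supseteq> J\<close> is a left Kan extension from \<open>J\<close> precisely when for
each \<open>k \<in> Q - J\<close> the cocone over \<open>{x \<in> J. x \<le> k}\<close> is a colimit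
(\<open>kan_extension_iff_univ_cocone\<close>). So, writing \<open>ij\<close> for the object \<open>(i, j)\<close> of \<open>[2] \<times> [1]\<close>, the
faces \<open>d\<^sub>2 X\<close>, \<open>d\<^sub>0 X\<close> and \<open>d\<^sub>1 X\<close> are coCartesian iff \<open>X\<close> has a colimit cocone

\<^item> from \<open>{00, 10, 01}\<close> to \<open>11\<close>,
\<^item> from \<open>{10, 20, 11}\<close> to \<open>21\<close>,
\<^item> from \<open>{00, 20, 01}\<close> to \<open>21\<close>,

respectively. Put \<open>A = {00, 10, 20, 01}\<close> and \<open>B = A \<union> {11}\<close>. The inclusions of \<open>{10, 20, 11}\<close> into \<open>B\<close>
and of \<open>{00, 20, 01}\<close> into \<open>A\<close> have left adjoints, hence are final
(\<open>univ_cocone_right_adjoint\<close>), and the last two conditions become conditions on the cocones over \<open>B\<close>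
and over \<open>A\<close>. The first condition says that the restriction of \<open>X\<close> to \<open>B\<close> is a left Kan extension
of its restriction to \<open>A\<close>. Then restriction from \<open>B\<close> to \<open>A\<close> is bijective on cocones, and the two
conditions are equivalent (\<open>univ_cocone_pasting\<close>).

Statement (ii) is the same argument for the categories \<open>\<D>(P)\<^sup>o\<^sup>p\<close>. Passing to opposite categories
of diagrams keeps the index posets and only reverses the natural transformations, that is, the
order relation by which they are indexed. The argument is therefore carried out in a locale in which
the order is a parameter; it has one instance for the order of the posets and \<open>\<D>(P)\<close>, and one for the
reversed order and \<open>\<D>(P)\<^sup>o\<^sup>p\<close>.\<close>

section \<open>Categories and functors\<close>

lemma hom_objs:
  assumes "category C" "f \<in> hom C a b"
  shows "a \<in> Obj C" "b \<in> Obj C"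
  using assms category.Dom_type[of C] category.Cod_type[of C] by (auto simp: hom_def)

lemma hom_Arr: "f \<in> hom C a b \<Longrightarrow> f \<in> Arr C"
  by (simp add: hom_def)

lemma Arr_hom: "f \<in> Arr C \<Longrightarrow> f \<in> hom C (Dom C f) (Cod C f)"
  by (simp add: hom_def)

lemma Fun_simps:
  assumes "F \<in> Fun C D"
  shows "Src F = C" "Trg F = D"
  using assms by (auto simp: Fun_def)

lemma Fun_cats:
  assumes "F \<in> Fun C D"
  shows "category C" "category D"
  using assms by (auto simp: Fun_def)

lemma Fun_Obj: "F \<in> Fun C D \<Longrightarrow> a \<in> Obj C \<Longrightarrow> onObj F a \<in> Obj D"
  by (auto simp: Fun_def)

lemma Fun_hom: "F \<in> Fun C D \<Longrightarrow> f \<in> hom C a b \<Longrightarrow> onArr F f \<in> hom D (onObj F a) (onObj F b)"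
  by (auto simp: Fun_def hom_def)

lemma Fun_Idn: "F \<in> Fun C D \<Longrightarrow> a \<in> Obj C \<Longrightarrow> onArr F (Idn C a) = Idn D (onObj F a)"
  by (auto simp: Fun_def)

lemma Fun_Cmp: "F \<in> Fun C D \<Longrightarrow> f \<in> hom C a b \<Longrightarrow> g \<in> hom C b c \<Longrightarrow>
   onArr F (Cmp C g f) = Cmp D (onArr F g) (onArr F f)"
  by (auto simp: Fun_def)

lemma FunI:
  assumes "Src F = C" "Trg F = D" "category C" "category D"
    "\<And>a. a \<in> Obj C \<Longrightarrow> onObj F a \<in> Obj D" "onObj F \<in> extensional (Obj C)"
    "onArr F \<in> extensional (Arr C)"
    "\<And>f a b. f \<in> hom C a b \<Longrightarrow> onArr F f \<in> hom D (onObj F a) (onObj F b)"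
    "\<And>a. a \<in> Obj C \<Longrightarrow> onArr F (Idn C a) = Idn D (onObj F a)"
    "\<And>f g a b c. f \<in> hom C a b \<Longrightarrow> g \<in> hom C b c \<Longrightarrow>
       onArr F (Cmp C g f) = Cmp D (onArr F g) (onArr F f)"
  shows "F \<in> Fun C D"
  unfolding Fun_def using assms by (auto simp: PiE_def dest: Arr_hom)

lemma comp_fun_simps:
  "Src (G \<odot> F) = Src F" "Trg (G \<odot> F) = Trg G"
  "a \<in> Obj (Src F) \<Longrightarrow> onObj (G \<odot> F) a = onObj G (onObj F a)"
  "f \<in> Arr (Src F) \<Longrightarrow> onArr (G \<odot> F) f = onArr G (onArr F f)"
  by (simp_all add: comp_fun_def mk_fun_def)

lemma id_fun_simps:
  "Src (id_fun C) = C" "Trg (id_fun C) = C"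
  "a \<in> Obj C \<Longrightarrow> onObj (id_fun C) a = a"
  "f \<in> Arr C \<Longrightarrow> onArr (id_fun C) f = f"
  by (simp_all add: id_fun_def mk_fun_def)

lemma Idn_Arr: "category C \<Longrightarrow> a \<in> Obj C \<Longrightarrow> Idn C a \<in> Arr C"
  using category.Idn_hom hom_Arr by metis

lemma Cmp_Arr: "category C \<Longrightarrow> f \<in> hom C a b \<Longrightarrow> g \<in> hom C b c \<Longrightarrow> Cmp C g f \<in> Arr C"
  using category.Cmp_hom hom_Arr by metis

lemma id_fun_Fun: "category C \<Longrightarrow> id_fun C \<in> Fun C C"
  by (rule FunI)
     (use hom_objs[of C] in \<open>simp_all add: id_fun_def mk_fun_def hom_Arr Idn_Arr Cmp_Arr\<close>)

lemma comp_fun_Fun: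
  assumes "F \<in> Fun C D" "G \<in> Fun D E"
  shows "G \<odot> F \<in> Fun C E"
proof (rule FunI)
  note [simp] = Fun_simps[OF assms(1)] Fun_simps[OF assms(2)]
  note c = Fun_cats[OF assms(1)] Fun_cats[OF assms(2)]
  show "category C" "category E" by (rule c)+
  show "onObj (G \<odot> F) a \<in> Obj E" if "a \<in> Obj C" for a
    using that assms by (simp add: comp_fun_simps Fun_Obj)
  show "onArr (G \<odot> F) f \<in> hom E (onObj (G \<odot> F) a) (onObj (G \<odot> F) b)" if "f \<in> hom C a b" for f a b
    using that assms hom_objs[OF c(1) that] by (simp add: comp_fun_simps hom_Arr Fun_hom)
  show "onArr (G \<odot> F) (Idn C a) = Idn E (onObj (G \<odot> F) a)" if "a \<in> Obj C" for a
    using that assms c by (simp add: comp_fun_simps Idn_Arr Fun_Idn Fun_Obj)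
  show "onArr (G \<odot> F) (Cmp C g f) = Cmp E (onArr (G \<odot> F) g) (onArr (G \<odot> F) f)"
    if "f \<in> hom C a b" "g \<in> hom C b c" for f g a b c
    using that assms c Cmp_Arr[of C f a b g c]
    by (simp add: comp_fun_simps hom_Arr Fun_Cmp[OF assms(1) that]
        Fun_Cmp[OF assms(2) Fun_hom[OF assms(1) that(1)] Fun_hom[OF assms(1) that(2)]])
qed (simp_all add: comp_fun_def mk_fun_def Fun_simps[OF assms(1)] Fun_simps[OF assms(2)])

lemma isoI:
  assumes "f \<in> hom C a b" "g \<in> hom C b a" "Cmp C g f = Idn C a" "Cmp C f g = Idn C b"
  shows "iso C f"
  using assms by (auto simp: iso_def hom_def)

lemma isoE:
  assumes "iso C f" "f \<in> hom C a b"
  obtains g where "g \<in> hom C b a" "Cmp C g f = Idn C a" "Cmp C f g = Idn C b"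
  using assms by (auto simp: iso_def hom_def)

lemma iso_Idn: "category C \<Longrightarrow> a \<in> Obj C \<Longrightarrow> iso C (Idn C a)"
  by (rule isoI[of _ _ a a "Idn C a"])
     (auto simp: category.Idn_hom category.Cmp_Idn_left[OF _ category.Idn_hom])

lemma iso_functor:
  assumes "F \<in> Fun C D" "f \<in> hom C a b" "iso C f"
  shows "iso D (onArr F f)"
proof -
  obtain g where g: "g \<in> hom C b a" "Cmp C g f = Idn C a" "Cmp C f g = Idn C b"
    using isoE assms by metis
  show ?thesis
    using Fun_Cmp[OF assms(1,2) g(1)] Fun_Cmp[OF assms(1) g(1) assms(2)] assms g
      Fun_Idn[OF assms(1)] hom_objs[OF Fun_cats(1)[OF assms(1)] assms(2)]
    by (intro isoI[of _ _ "onObj F a" "onObj F b" "onArr F g"]) (auto intro: Fun_hom)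
qed

lemma bij_betw_hom_of_inverse_functors:
  assumes V: "V \<in> Fun C D" and W: "W \<in> Fun D C"
    and inv: "W \<odot> V = id_fun C" "V \<odot> W = id_fun D" and a: "a \<in> Obj C" and b: "b \<in> Obj C"
  shows "bij_betw (onArr V) (hom C a b) (hom D (onObj V a) (onObj V b))"
proof (rule bij_betwI[where g = "onArr W"])
  note s = Fun_simps[OF V] Fun_simps[OF W]
  have o: "onObj W (onObj V x) = x" if "x \<in> Obj C" for x
    using comp_fun_simps(3)[of x V W] that inv(1) by (simp add: s id_fun_simps)
  show "onArr V \<in> hom C a b \<rightarrow> hom D (onObj V a) (onObj V b)"
    using Fun_hom[OF V] by auto
  show "onArr W \<in> hom D (onObj V a) (onObj V b) \<rightarrow> hom C a b"
    using Fun_hom[OF W] o[OF a] o[OF b] by (metis Pi_I)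
  show "onArr W (onArr V f) = f" if "f \<in> hom C a b" for f
    using comp_fun_simps(4)[of f V W] that inv(1) by (simp add: s id_fun_simps hom_Arr)
  show "onArr V (onArr W f) = f" if "f \<in> hom D (onObj V a) (onObj V b)" for f
    using comp_fun_simps(4)[of f W V] that inv(2) by (simp add: s id_fun_simps hom_Arr)
qed

lemma category_mk_cat:
  assumes "\<And>f. f \<in> Ar \<Longrightarrow> d f \<in> Ob \<and> c f \<in> Ob"
    "\<And>a. a \<in> Ob \<Longrightarrow> i a \<in> Ar \<and> d (i a) = a \<and> c (i a) = a"
    "\<And>f g. f \<in> Ar \<Longrightarrow> g \<in> Ar \<Longrightarrow> c f = d g \<Longrightarrow> m g f \<in> Ar \<and> d (m g f) = d f \<and> c (m g f) = c g"
    "\<And>f. f \<in> Ar \<Longrightarrow> m f (i (d f)) = f \<and> m (i (c f)) f = f"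
    "\<And>f g h. f \<in> Ar \<Longrightarrow> g \<in> Ar \<Longrightarrow> h \<in> Ar \<Longrightarrow> c f = d g \<Longrightarrow> c g = d h \<Longrightarrow> m h (m g f) = m (m h g) f"
  shows "category (mk_cat Ob Ar d c i m)"
proof -
  let ?C = "mk_cat Ob Ar d c i m"
  have h: "f \<in> hom ?C a b \<longleftrightarrow> f \<in> Ar \<and> d f = a \<and> c f = b" for f a b
    by (auto simp: mk_cat_def hom_def)
  show ?thesis
    by unfold_locales (unfold h, use assms in \<open>auto simp: mk_cat_def\<close>)
qed

section \<open>Universal arrows\<close>

text \<open>The initial objects \<open>(T, f)\<close> of the comma category of \<open>X\<close> over \<open>G\<close>. In this form a homotopy colimit or
a left Kan extension is a property of an arrow, and no adjoint has to be chosen.\<close>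

definition universal_arrow :: "('o, 'a, 'p, 'b) functr \<Rightarrow> 'p \<Rightarrow> 'o \<Rightarrow> 'b \<Rightarrow> bool" where
  "universal_arrow G X T f \<longleftrightarrow>
     X \<in> Obj (Trg G) \<and> T \<in> Obj (Src G) \<and> f \<in> hom (Trg G) X (onObj G T) \<and>
     (\<forall>T' \<in> Obj (Src G). \<forall>g \<in> hom (Trg G) X (onObj G T').
        \<exists>!h. h \<in> hom (Src G) T T' \<and> Cmp (Trg G) (onArr G h) f = g)"

text \<open>An arrow out of an initial object has an initial target iff it is invertible.\<close>

lemma universal_arrow_change_target:
  assumes "G \<in> Fun D C" "universal_arrow G X T f" "t \<in> hom D T T'"
    and "Cmp C (onArr G t) f = f'"
  shows "universal_arrow G X T' f' \<longleftrightarrow> iso D t"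
proof
  interpret C: category C using assms(1) Fun_cats by metis
  interpret D: category D using assms(1) Fun_cats by metis
  note G[simp] = Fun_simps[OF assms(1)]
  have f: "f \<in> hom C X (onObj G T)" and T: "T \<in> Obj D" and X: "X \<in> Obj C"
    using assms(2) by (auto simp: universal_arrow_def)
  have u: "\<exists>!h. h \<in> hom D T S \<and> Cmp C (onArr G h) f = g" if "g \<in> hom C X (onObj G S)" "S \<in> Obj D" for g S
    using assms(2) that by (auto simp: universal_arrow_def)
  have T': "T' \<in> Obj D" using hom_objs[OF D.category_axioms assms(3)] by simp
  have Gt: "onArr G t \<in> hom C (onObj G T) (onObj G T')" using Fun_hom[OF assms(1,3)] .
  have f': "f' \<in> hom C X (onObj G T')" using f Gt assms(4) C.Cmp_hom by metis
  { assume i: "iso D t"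
    then obtain s where s: "s \<in> hom D T' T" "Cmp D s t = Idn D T" "Cmp D t s = Idn D T'"
      using assms(3) by (rule isoE)
    have *: "\<exists>!h. h \<in> hom D T' S \<and> Cmp C (onArr G h) f' = g" if g: "g \<in> hom C X (onObj G S)" "S \<in> Obj D" for g S
    proof -
      obtain h where h: "h \<in> hom D T S" "Cmp C (onArr G h) f = g"
        and un: "\<And>k. k \<in> hom D T S \<Longrightarrow> Cmp C (onArr G k) f = g \<Longrightarrow> k = h" using u[OF g] by metis
      have key: "Cmp C (onArr G k) f' = Cmp C (onArr G (Cmp D k t)) f" if "k \<in> hom D T' S" for k
        using that assms(4) C.Cmp_assoc[OF f Gt Fun_hom[OF assms(1) that]] Fun_Cmp[OF assms(1,3) that] by simp
      show ?thesis
      proof (rule ex1I[of _ "Cmp D h s"], intro conjI)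
        show hs: "Cmp D h s \<in> hom D T' S" using h s D.Cmp_hom by metis
        have "Cmp D (Cmp D h s) t = h"
          using D.Cmp_assoc[OF assms(3) s(1) h(1)] s D.Cmp_Idn_right h by simp
        then show "Cmp C (onArr G (Cmp D h s)) f' = g" using key[OF hs] h by simp
      next
        fix k assume k: "k \<in> hom D T' S \<and> Cmp C (onArr G k) f' = g"
        then have "Cmp D k t = h" using un key D.Cmp_hom assms(3) by metis
        then show "k = Cmp D h s"
          using D.Cmp_assoc[OF s(1) assms(3), of k S] s k D.Cmp_Idn_right[of k T' S] by simp
      qed
    qed
    then show "universal_arrow G X T' f'"
      using X T' f' by (auto simp: universal_arrow_def)
  }
  { assume "universal_arrow G X T' f'"
    then have u': "\<exists>!h. h \<in> hom D T' S \<and> Cmp C (onArr G h) f' = g" if "g \<in> hom C X (onObj G S)" "S \<in> Obj D" for g S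
      using that by (auto simp: universal_arrow_def)
    obtain s where s: "s \<in> hom D T' T" "Cmp C (onArr G s) f' = f" using u'[OF f T] by auto
    have Gs: "onArr G s \<in> hom C (onObj G T') (onObj G T)" using Fun_hom[OF assms(1) s(1)] .
    have "Cmp C (onArr G (Cmp D s t)) f = f"
      using C.Cmp_assoc[OF f Gt Gs] Fun_Cmp[OF assms(1,3) s(1)] s assms(4) by simp
    moreover have "Cmp C (onArr G (Idn D T)) f = f"
      using Fun_Idn[OF assms(1) T] f C.Cmp_Idn_left by simp
    ultimately have 1: "Cmp D s t = Idn D T"
      using u[OF f T] D.Cmp_hom[OF assms(3) s(1)] D.Idn_hom[OF T] by blast
    have "Cmp C (onArr G (Cmp D t s)) f' = f'"
      using C.Cmp_assoc[OF f' Gs Gt] Fun_Cmp[OF assms(1) s(1) assms(3)] s assms(4) by simp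
    moreover have "Cmp C (onArr G (Idn D T')) f' = f'"
      using Fun_Idn[OF assms(1) T'] f' C.Cmp_Idn_left by simp
    ultimately have 2: "Cmp D t s = Idn D T'"
      using u'[OF f' T'] D.Cmp_hom[OF s(1) assms(3)] D.Idn_hom[OF T'] by blast
    show "iso D t" using isoI[OF assms(3) s(1) 1 2] .
  }
qed

lemma universal_arrow_precompose_iso:
  assumes "G \<in> Fun D C" "universal_arrow G X T f" "a \<in> hom C X' X" "iso C a"
  shows "universal_arrow G X' T (Cmp C f a)"
proof -
  interpret C: category C using assms(1) Fun_cats by metis
  interpret D: category D using assms(1) Fun_cats by metis
  note G[simp] = Fun_simps[OF assms(1)]
  have f: "f \<in> hom C X (onObj G T)" and T: "T \<in> Obj D" and X: "X \<in> Obj C"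
    using assms(2) by (auto simp: universal_arrow_def)
  obtain b where b: "b \<in> hom C X X'" "Cmp C b a = Idn C X'" "Cmp C a b = Idn C X"
    using assms(3,4) isoE by metis
  have "\<exists>!h. h \<in> hom D T S \<and> Cmp C (onArr G h) (Cmp C f a) = g"
    if g: "g \<in> hom C X' (onObj G S)" "S \<in> Obj D" for g S
  proof -
    have gb: "Cmp C g b \<in> hom C X (onObj G S)" using g b C.Cmp_hom by metis
    have gba: "Cmp C (Cmp C g b) a = g"
      using C.Cmp_assoc[OF assms(3) b(1) g(1)] b C.Cmp_Idn_right g by simp
    have "Cmp C (onArr G h) (Cmp C f a) = g \<longleftrightarrow> Cmp C (onArr G h) f = Cmp C g b" if h: "h \<in> hom D T S" for h
    proof -
      have Gh: "onArr G h \<in> hom C (onObj G T) (onObj G S)" using Fun_hom[OF assms(1) h] .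
      have e: "Cmp C (onArr G h) (Cmp C f a) = Cmp C (Cmp C (onArr G h) f) a"
        by (rule C.Cmp_assoc[OF assms(3) f Gh])
      have Ghf: "Cmp C (onArr G h) f \<in> hom C X (onObj G S)" using f Gh C.Cmp_hom by metis
      have "Cmp C (Cmp C (Cmp C (onArr G h) f) a) b = Cmp C (onArr G h) f"
        using C.Cmp_assoc[OF b(1) assms(3) Ghf] b C.Cmp_Idn_right Ghf by simp
      then show ?thesis using e gba by metis
    qed
    moreover have "\<exists>!h. h \<in> hom D T S \<and> Cmp C (onArr G h) f = Cmp C g b"
      using assms(2) gb g by (auto simp: universal_arrow_def)
    ultimately show ?thesis by metis
  qed
  then show ?thesis
    using hom_objs[OF C.category_axioms assms(3)] T C.Cmp_hom[OF assms(3) f]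
    by (auto simp: universal_arrow_def)
qed

text \<open>Universality of \<open>f\<close> only concerns the sets of arrows from \<open>X\<close> to objects \<open>G T'\<close>, on which \<open>V\<close> is assumed to
be a bijection. Three instances matter: \<open>V\<close> is restriction along a final functor; \<open>V\<close> is restriction to
a subposet from which \<open>X\<close> is Kan extended; \<open>V\<close> is the isomorphism between diagrams over a subposet and
diagrams over the slice isomorphic to it.\<close>

lemma universal_arrow_along_functor:
  assumes G: "G \<in> Fun D C" and V: "V \<in> Fun C C'"
    and bij: "\<And>T'. T' \<in> Obj D \<Longrightarrow>
      bij_betw (onArr V) (hom C X (onObj G T')) (hom C' (onObj V X) (onObj V (onObj G T')))"
    and f: "f \<in> hom C X (onObj G T)" and T: "T \<in> Obj D"
  shows "universal_arrow (V \<odot> G) (onObj V X) T (onArr V f) \<longleftrightarrow> universal_arrow G X T f"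
proof -
  interpret C: category C using G Fun_cats by metis
  note s = Fun_simps[OF G] Fun_simps[OF V]
  have X: "X \<in> Obj C" using hom_objs[OF C.category_axioms f] by simp
  have key: "Cmp C' (onArr (V \<odot> G) h) (onArr V f) = onArr V g \<longleftrightarrow> Cmp C (onArr G h) f = g"
    if h: "h \<in> hom D T T'" and g: "g \<in> hom C X (onObj G T')" for h g T'
  proof -
    have T': "T' \<in> Obj D" using hom_objs[OF _ h] Fun_cats[OF G] by simp
    have Gh: "onArr G h \<in> hom C (onObj G T) (onObj G T')" using Fun_hom[OF G h] .
    have "Cmp C' (onArr (V \<odot> G) h) (onArr V f) = onArr V (Cmp C (onArr G h) f)"
      using Fun_Cmp[OF V f Gh] h by (simp add: comp_fun_simps s hom_Arr)
    then show ?thesis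
      using bij[OF T'] C.Cmp_hom[OF f Gh] g by (auto simp: bij_betw_def dest: inj_onD)
  qed
  have "(\<forall>g' \<in> hom C' (onObj V X) (onObj (V \<odot> G) T').
        \<exists>!h. h \<in> hom D T T' \<and> Cmp C' (onArr (V \<odot> G) h) (onArr V f) = g') \<longleftrightarrow>
      (\<forall>g \<in> hom C X (onObj G T'). \<exists>!h. h \<in> hom D T T' \<and> Cmp C (onArr G h) f = g)"
    if T': "T' \<in> Obj D" for T'
  proof -
    have "hom C' (onObj V X) (onObj (V \<odot> G) T') = onArr V ` hom C X (onObj G T')"
      using bij[OF T'] T' by (simp add: bij_betw_def comp_fun_simps s)
    then have "(\<forall>g' \<in> hom C' (onObj V X) (onObj (V \<odot> G) T').
        \<exists>!h. h \<in> hom D T T' \<and> Cmp C' (onArr (V \<odot> G) h) (onArr V f) = g') \<longleftrightarrow>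
      (\<forall>g \<in> hom C X (onObj G T').
        \<exists>!h. h \<in> hom D T T' \<and> Cmp C' (onArr (V \<odot> G) h) (onArr V f) = onArr V g)"
      by simp
    also have "\<dots> \<longleftrightarrow> (\<forall>g \<in> hom C X (onObj G T'). \<exists>!h. h \<in> hom D T T' \<and> Cmp C (onArr G h) f = g)"
      by (simp add: key cong: conj_cong)
    finally show ?thesis .
  qed
  then show ?thesis
    using X T f Fun_Obj[OF V X] Fun_hom[OF V f]
    by (simp add: universal_arrow_def comp_fun_simps s)
qed

lemma universal_arrow_id_fun:
  assumes "category D" "f \<in> hom D W T"
  shows "universal_arrow (id_fun D) W T f \<longleftrightarrow> iso D f"
proof -
  interpret category D by fact
  have o: "W \<in> Obj D" "T \<in> Obj D" using hom_objs[OF assms] by auto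
  have "universal_arrow (id_fun D) W W (Idn D W)"
    using o Cmp_Idn_right by (auto simp: universal_arrow_def id_fun_simps Idn_hom hom_Arr)
  then show ?thesis
    using universal_arrow_change_target[OF id_fun_Fun[OF assms(1)] _ assms(2)] assms Cmp_Idn_right
    by (auto simp: id_fun_simps hom_Arr)
qed

text \<open>The hypothesis says that \<open>T\<close> is a left Kan extension of its own restriction \<open>G T\<close>.\<close>

lemma bij_betw_of_universal_Idn:
  assumes G: "G \<in> Fun D C" and u: "universal_arrow G (onObj G T) T (Idn C (onObj G T))"
    and T': "T' \<in> Obj D"
  shows "bij_betw (onArr G) (hom D T T') (hom C (onObj G T) (onObj G T'))"
proof -
  interpret C: category C using Fun_cats[OF G] by auto
  have r: "Cmp C (onArr G h) (Idn C (onObj G T)) = onArr G h" if "h \<in> hom D T T'" for h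
    using C.Cmp_Idn_right[OF Fun_hom[OF G that]] .
  have ex1: "\<exists>!h. h \<in> hom D T T' \<and> onArr G h = g" if "g \<in> hom C (onObj G T) (onObj G T')" for g
  proof -
    have "\<exists>!h. h \<in> hom D T T' \<and> Cmp C (onArr G h) (Idn C (onObj G T)) = g"
      using u that T' by (simp add: universal_arrow_def Fun_simps[OF G])
    then show ?thesis using r by (metis (no_types, lifting))
  qed
  show ?thesis
    unfolding bij_betw_def
  proof
    show "inj_on (onArr G) (hom D T T')"
      using ex1 Fun_hom[OF G] by (intro inj_onI) metis
    show "onArr G ` hom D T T' = hom C (onObj G T) (onObj G T')"
      using ex1 Fun_hom[OF G] by (auto simp: image_iff) metis
  qed
qed

section \<open>Adjunctions\<close>

lemma Nat_hom:
  assumes "\<alpha> \<in> Nat F G" "F \<in> Fun C D" "a \<in> Obj C"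
  shows "component \<alpha> a \<in> hom D (onObj F a) (onObj G a)"
  using assms by (auto simp: Nat_def Fun_simps[OF assms(2)])

lemma Nat_natural:
  assumes "\<alpha> \<in> Nat F G" "F \<in> Fun C D" "f \<in> hom C a b"
  shows "Cmp D (onArr G f) (component \<alpha> a) = Cmp D (component \<alpha> b) (onArr F f)"
  using assms(1,3) by (auto simp: Nat_def Fun_simps[OF assms(2)] hom_def)

lemma NatI:
  assumes "F \<in> Fun C D" "G \<in> Fun C D" "NSrc \<alpha> = F" "NTrg \<alpha> = G"
    "component \<alpha> \<in> extensional (Obj C)"
    "\<And>a. a \<in> Obj C \<Longrightarrow> component \<alpha> a \<in> hom D (onObj F a) (onObj G a)"
    "\<And>f a b. f \<in> hom C a b \<Longrightarrow>
       Cmp D (onArr G f) (component \<alpha> a) = Cmp D (component \<alpha> b) (onArr F f)"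
  shows "\<alpha> \<in> Nat F G"
  using assms unfolding Nat_def by (auto simp: Fun_simps[OF assms(1)] Fun_simps[OF assms(2)] dest: Arr_hom)

lemma NSrc_Nat: "\<alpha> \<in> Nat F G \<Longrightarrow> NSrc \<alpha> = F" "\<alpha> \<in> Nat F G \<Longrightarrow> NTrg \<alpha> = G"
  by (auto simp: Nat_def)

lemma adjunction_right_Fun: "adjunction L R \<eta> \<epsilon> \<Longrightarrow> L \<in> Fun C D \<Longrightarrow> R \<in> Fun D C"
  by (auto simp: adjunction_def Fun_simps)

lemma adjunctionD:
  assumes "adjunction L R \<eta> \<epsilon>" "R \<in> Fun D C"
  shows "L \<in> Fun C D"
    and "X \<in> Obj C \<Longrightarrow> component \<eta> X \<in> hom C X (onObj R (onObj L X))"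
    and "Y \<in> Obj D \<Longrightarrow> component \<epsilon> Y \<in> hom D (onObj L (onObj R Y)) Y"
    and "f \<in> hom C X X' \<Longrightarrow> Cmp C (onArr R (onArr L f)) (component \<eta> X) = Cmp C (component \<eta> X') f"
    and "g \<in> hom D Y Y' \<Longrightarrow> Cmp D g (component \<epsilon> Y) = Cmp D (component \<epsilon> Y') (onArr L (onArr R g))"
    and "X \<in> Obj C \<Longrightarrow> Cmp D (component \<epsilon> (onObj L X)) (onArr L (component \<eta> X)) = Idn D (onObj L X)"
    and "Y \<in> Obj D \<Longrightarrow> Cmp C (onArr R (component \<epsilon> Y)) (component \<eta> (onObj R Y)) = Idn C (onObj R Y)"
proof -
  have a: "L \<in> Fun (Src L) (Trg L)" "R \<in> Fun (Trg L) (Src L)"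
    "\<eta> \<in> Nat (id_fun (Src L)) (R \<odot> L)" "\<epsilon> \<in> Nat (L \<odot> R) (id_fun (Trg L))"
    "(\<epsilon> \<triangleleft> L) \<bullet> (L \<triangleright> \<eta>) = id_nat L" "(R \<triangleright> \<epsilon>) \<bullet> (\<eta> \<triangleleft> R) = id_nat R"
    using assms(1) by (auto simp: adjunction_def)
  have s: "Src L = C" "Trg L = D" "Src R = D" "Trg R = C"
    using Fun_simps[OF a(2)] Fun_simps[OF assms(2)] by auto
  show L: "L \<in> Fun C D" using a s by simp
  have c: "category C" "category D" using Fun_cats[OF L] by auto
  have \<eta>: "\<eta> \<in> Nat (id_fun C) (R \<odot> L)" and \<epsilon>: "\<epsilon> \<in> Nat (L \<odot> R) (id_fun D)" using a s by auto
  have RL: "L \<odot> R \<in> Fun D D" using comp_fun_Fun L assms(2) by metis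
  show "component \<eta> X \<in> hom C X (onObj R (onObj L X))" if "X \<in> Obj C" for X
    using Nat_hom[OF \<eta> id_fun_Fun[OF c(1)] that] that by (simp add: id_fun_simps comp_fun_simps s)
  show "component \<epsilon> Y \<in> hom D (onObj L (onObj R Y)) Y" if "Y \<in> Obj D" for Y
    using Nat_hom[OF \<epsilon> RL that] that by (simp add: id_fun_simps comp_fun_simps s)
  show "Cmp C (onArr R (onArr L f)) (component \<eta> X) = Cmp C (component \<eta> X') f" if "f \<in> hom C X X'" for f X X'
    using Nat_natural[OF \<eta> id_fun_Fun[OF c(1)] that] that by (simp add: id_fun_simps comp_fun_simps s hom_Arr)
  show "Cmp D g (component \<epsilon> Y) = Cmp D (component \<epsilon> Y') (onArr L (onArr R g))" if "g \<in> hom D Y Y'" for g Y Y'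
    using Nat_natural[OF \<epsilon> RL that] that by (simp add: id_fun_simps comp_fun_simps s hom_Arr)
  have n: "NSrc \<eta> = id_fun C" "NSrc \<epsilon> = L \<odot> R" "NTrg \<epsilon> = id_fun D" using \<eta> \<epsilon> by (auto simp: Nat_def)
  show "Cmp D (component \<epsilon> (onObj L X)) (onArr L (component \<eta> X)) = Idn D (onObj L X)" if "X \<in> Obj C" for X
    using arg_cong[OF a(5), of "\<lambda>n. component n X"] that Fun_Obj[OF L that]
    by (simp add: vcomp_def whisker_left_def whisker_right_def id_nat_def mk_nat_def comp_fun_simps id_fun_simps s n)
  show "Cmp C (onArr R (component \<epsilon> Y)) (component \<eta> (onObj R Y)) = Idn C (onObj R Y)" if "Y \<in> Obj D" for Y
    using arg_cong[OF a(6), of "\<lambda>n. component n Y"] that Fun_Obj[OF assms(2) that]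
    by (simp add: vcomp_def whisker_left_def whisker_right_def id_nat_def mk_nat_def comp_fun_simps id_fun_simps s n)
qed

text \<open>The unique arrow belonging to \<open>g\<close> is its transpose \<open>\<epsilon>\<^sub>T \<circ> L g\<close>.\<close>

lemma adjunction_unit_universal:
  assumes "adjunction L R \<eta> \<epsilon>" "R \<in> Fun D C" "X \<in> Obj C"
  shows "universal_arrow R X (onObj L X) (component \<eta> X)"
proof -
  interpret C: category C using assms(2) Fun_cats by metis
  interpret D: category D using assms(2) Fun_cats by metis
  note a = adjunctionD[OF assms(1,2)]
  note \<eta> = a(2)[OF assms(3)]
  have "\<exists>!h. h \<in> hom D (onObj L X) T \<and> Cmp C (onArr R h) (component \<eta> X) = g"
    if T: "T \<in> Obj D" and g: "g \<in> hom C X (onObj R T)" for T g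
  proof (rule ex1I[of _ "Cmp D (component \<epsilon> T) (onArr L g)"])
    have Lg: "onArr L g \<in> hom D (onObj L X) (onObj L (onObj R T))" using Fun_hom[OF a(1) g] .
    have RT: "onObj R T \<in> Obj C" using Fun_Obj[OF assms(2) T] .
    have "Cmp C (onArr R (Cmp D (component \<epsilon> T) (onArr L g))) (component \<eta> X) =
        Cmp C (onArr R (component \<epsilon> T)) (Cmp C (onArr R (onArr L g)) (component \<eta> X))"
      using Fun_Cmp[OF assms(2) Lg a(3)[OF T]]
        C.Cmp_assoc[OF \<eta> Fun_hom[OF assms(2) Lg] Fun_hom[OF assms(2) a(3)[OF T]]] by simp
    also have "\<dots> = g"
      using a(4)[OF g] a(7)[OF T] C.Cmp_Idn_left[OF g]
        C.Cmp_assoc[OF g a(2)[OF RT] Fun_hom[OF assms(2) a(3)[OF T]]] by simp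
    finally show "Cmp D (component \<epsilon> T) (onArr L g) \<in> hom D (onObj L X) T \<and>
       Cmp C (onArr R (Cmp D (component \<epsilon> T) (onArr L g))) (component \<eta> X) = g"
      using D.Cmp_hom[OF Lg a(3)[OF T]] by simp
  next
    fix h assume "h \<in> hom D (onObj L X) T \<and> Cmp C (onArr R h) (component \<eta> X) = g"
    then have h: "h \<in> hom D (onObj L X) T" and e: "g = Cmp C (onArr R h) (component \<eta> X)" by auto
    have LX: "onObj L X \<in> Obj D" using Fun_Obj[OF a(1) assms(3)] .
    have "onArr L g = Cmp D (onArr L (onArr R h)) (onArr L (component \<eta> X))"
      using e Fun_Cmp[OF a(1) \<eta> Fun_hom[OF assms(2) h]] by simp
    then have "Cmp D (component \<epsilon> T) (onArr L g) = Cmp D (Cmp D h (component \<epsilon> (onObj L X))) (onArr L (component \<eta> X))"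
      using a(5)[OF h] D.Cmp_assoc[OF Fun_hom[OF a(1) \<eta>] Fun_hom[OF a(1) Fun_hom[OF assms(2) h]] a(3)[OF T]] by simp
    also have "\<dots> = h"
      using D.Cmp_assoc[OF Fun_hom[OF a(1) \<eta>] a(3)[OF LX] h] a(6)[OF assms(3)] D.Cmp_Idn_right[OF h] by simp
    finally show "h = Cmp D (component \<epsilon> T) (onArr L g)" by simp
  qed
  then show ?thesis
    using assms(3) \<eta> Fun_Obj[OF a(1) assms(3)] Fun_simps[OF assms(2)] by (simp add: universal_arrow_def)
qed

text \<open>The unit at \<open>X\<close> is universal too, and the transpose of \<open>f\<close> is the arrow that compares the two.\<close>

lemma universal_arrow_iff_iso_transpose:
  assumes "adjunction L R \<eta> \<epsilon>" "R \<in> Fun D C" "T \<in> Obj D" "f \<in> hom C X (onObj R T)"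
  shows "universal_arrow R X T f \<longleftrightarrow> iso D (Cmp D (component \<epsilon> T) (onArr L f))"
proof -
  interpret C: category C using assms(2) Fun_cats by metis
  interpret D: category D using assms(2) Fun_cats by metis
  note a = adjunctionD[OF assms(1,2)]
  have X: "X \<in> Obj C" using hom_objs[OF C.category_axioms assms(4)] by simp
  have Lg: "onArr L f \<in> hom D (onObj L X) (onObj L (onObj R T))" using Fun_hom[OF a(1) assms(4)] .
  have RT: "onObj R T \<in> Obj C" using Fun_Obj[OF assms(2,3)] .
  have "Cmp C (onArr R (Cmp D (component \<epsilon> T) (onArr L f))) (component \<eta> X) =
      Cmp C (onArr R (component \<epsilon> T)) (Cmp C (onArr R (onArr L f)) (component \<eta> X))"
    using Fun_Cmp[OF assms(2) Lg a(3)[OF assms(3)]]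
      C.Cmp_assoc[OF a(2)[OF X] Fun_hom[OF assms(2) Lg] Fun_hom[OF assms(2) a(3)[OF assms(3)]]] by simp
  also have "\<dots> = f"
    using a(4)[OF assms(4)] a(7)[OF assms(3)] C.Cmp_Idn_left[OF assms(4)]
      C.Cmp_assoc[OF assms(4) a(2)[OF RT] Fun_hom[OF assms(2) a(3)[OF assms(3)]]] by simp
  finally show ?thesis
    using universal_arrow_change_target[OF assms(2) adjunction_unit_universal[OF assms(1,2) X]
        D.Cmp_hom[OF Lg a(3)[OF assms(3)]]] by blast
qed

section \<open>Opposite categories\<close>

text \<open>Only the fields are exchanged, so that taking opposites twice is the identity on the nose and an
opposite functor has the same maps on objects and arrows.\<close>

definition op_cat :: "('o, 'a) cat \<Rightarrow> ('o, 'a) cat" where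
  "op_cat C = \<lparr>Obj = Obj C, Arr = Arr C, Dom = Cod C, Cod = Dom C, Idn = Idn C, Cmp = (\<lambda>g f. Cmp C f g)\<rparr>"

definition op_fun :: "('o, 'a, 'p, 'b) functr \<Rightarrow> ('o, 'a, 'p, 'b) functr" where
  "op_fun F = \<lparr>Src = op_cat (Src F), Trg = op_cat (Trg F), onObj = onObj F, onArr = onArr F\<rparr>"

definition op_nat :: "('o, 'a, 'p, 'b) nattrans \<Rightarrow> ('o, 'a, 'p, 'b) nattrans" where
  "op_nat \<alpha> = \<lparr>NSrc = op_fun (NTrg \<alpha>), NTrg = op_fun (NSrc \<alpha>), component = component \<alpha>\<rparr>"

lemma op_simps [simp]:
  "Obj (op_cat C) = Obj C" "Arr (op_cat C) = Arr C" "Dom (op_cat C) = Cod C" "Cod (op_cat C) = Dom C"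
  "Idn (op_cat C) = Idn C" "Cmp (op_cat C) g f = Cmp C f g" "hom (op_cat C) a b = hom C b a"
  "Src (op_fun F) = op_cat (Src F)" "Trg (op_fun F) = op_cat (Trg F)"
  "onObj (op_fun F) = onObj F" "onArr (op_fun F) = onArr F"
  "NSrc (op_nat \<alpha>) = op_fun (NTrg \<alpha>)" "NTrg (op_nat \<alpha>) = op_fun (NSrc \<alpha>)"
  "component (op_nat \<alpha>) = component \<alpha>"
  by (auto simp: op_cat_def op_fun_def op_nat_def hom_def)

lemma category_op:
  assumes "category C"
  shows "category (op_cat C)"
proof -
  interpret category C by fact
  show ?thesis
    by unfold_locales
       (auto simp: Dom_type Cod_type Idn_ext Idn_hom Cmp_hom Cmp_Idn_right Cmp_Idn_left Cmp_ext Cmp_assoc)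
qed

lemma iso_op [simp]: "iso (op_cat C) f \<longleftrightarrow> iso C f"
  by (auto simp: iso_def)

lemma isomorphic_op: "isomorphic (op_cat C) a b \<longleftrightarrow> isomorphic C a b"
proof -
  have "isomorphic C b a" if i: "isomorphic C a b" for a b
  proof -
    obtain f where f: "f \<in> hom C a b" "iso C f" using i by (auto simp: isomorphic_def)
    then obtain g where "g \<in> hom C b a" "Cmp C g f = Idn C a" "Cmp C f g = Idn C b" by (auto elim: isoE)
    then show ?thesis using isoI[OF _ f(1)] by (auto simp: isomorphic_def)
  qed
  then show ?thesis by (auto simp: isomorphic_def)
qed

lemma op_fun_Fun: "F \<in> Fun C D \<Longrightarrow> op_fun F \<in> Fun (op_cat C) (op_cat D)"
  by (rule FunI) (auto simp: Fun_simps Fun_cats category_op Fun_Obj Fun_hom Fun_Idn Fun_Cmp, auto simp: Fun_def PiE_def)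

lemma op_fun_comp: "op_fun (G \<odot> F) = op_fun G \<odot> op_fun F"
  by (simp add: op_fun_def comp_fun_def mk_fun_def)

lemma op_fun_id: "op_fun (id_fun C) = id_fun (op_cat C)"
  by (simp add: op_fun_def id_fun_def mk_fun_def)

lemma op_nat_Nat:
  assumes "\<alpha> \<in> Nat F G"
  shows "op_nat \<alpha> \<in> Nat (op_fun G) (op_fun F)"
proof -
  have F: "F \<in> Fun (Src F) (Trg F)" and G: "G \<in> Fun (Src F) (Trg F)"
    using assms by (auto simp: Nat_def)
  show ?thesis
    using Nat_hom[OF assms F] Nat_natural[OF assms F, symmetric] assms
    by (intro NatI[OF op_fun_Fun[OF G] op_fun_Fun[OF F]]) (auto simp: Nat_def)
qed

lemma op_nat_whisker_left: "op_nat (H \<triangleright> \<alpha>) = op_fun H \<triangleright> op_nat \<alpha>" if "Src (NSrc \<alpha>) = Src (NTrg \<alpha>)"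
  using that by (simp add: op_nat_def whisker_left_def mk_nat_def op_fun_comp comp_fun_simps)

lemma op_nat_whisker_right: "op_nat (\<alpha> \<triangleleft> F) = op_nat \<alpha> \<triangleleft> op_fun F"
  by (simp add: op_nat_def whisker_right_def mk_nat_def op_fun_comp comp_fun_simps)

lemma op_nat_vcomp: "op_nat (\<beta> \<bullet> \<alpha>) = op_nat \<alpha> \<bullet> op_nat \<beta>"
  if "Src (NSrc \<alpha>) = Src (NTrg \<beta>)" "Trg (NSrc \<alpha>) = Trg (NTrg \<beta>)"
  using that by (simp add: op_nat_def vcomp_def mk_nat_def)

lemma op_nat_id: "op_nat (id_nat F) = id_nat (op_fun F)"
  by (simp add: op_nat_def id_nat_def mk_nat_def)

lemma adjunction_op:
  assumes "adjunction L R \<eta> \<epsilon>"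
  shows "adjunction (op_fun R) (op_fun L) (op_nat \<epsilon>) (op_nat \<eta>)"
proof -
  have a: "L \<in> Fun (Src L) (Trg L)" "R \<in> Fun (Trg L) (Src L)"
    "\<eta> \<in> Nat (id_fun (Src L)) (R \<odot> L)" "\<epsilon> \<in> Nat (L \<odot> R) (id_fun (Trg L))"
    "(\<epsilon> \<triangleleft> L) \<bullet> (L \<triangleright> \<eta>) = id_nat L" "(R \<triangleright> \<epsilon>) \<bullet> (\<eta> \<triangleleft> R) = id_nat R"
    using assms by (auto simp: adjunction_def)
  have s: "Src R = Trg L" "Trg R = Src L" using Fun_simps[OF a(2)] by auto
  have n: "NSrc \<eta> = id_fun (Src L)" "NTrg \<eta> = R \<odot> L" "NSrc \<epsilon> = L \<odot> R" "NTrg \<epsilon> = id_fun (Trg L)"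
    using a(3,4) by (auto simp: Nat_def)
  have w: "op_nat (L \<triangleright> \<eta>) = op_fun L \<triangleright> op_nat \<eta>" "op_nat (R \<triangleright> \<epsilon>) = op_fun R \<triangleright> op_nat \<epsilon>"
    by (simp_all add: op_nat_whisker_left n id_fun_simps comp_fun_simps s)
  have "(op_fun L \<triangleright> op_nat \<eta>) \<bullet> (op_nat \<epsilon> \<triangleleft> op_fun L) = id_nat (op_fun L)"
    using arg_cong[OF a(5), of op_nat]
    by (subst (asm) op_nat_vcomp)
       (simp_all add: w op_nat_id op_nat_whisker_right,
        simp_all add: whisker_left_def whisker_right_def mk_nat_def comp_fun_simps n id_fun_simps s)
  moreover have "(op_nat \<eta> \<triangleleft> op_fun R) \<bullet> (op_fun R \<triangleright> op_nat \<epsilon>) = id_nat (op_fun R)"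
    using arg_cong[OF a(6), of op_nat]
    by (subst (asm) op_nat_vcomp)
       (simp_all add: w op_nat_id op_nat_whisker_right,
        simp_all add: whisker_left_def whisker_right_def mk_nat_def comp_fun_simps n id_fun_simps s)
  ultimately show ?thesis
    using op_fun_Fun[OF a(1)] op_fun_Fun[OF a(2)] op_nat_Nat[OF a(3)] op_nat_Nat[OF a(4)]
    by (simp add: adjunction_def s op_fun_comp op_fun_id)
qed

section \<open>Kan extensions as universal arrows\<close>

text \<open>The essential image of a left adjoint does not depend on the adjoint: its members are the targets of
universal arrows, and those are unique up to isomorphism.\<close>

lemma kan_extension_iff_universal_arrow:
  assumes U: "U \<in> Fun D C" and ex: "\<exists>L \<eta> \<epsilon>. adjunction L U \<eta> \<epsilon>"
  shows "(\<exists>L \<eta> \<epsilon>. adjunction L U \<eta> \<epsilon> \<and> Y \<in> ess_image L) \<longleftrightarrow> (\<exists>Z \<eta>. universal_arrow U Z Y \<eta>)"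
proof
  assume "\<exists>L \<eta> \<epsilon>. adjunction L U \<eta> \<epsilon> \<and> Y \<in> ess_image L"
  then obtain L \<eta> \<epsilon> where a: "adjunction L U \<eta> \<epsilon>" and Y: "Y \<in> ess_image L" by auto
  note s = Fun_simps[OF adjunctionD(1)[OF a U]]
  obtain Z t where Z: "Z \<in> Obj C" and t: "t \<in> hom D (onObj L Z) Y" "iso D t"
    using Y by (auto simp: ess_image_def isomorphic_def s)
  then show "\<exists>Z \<eta>. universal_arrow U Z Y \<eta>"
    using universal_arrow_change_target[OF U adjunction_unit_universal[OF a U Z] t(1) refl] by blast
next
  assume "\<exists>Z \<eta>. universal_arrow U Z Y \<eta>"
  then obtain Z f where u: "universal_arrow U Z Y f" by auto
  obtain L \<eta> \<epsilon> where a: "adjunction L U \<eta> \<epsilon>" using ex by auto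
  note s = Fun_simps[OF adjunctionD(1)[OF a U]] Fun_simps[OF U]
  have Z: "Z \<in> Obj C" and Y: "Y \<in> Obj D" and f: "f \<in> hom C Z (onObj U Y)"
    using u by (auto simp: universal_arrow_def s)
  have v: "universal_arrow U Z (onObj L Z) (component \<eta> Z)" by (rule adjunction_unit_universal[OF a U Z])
  then obtain t where t: "t \<in> hom D (onObj L Z) Y" "Cmp C (onArr U t) (component \<eta> Z) = f"
    using Y f by (auto simp: universal_arrow_def s) metis
  then have "iso D t" using universal_arrow_change_target[OF U v t] u by simp
  then have "Y \<in> ess_image L" using t Z Y by (auto simp: ess_image_def isomorphic_def s)
  then show "\<exists>L \<eta> \<epsilon>. adjunction L U \<eta> \<epsilon> \<and> Y \<in> ess_image L" using a by auto
qed

lemma op_op: "op_cat (op_cat C) = C" "op_fun (op_fun F) = F"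
  by (simp_all add: op_cat_def op_fun_def)

lemma ess_image_op: "ess_image (op_fun F) = ess_image F"
  by (simp add: ess_image_def isomorphic_op)

lemma right_kan_extension_iff_universal_arrow:
  assumes U: "U \<in> Fun D C" and ex: "\<exists>R \<eta> \<epsilon>. adjunction U R \<eta> \<epsilon>"
  shows "(\<exists>R \<eta> \<epsilon>. adjunction U R \<eta> \<epsilon> \<and> Y \<in> ess_image R) \<longleftrightarrow> (\<exists>Z \<eta>. universal_arrow (op_fun U) Z Y \<eta>)"
proof -
  have "(\<exists>R \<eta> \<epsilon>. adjunction U R \<eta> \<epsilon> \<and> Y \<in> ess_image R) \<longleftrightarrow>
     (\<exists>L \<eta> \<epsilon>. adjunction L (op_fun U) \<eta> \<epsilon> \<and> Y \<in> ess_image L)"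
    using adjunction_op ess_image_op op_op(2) by metis
  then show ?thesis
    using kan_extension_iff_universal_arrow[OF op_fun_Fun[OF U]] ex adjunction_op by blast
qed

section \<open>Diagrams over finite posets\<close>

text \<open>One relation \<open>le\<close> orders all posets, so a poset is given by its set of elements. Reflexivity is required
on this set only, because \<open>code_le\<close> relates no \<open>Base x\<close> to itself.\<close>

definition index :: "('i \<Rightarrow> 'i \<Rightarrow> bool) \<Rightarrow> 'i set \<Rightarrow> bool" where
  "index le P \<longleftrightarrow> finite P \<and> (\<forall>x \<in> P. le x x)"

definition order_map :: "('i \<Rightarrow> 'i \<Rightarrow> bool) \<Rightarrow> 'i set \<Rightarrow> 'i set \<Rightarrow> ('i \<Rightarrow> 'i) \<Rightarrow> bool" where
  "order_map le P Q h \<longleftrightarrow> index le P \<and> index le Q \<and> h \<in> P \<rightarrow> Q \<and>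
     (\<forall>x \<in> P. \<forall>y \<in> P. le x y \<longrightarrow> le (h x) (h y))"

definition below :: "('i \<Rightarrow> 'i \<Rightarrow> bool) \<Rightarrow> 'i set \<Rightarrow> ('i \<Rightarrow> 'i) \<Rightarrow> ('i \<Rightarrow> 'i) \<Rightarrow> bool" where
  "below le P h h' \<longleftrightarrow> (\<forall>x \<in> P. le (h x) (h' x))"

lemma index_subset: "index le Q \<Longrightarrow> S \<subseteq> Q \<Longrightarrow> index le S"
  by (auto simp: index_def intro: finite_subset)

lemma order_map_const: "index le S \<Longrightarrow> index le Q \<Longrightarrow> k \<in> Q \<Longrightarrow> order_map le S Q (\<lambda>_. k)"
  by (auto simp: order_map_def index_def)

lemma order_map_incl: "index le Q \<Longrightarrow> S \<subseteq> Q \<Longrightarrow> order_map le S Q (\<lambda>x. x)"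
  using index_subset[of le Q S] by (auto simp: order_map_def)

lemma order_map_comp: "order_map le P Q h \<Longrightarrow> order_map le Q S g \<Longrightarrow> order_map le P S (\<lambda>x. g (h x))"
  by (auto simp: order_map_def Pi_iff)

lemma order_map_restrict: "order_map le P Q h \<Longrightarrow> S \<subseteq> P \<Longrightarrow> order_map le S Q h"
  using index_subset[of le P S] by (auto simp: order_map_def)

lemma order_map_index: "order_map le P Q h \<Longrightarrow> index le P" "order_map le P Q h \<Longrightarrow> index le Q"
  by (auto simp: order_map_def)

text \<open>A strict 2-functor on finite posets, contravariant on monotone maps, for which isomorphisms are
detected pointwise: \<open>C P\<close> is the category of diagrams over \<open>P\<close>, \<open>R P Q h\<close> is restriction along
\<open>h : P \<rightarrow> Q\<close>, \<open>tr P Q h h' X\<close> is the component at \<open>X\<close> of the transformation given by \<open>h \<le> h'\<close>, and \<open>{pt}\<close>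
is the terminal poset. The order is a parameter because opposite categories reverse the arrows
\<open>tr P Q h h' X\<close> and thus belong to the reversed order.\<close>

locale diagrams =
  fixes le :: "'i \<Rightarrow> 'i \<Rightarrow> bool"
    and C :: "'i set \<Rightarrow> ('o, 'a) cat"
    and R :: "'i set \<Rightarrow> 'i set \<Rightarrow> ('i \<Rightarrow> 'i) \<Rightarrow> ('o, 'a, 'o, 'a) functr"
    and tr :: "'i set \<Rightarrow> 'i set \<Rightarrow> ('i \<Rightarrow> 'i) \<Rightarrow> ('i \<Rightarrow> 'i) \<Rightarrow> 'o \<Rightarrow> 'a"
    and pt :: 'i
  assumes le_pt: "le pt pt"
    and C_category: "index le P \<Longrightarrow> category (C P)"
    and R_Fun: "order_map le P Q h \<Longrightarrow> R P Q h \<in> Fun (C Q) (C P)"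
    and R_cong: "(\<And>x. x \<in> P \<Longrightarrow> h x = h' x) \<Longrightarrow> R P Q h = R P Q h'"
    and R_id: "index le P \<Longrightarrow> R P P (\<lambda>x. x) = id_fun (C P)"
    and R_comp: "order_map le P Q h \<Longrightarrow> order_map le Q S g \<Longrightarrow>
      R P S (\<lambda>x. g (h x)) = R P Q h \<odot> R Q S g"
    and tr_hom: "order_map le P Q h \<Longrightarrow> order_map le P Q h' \<Longrightarrow> below le P h h' \<Longrightarrow>
      X \<in> Obj (C Q) \<Longrightarrow> tr P Q h h' X \<in> hom (C P) (onObj (R P Q h) X) (onObj (R P Q h') X)"
    and tr_natural: "order_map le P Q h \<Longrightarrow> order_map le P Q h' \<Longrightarrow> below le P h h' \<Longrightarrow>
      f \<in> hom (C Q) X Y \<Longrightarrow>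
      Cmp (C P) (onArr (R P Q h') f) (tr P Q h h' X) = Cmp (C P) (tr P Q h h' Y) (onArr (R P Q h) f)"
    and tr_id: "order_map le P Q h \<Longrightarrow> X \<in> Obj (C Q) \<Longrightarrow> tr P Q h h X = Idn (C P) (onObj (R P Q h) X)"
    and tr_comp: "order_map le P Q h \<Longrightarrow> order_map le P Q h' \<Longrightarrow> order_map le P Q h'' \<Longrightarrow>
      below le P h h' \<Longrightarrow> below le P h' h'' \<Longrightarrow> X \<in> Obj (C Q) \<Longrightarrow>
      Cmp (C P) (tr P Q h' h'' X) (tr P Q h h' X) = tr P Q h h'' X"
    and tr_left: "order_map le P Q h \<Longrightarrow> order_map le Q S g \<Longrightarrow> order_map le Q S g' \<Longrightarrow>
      below le Q g g' \<Longrightarrow> X \<in> Obj (C S) \<Longrightarrow>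
      onArr (R P Q h) (tr Q S g g' X) = tr P S (\<lambda>x. g (h x)) (\<lambda>x. g' (h x)) X"
    and tr_right: "order_map le P Q h \<Longrightarrow> order_map le P Q h' \<Longrightarrow> below le P h h' \<Longrightarrow>
      order_map le Q S g \<Longrightarrow> X \<in> Obj (C S) \<Longrightarrow>
      tr P Q h h' (onObj (R Q S g) X) = tr P S (\<lambda>x. g (h x)) (\<lambda>x. g (h' x)) X"
    and iso_pointwise: "index le P \<Longrightarrow> f \<in> Arr (C P) \<Longrightarrow>
      (\<And>k. k \<in> P \<Longrightarrow> iso (C {pt}) (onArr (R {pt} P (\<lambda>_. k)) f)) \<Longrightarrow> iso (C P) f"
begin

text \<open>Its values are the constant diagrams, so an arrow from \<open>W\<close> to \<open>const_dgm S T\<close> is a cocone under \<open>W\<close> with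
vertex \<open>T\<close>.\<close>

abbreviation const_dgm :: "'i set \<Rightarrow> ('o, 'a, 'o, 'a) functr" where
  "const_dgm S \<equiv> R S {pt} (\<lambda>_. pt)"

abbreviation at_pt :: "'i set \<Rightarrow> 'i \<Rightarrow> ('o, 'a, 'o, 'a) functr" where
  "at_pt Q k \<equiv> R {pt} Q (\<lambda>_. k)"

text \<open>\<open>X\<^sub>k\<close> is the homotopy colimit of \<open>w\<^sup>* X\<close>, by the cocone that \<open>w s \<le> k\<close> induces.\<close>

definition univ_cocone :: "'i set \<Rightarrow> 'i set \<Rightarrow> ('i \<Rightarrow> 'i) \<Rightarrow> 'i \<Rightarrow> 'o \<Rightarrow> bool" where
  "univ_cocone S Q w k X \<longleftrightarrow>
     universal_arrow (const_dgm S) (onObj (R S Q w) X) (onObj (at_pt Q k) X) (tr S Q w (\<lambda>_. k) X)"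

lemma index_pt [simp]: "index le {pt}"
  by (simp add: index_def le_pt)

lemma order_map_to_pt: "index le S \<Longrightarrow> order_map le S {pt} (\<lambda>_. pt)"
  by (rule order_map_const) auto

lemma order_map_from_pt: "index le Q \<Longrightarrow> k \<in> Q \<Longrightarrow> order_map le {pt} Q (\<lambda>_. k)"
  by (rule order_map_const) auto

lemma R_Obj: "order_map le P Q h \<Longrightarrow> X \<in> Obj (C Q) \<Longrightarrow> onObj (R P Q h) X \<in> Obj (C P)"
  using R_Fun Fun_Obj by metis

lemma R_comp_Obj: "order_map le P Q h \<Longrightarrow> order_map le Q S g \<Longrightarrow> X \<in> Obj (C S) \<Longrightarrow>
    onObj (R P Q h) (onObj (R Q S g) X) = onObj (R P S (\<lambda>x. g (h x))) X"
  using R_comp[of P Q h S g] Fun_simps(1)[OF R_Fun[of Q S g]] by (simp add: comp_fun_simps)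

lemma R_comp_Arr: "order_map le P Q h \<Longrightarrow> order_map le Q S g \<Longrightarrow> f \<in> hom (C S) X Y \<Longrightarrow>
    onArr (R P Q h) (onArr (R Q S g) f) = onArr (R P S (\<lambda>x. g (h x))) f"
  using R_comp[of P Q h S g] Fun_simps(1)[OF R_Fun[of Q S g]] hom_Arr[of f "C S" X Y]
  by (simp add: comp_fun_simps)

lemma const_dgm_comp: "order_map le S' S v \<Longrightarrow> R S' S v \<odot> const_dgm S = const_dgm S'"
  using R_comp[OF _ order_map_to_pt, of S' S v] order_map_index by metis

text \<open>Both maps become equal after composition with the map to the terminal poset.\<close>

lemma tr_const_dgm:
  assumes "order_map le S' S v" "order_map le S' S v'" "below le S' v v'" "T \<in> Obj (C {pt})"
  shows "tr S' S v v' (onObj (const_dgm S) T) = Idn (C S') (onObj (const_dgm S') T)"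
  using tr_right[OF assms(1-3) order_map_to_pt assms(4)] tr_id[OF order_map_to_pt assms(4)]
    order_map_index[OF assms(1)] by metis

text \<open>Right adjoint functors are final. The inequalities say that \<open>l\<close> is left adjoint to \<open>v\<close>, so by
2-functoriality \<open>v\<^sup>*\<close> is left adjoint to \<open>l\<^sup>*\<close>. As \<open>l\<^sup>*\<close> preserves constant diagrams, transposition turns
cocones under \<open>v\<^sup>* W\<close> into cocones under \<open>W\<close>; explicitly, \<open>g\<close> becomes \<open>l\<^sup>* g \<circ> \<eta>\<close>, where
\<open>\<eta> : W \<rightarrow> l\<^sup>* v\<^sup>* W\<close> comes from \<open>x \<le> v (l x)\<close>.\<close>

lemma bij_betw_cocones_right_adjoint:
  assumes v: "order_map le S' S v" and l: "order_map le S S' l"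
    and unit: "below le S (\<lambda>x. x) (\<lambda>x. v (l x))" and counit: "below le S' (\<lambda>x. l (v x)) (\<lambda>x. x)"
    and W: "W \<in> Obj (C S)" and T: "T \<in> Obj (C {pt})"
  shows "bij_betw (onArr (R S' S v)) (hom (C S) W (onObj (const_dgm S) T))
           (hom (C S') (onObj (R S' S v) W) (onObj (R S' S v) (onObj (const_dgm S) T)))"
proof -
  have i: "index le S" "index le S'" using order_map_index[OF v] by auto
  interpret S: category "C S" using C_category[OF i(1)] .
  interpret S': category "C S'" using C_category[OF i(2)] .
  note vf = R_Fun[OF v] and lf = R_Fun[OF l]
  note vl = order_map_comp[OF l v] and lv = order_map_comp[OF v l]
  note idS = order_map_incl[OF i(1) subset_refl] and idS' = order_map_incl[OF i(2) subset_refl]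
  define V where "V = onArr (R S' S v)"
  define L where "L = onArr (R S S' l)"
  define \<eta> where "\<eta> = tr S S (\<lambda>x. x) (\<lambda>x. v (l x)) W"
  define Z where "Z = onObj (const_dgm S) T"
  define Z' where "Z' = onObj (const_dgm S') T"
  define VW where "VW = onObj (R S' S v) W"
  have Z: "Z \<in> Obj (C S)" unfolding Z_def by (rule R_Obj[OF order_map_to_pt[OF i(1)] T])
  have VZ: "onObj (R S' S v) Z = Z'"
    unfolding Z_def Z'_def using R_comp_Obj[OF v order_map_to_pt T] i by simp
  have LZ: "onObj (R S S' l) Z' = Z"
    unfolding Z_def Z'_def using R_comp_Obj[OF l order_map_to_pt T] i by simp
  have VW: "VW \<in> Obj (C S')" unfolding VW_def by (rule R_Obj[OF v W])
  have idW: "onObj (R S S (\<lambda>x. x)) W = W" and idVW: "onObj (R S' S' (\<lambda>x. x)) VW = VW"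
    using W VW by (simp_all add: R_id i id_fun_simps)
  have \<eta>: "\<eta> \<in> hom (C S) W (onObj (R S S' l) VW)"
    unfolding \<eta>_def VW_def R_comp_Obj[OF l v W]
    using tr_hom[OF idS vl unit W] idW by simp
  have V: "V g \<in> hom (C S') VW Z'" if "g \<in> hom (C S) W Z" for g
    using Fun_hom[OF vf that] VZ by (simp add: VW_def V_def)
  have L: "L g \<in> hom (C S) (onObj (R S S' l) VW) Z" if "g \<in> hom (C S') VW Z'" for g
    using Fun_hom[OF lf that] LZ by (simp add: L_def)
  have 1: "Cmp (C S) (L (V g)) \<eta> = g" if g: "g \<in> hom (C S) W Z" for g
  proof -
    have "Cmp (C S) (L (V g)) \<eta> = Cmp (C S) (tr S S (\<lambda>x. x) (\<lambda>x. v (l x)) Z) (onArr (R S S (\<lambda>x. x)) g)"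
      unfolding L_def V_def \<eta>_def R_comp_Arr[OF l v g] by (rule tr_natural[OF idS vl unit g])
    also have "\<dots> = g"
      unfolding Z_def tr_const_dgm[OF idS vl unit T] using S.Cmp_Idn_left[OF g] hom_Arr[OF g]
      by (simp add: R_id i id_fun_simps Z_def)
    finally show ?thesis .
  qed
  have 2: "V (Cmp (C S) (L g) \<eta>) = g" if g: "g \<in> hom (C S') VW Z'" for g
  proof -
    define \<epsilon> where "\<epsilon> = tr S' S' (\<lambda>x. l (v x)) (\<lambda>x. x) VW"
    have \<epsilon>: "\<epsilon> \<in> hom (C S') (onObj (R S' S' (\<lambda>x. l (v x))) VW) VW"
      unfolding \<epsilon>_def using tr_hom[OF lv idS' counit VW] idVW by simp
    have lvg: "onArr (R S' S' (\<lambda>x. l (v x))) g \<in> hom (C S') (onObj (R S' S' (\<lambda>x. l (v x))) VW) Z'"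
      using Fun_hom[OF R_Fun[OF lv] g] R_comp_Obj[OF lv order_map_to_pt T] i by (simp add: Z'_def)
    have nat: "onArr (R S' S' (\<lambda>x. l (v x))) g = Cmp (C S') g \<epsilon>"
    proof -
      have "Cmp (C S') g \<epsilon> = Cmp (C S') (onArr (R S' S' (\<lambda>x. x)) g) \<epsilon>"
        using g by (simp add: R_id i id_fun_simps hom_Arr)
      also have "\<dots> = Cmp (C S') (tr S' S' (\<lambda>x. l (v x)) (\<lambda>x. x) Z') (onArr (R S' S' (\<lambda>x. l (v x))) g)"
        unfolding \<epsilon>_def by (rule tr_natural[OF lv idS' counit g])
      also have "\<dots> = onArr (R S' S' (\<lambda>x. l (v x))) g"
        unfolding Z'_def tr_const_dgm[OF lv idS' counit T]
        using S'.Cmp_Idn_left[OF lvg] by (simp add: Z'_def)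
      finally show ?thesis by simp
    qed
    have vlv: "order_map le S' S (\<lambda>x. v (l (v x)))" by (rule order_map_comp[OF v vl])
    have b: "below le S' (\<lambda>x. v (l (v x))) v" "below le S' v (\<lambda>x. v (l (v x)))"
      using counit unit v l by (auto simp: below_def order_map_def Pi_iff)
    have tri: "Cmp (C S') \<epsilon> (V \<eta>) = Idn (C S') VW"
    proof -
      have "V \<eta> = tr S' S v (\<lambda>x. v (l (v x))) W"
        unfolding V_def \<eta>_def by (rule tr_left[OF v idS vl unit W])
      moreover have "\<epsilon> = tr S' S (\<lambda>x. v (l (v x))) v W"
        unfolding \<epsilon>_def VW_def by (rule tr_right[OF lv idS' counit v W])
      ultimately show ?thesis
        using tr_comp[OF v vlv v b(2,1) W] tr_id[OF v W] by (simp add: VW_def)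
    qed
    have V\<eta>: "V \<eta> \<in> hom (C S') VW (onObj (R S' S' (\<lambda>x. l (v x))) VW)"
      using Fun_hom[OF vf \<eta>] R_comp_Obj[OF v l VW] by (simp add: V_def VW_def)
    have "V (Cmp (C S) (L g) \<eta>) = Cmp (C S') (V (L g)) (V \<eta>)"
      unfolding V_def by (rule Fun_Cmp[OF vf \<eta> L[OF g]])
    also have "V (L g) = Cmp (C S') g \<epsilon>"
      unfolding V_def L_def R_comp_Arr[OF v l g] by (rule nat)
    also have "Cmp (C S') (Cmp (C S') g \<epsilon>) (V \<eta>) = g"
      using S'.Cmp_assoc[OF V\<eta> \<epsilon> g] tri S'.Cmp_Idn_right[OF g] by simp
    finally show ?thesis .
  qed
  show ?thesis
    unfolding Z_def[symmetric] VZ VW_def[symmetric] V_def[symmetric]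
    by (rule bij_betwI[where g = "\<lambda>g. Cmp (C S) (L g) \<eta>"])
       (use V L 1 2 S.Cmp_hom[OF \<eta>] in auto)
qed

lemma universal_arrow_right_adjoint:
  assumes v: "order_map le S' S v" and l: "order_map le S S' l"
    and "below le S (\<lambda>x. x) (\<lambda>x. v (l x))" "below le S' (\<lambda>x. l (v x)) (\<lambda>x. x)"
    and T: "T \<in> Obj (C {pt})" and f: "f \<in> hom (C S) W (onObj (const_dgm S) T)"
  shows "universal_arrow (const_dgm S') (onObj (R S' S v) W) T (onArr (R S' S v) f) \<longleftrightarrow>
         universal_arrow (const_dgm S) W T f"
proof -
  have i: "index le S" using order_map_index[OF v] by auto
  have W: "W \<in> Obj (C S)" using hom_objs[OF C_category[OF i] f] by simp
  show ?thesis
    using universal_arrow_along_functor[OF R_Fun[OF order_map_to_pt[OF i]] R_Fun[OF v]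
        bij_betw_cocones_right_adjoint[OF assms(1-4) W] f T]
    by (simp add: const_dgm_comp[OF v])
qed

text \<open>The inclusion of the greatest element is right adjoint to the map to the terminal poset, so the
colimit is the value at that element.\<close>

lemma universal_arrow_greatest:
  assumes S: "index le S" "m \<in> S" "\<And>x. x \<in> S \<Longrightarrow> le x m"
    and T: "T \<in> Obj (C {pt})" and f: "f \<in> hom (C S) W (onObj (const_dgm S) T)"
  shows "universal_arrow (const_dgm S) W T f \<longleftrightarrow> iso (C {pt}) (onArr (at_pt S m) f)"
proof -
  have v: "order_map le {pt} S (\<lambda>_. m)" by (rule order_map_from_pt[OF S(1,2)])
  note l = order_map_to_pt[OF S(1)]
  have c: "const_dgm {pt} = id_fun (C {pt})"
    using R_cong[of "{pt}" "\<lambda>_. pt" "\<lambda>x. x" "{pt}"] R_id[OF index_pt] by simp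
  have o: "onObj (at_pt S m) (onObj (const_dgm S) T) = T"
    using R_comp_Obj[OF v l T] c T by (simp add: id_fun_simps)
  have "universal_arrow (const_dgm S) W T f \<longleftrightarrow>
     universal_arrow (id_fun (C {pt})) (onObj (at_pt S m) W) T (onArr (at_pt S m) f)"
    using universal_arrow_right_adjoint[OF v l _ _ T f] S(3) by (simp add: below_def le_pt c)
  also have "\<dots> \<longleftrightarrow> iso (C {pt}) (onArr (at_pt S m) f)"
    using Fun_hom[OF R_Fun[OF v] f] by (intro universal_arrow_id_fun) (simp_all add: C_category o)
  finally show ?thesis .
qed

text \<open>If restriction along \<open>v\<close> is a bijection on the cocones under \<open>w\<^sup>* X\<close>, then colimits over \<open>S\<close> and over \<open>S'\<close>
agree.\<close>

lemma univ_cocone_reindex: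
  assumes v: "order_map le S' S v"
    and w: "order_map le S Q w" "k \<in> Q" "below le S w (\<lambda>_. k)" and X: "X \<in> Obj (C Q)"
    and bij: "\<And>T. T \<in> Obj (C {pt}) \<Longrightarrow>
      bij_betw (onArr (R S' S v)) (hom (C S) (onObj (R S Q w) X) (onObj (const_dgm S) T))
        (hom (C S') (onObj (R S' S v) (onObj (R S Q w) X)) (onObj (R S' S v) (onObj (const_dgm S) T)))"
  shows "univ_cocone S' Q (\<lambda>x. w (v x)) k X \<longleftrightarrow> univ_cocone S Q w k X"
proof -
  have i: "index le S" "index le Q" using order_map_index[OF w(1)] by auto
  note k = order_map_from_pt[OF i(2) w(2)] and ck = order_map_const[OF i w(2)]
  have "tr S Q w (\<lambda>_. k) X \<in> hom (C S) (onObj (R S Q w) X) (onObj (const_dgm S) (onObj (at_pt Q k) X))"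
    unfolding R_comp_Obj[OF order_map_to_pt[OF i(1)] k X]
    by (rule tr_hom[OF w(1) ck w(3) X])
  from universal_arrow_along_functor[OF R_Fun[OF order_map_to_pt[OF i(1)]] R_Fun[OF v] bij
      this R_Obj[OF k X], unfolded const_dgm_comp[OF v]]
  show ?thesis
    unfolding univ_cocone_def tr_left[OF v w(1) ck w(3) X] R_comp_Obj[OF v w(1) X] .
qed

lemma univ_cocone_right_adjoint:
  assumes v: "order_map le S' S v" and l: "order_map le S S' l"
    and b: "below le S (\<lambda>x. x) (\<lambda>x. v (l x))" "below le S' (\<lambda>x. l (v x)) (\<lambda>x. x)"
    and w: "order_map le S Q w" "k \<in> Q" "below le S w (\<lambda>_. k)" and X: "X \<in> Obj (C Q)"
  shows "univ_cocone S' Q (\<lambda>x. w (v x)) k X \<longleftrightarrow> univ_cocone S Q w k X"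
  by (rule univ_cocone_reindex[OF v w X bij_betw_cocones_right_adjoint[OF v l b R_Obj[OF w(1) X]]])

lemma univ_cocone_restrict:
  assumes h: "order_map le Q Q' h" and w: "order_map le S Q w" "k \<in> Q" "below le S w (\<lambda>_. k)"
    and X: "X \<in> Obj (C Q')"
  shows "univ_cocone S Q w k (onObj (R Q Q' h) X) \<longleftrightarrow> univ_cocone S Q' (\<lambda>x. h (w x)) (h k) X"
proof -
  have i: "index le S" "index le Q" using order_map_index[OF w(1)] by auto
  note k = order_map_from_pt[OF i(2) w(2)] and ck = order_map_const[OF i w(2)]
  show ?thesis
    unfolding univ_cocone_def tr_right[OF w(1) ck w(3) h X] R_comp_Obj[OF w(1) h X]
      R_comp_Obj[OF k h X] ..
qed

lemma univ_cocone_greatest: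
  assumes S: "m \<in> S" "\<And>x. x \<in> S \<Longrightarrow> le x m"
    and w: "order_map le S Q w" and X: "X \<in> Obj (C Q)"
  shows "univ_cocone S Q w (w m) X"
proof -
  have i: "index le S" "index le Q" using order_map_index[OF w(1)] by auto
  have wm: "w m \<in> Q" and b: "below le S w (\<lambda>_. w m)"
    using w S by (auto simp: order_map_def below_def)
  note k = order_map_from_pt[OF i(2) wm] and ck = order_map_const[OF i wm]
  have "tr S Q w (\<lambda>_. w m) X \<in> hom (C S) (onObj (R S Q w) X) (onObj (const_dgm S) (onObj (at_pt Q (w m)) X))"
    unfolding R_comp_Obj[OF order_map_to_pt[OF i(1)] k X]
    by (rule tr_hom[OF w(1) ck b X])
  moreover have "onArr (at_pt S m) (tr S Q w (\<lambda>_. w m) X) = Idn (C {pt}) (onObj (at_pt Q (w m)) X)"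
    using tr_left[OF order_map_from_pt[OF i(1) S(1)] w ck b X] tr_id[OF k X] by simp
  ultimately show ?thesis
    unfolding univ_cocone_def
    using universal_arrow_greatest[OF i(1) S R_Obj[OF k X]]
      iso_Idn[OF C_category[OF index_pt] R_Obj[OF k X]] by simp
qed

text \<open>An isomorphism of posets is a right adjoint, its inverse being the left adjoint.\<close>

lemma univ_cocone_embedding:
  assumes h: "order_map le P Q h" "\<And>x y. x \<in> P \<Longrightarrow> y \<in> P \<Longrightarrow> le (h x) (h y) \<Longrightarrow> le x y" "inj_on h P"
    and S: "S \<subseteq> P" "k \<in> P" "\<And>x. x \<in> S \<Longrightarrow> le x k" and X: "X \<in> Obj (C Q)"
  shows "univ_cocone S P (\<lambda>x. x) k (onObj (R P Q h) X) \<longleftrightarrow> univ_cocone (h ` S) Q (\<lambda>x. x) (h k) X"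
proof -
  have i: "index le P" "index le Q" using order_map_index[OF h(1)] by auto
  have hS: "h ` S \<subseteq> Q" using S(1) h(1) by (auto simp: order_map_def)
  have iS: "index le S" "index le (h ` S)"
    using index_subset[OF i(1) S(1)] index_subset[OF i(2) hS] .
  have inj: "inj_on h S" using h(3) S(1) inj_on_subset by metis
  have v: "order_map le S (h ` S) h"
    using iS S(1) h(1) by (auto simp: order_map_def)
  have l: "order_map le (h ` S) S (inv_into S h)"
    using iS S(1) h(2) inj by (auto simp: order_map_def subset_iff)
  have b: "below le (h ` S) (\<lambda>x. x) (\<lambda>x. h (inv_into S h x))" "below le S (\<lambda>x. inv_into S h (h x)) (\<lambda>x. x)"
    using inj iS by (auto simp: below_def index_def)
  have w: "below le (h ` S) (\<lambda>x. x) (\<lambda>_. h k)" "below le S (\<lambda>x. x) (\<lambda>_. k)" "h k \<in> Q"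
    using h(1) S by (auto simp: below_def order_map_def subset_iff)
  show ?thesis
    using univ_cocone_restrict[OF h(1) order_map_incl[OF i(1) S(1)] S(2) w(2) X]
      univ_cocone_right_adjoint[OF v l b order_map_incl[OF i(2) hS] w(3,1) X] by simp
qed

end

section \<open>Pointwise Kan extensions\<close>

text \<open>The content of (Der3) and (Der4) for left Kan extensions, freed from adjoints: along every monotone map
\<open>h\<close> a universal arrow \<open>\<eta> : Z \<rightarrow> h\<^sup>* Y\<close> exists, and the value of \<open>Y\<close> at \<open>k\<close> is the colimit of \<open>Z\<close> over the slice
\<open>{x. h x \<le> k}\<close>, by the cocone \<open>Z\<^sub>x \<rightarrow> Y\<^bsub>h x\<^esub> \<rightarrow> Y\<^sub>k\<close>.\<close>

locale kan_diagrams = diagrams le C R tr pt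
  for le :: "'i \<Rightarrow> 'i \<Rightarrow> bool"
    and C :: "'i set \<Rightarrow> ('o, 'a) cat"
    and R :: "'i set \<Rightarrow> 'i set \<Rightarrow> ('i \<Rightarrow> 'i) \<Rightarrow> ('o, 'a, 'o, 'a) functr"
    and tr :: "'i set \<Rightarrow> 'i set \<Rightarrow> ('i \<Rightarrow> 'i) \<Rightarrow> ('i \<Rightarrow> 'i) \<Rightarrow> 'o \<Rightarrow> 'a"
    and pt :: 'i +
  assumes pointwise_kan: "order_map le P Q h \<Longrightarrow> Z \<in> Obj (C P) \<Longrightarrow>
    \<exists>Y \<eta>. universal_arrow (R P Q h) Z Y \<eta> \<and>
      (\<forall>k \<in> Q. let S = {x \<in> P. le (h x) k} in
         universal_arrow (const_dgm S) (onObj (R S P (\<lambda>x. x)) Z) (onObj (at_pt Q k) Y)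
           (Cmp (C S) (tr S Q h (\<lambda>_. k) Y) (onArr (R S P (\<lambda>x. x)) \<eta>)))"
begin

text \<open>Naturality in the Kan extended diagram, of the cocone that computes its value at \<open>k\<close>.\<close>

lemma cocone_change_target:
  assumes h: "order_map le P Q h" and k: "k \<in> Q" and S: "S = {x \<in> P. le (h x) k}"
    and t: "t \<in> hom (C Q) Y' Y" and \<eta>: "\<eta> \<in> hom (C P) Z (onObj (R P Q h) Y')"
  shows "Cmp (C S) (onArr (const_dgm S) (onArr (at_pt Q k) t))
           (Cmp (C S) (tr S Q h (\<lambda>_. k) Y') (onArr (R S P (\<lambda>x. x)) \<eta>)) =
         Cmp (C S) (tr S Q h (\<lambda>_. k) Y) (onArr (R S P (\<lambda>x. x)) (Cmp (C P) (onArr (R P Q h) t) \<eta>))"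
proof -
  have i: "index le P" "index le Q" using order_map_index[OF h] by auto
  have SP: "S \<subseteq> P" using S by auto
  have iS: "index le S" using index_subset[OF i(1) SP] .
  interpret S: category "C S" using C_category[OF iS] .
  note pr = order_map_incl[OF i(1) SP] and hS = order_map_restrict[OF h SP]
  note ck = order_map_const[OF iS i(2) k] and kk = order_map_from_pt[OF i(2) k]
  have b: "below le S h (\<lambda>_. k)" using S by (auto simp: below_def)
  have Y: "Y' \<in> Obj (C Q)" "Y \<in> Obj (C Q)" using hom_objs[OF C_category[OF i(2)] t] by auto
  have 1: "onArr (R S P (\<lambda>x. x)) \<eta> \<in> hom (C S) (onObj (R S P (\<lambda>x. x)) Z) (onObj (R S Q h) Y')"
    using Fun_hom[OF R_Fun[OF pr] \<eta>] R_comp_Obj[OF pr h Y(1)] by simp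
  note 2 = tr_hom[OF hS ck b Y(1)]
  have 3: "onArr (const_dgm S) (onArr (at_pt Q k) t) = onArr (R S Q (\<lambda>_. k)) t"
    by (rule R_comp_Arr[OF order_map_to_pt[OF iS] kk t])
  note 4 = Fun_hom[OF R_Fun[OF ck] t] and 5 = Fun_hom[OF R_Fun[OF hS] t]
  have "Cmp (C S) (onArr (R S Q (\<lambda>_. k)) t) (Cmp (C S) (tr S Q h (\<lambda>_. k) Y') (onArr (R S P (\<lambda>x. x)) \<eta>))
     = Cmp (C S) (Cmp (C S) (onArr (R S Q (\<lambda>_. k)) t) (tr S Q h (\<lambda>_. k) Y')) (onArr (R S P (\<lambda>x. x)) \<eta>)"
    by (rule S.Cmp_assoc[OF 1 2 4])
  also have "\<dots> = Cmp (C S) (Cmp (C S) (tr S Q h (\<lambda>_. k) Y) (onArr (R S Q h) t)) (onArr (R S P (\<lambda>x. x)) \<eta>)"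
    by (simp add: tr_natural[OF hS ck b t])
  also have "\<dots> = Cmp (C S) (tr S Q h (\<lambda>_. k) Y) (Cmp (C S) (onArr (R S Q h) t) (onArr (R S P (\<lambda>x. x)) \<eta>))"
    using S.Cmp_assoc[OF 1 5 tr_hom[OF hS ck b Y(2)]] by simp
  also have "Cmp (C S) (onArr (R S Q h) t) (onArr (R S P (\<lambda>x. x)) \<eta>) =
      onArr (R S P (\<lambda>x. x)) (Cmp (C P) (onArr (R P Q h) t) \<eta>)"
    using Fun_Cmp[OF R_Fun[OF pr] \<eta> Fun_hom[OF R_Fun[OF h] t]] R_comp_Arr[OF pr h t] by simp
  finally show ?thesis unfolding 3 .
qed

text \<open>\<open>pointwise_kan\<close> gives the colimit formula for one Kan extension of \<open>Z\<close>; the canonical isomorphism to \<open>Y\<close>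
carries it over.\<close>

lemma kan_extension_pointwise:
  assumes h: "order_map le P Q h" and u: "universal_arrow (R P Q h) Z Y \<eta>"
    and k: "k \<in> Q" and S: "S = {x \<in> P. le (h x) k}"
  shows "universal_arrow (const_dgm S) (onObj (R S P (\<lambda>x. x)) Z) (onObj (at_pt Q k) Y)
           (Cmp (C S) (tr S Q h (\<lambda>_. k) Y) (onArr (R S P (\<lambda>x. x)) \<eta>))"
proof -
  have i: "index le P" "index le Q" using order_map_index[OF h] by auto
  note f = R_Fun[OF h] and s = Fun_simps[OF R_Fun[OF h]]
  have Z: "Z \<in> Obj (C P)" and Y: "Y \<in> Obj (C Q)" and \<eta>: "\<eta> \<in> hom (C P) Z (onObj (R P Q h) Y)"
    using u by (auto simp: universal_arrow_def s)
  obtain Y' \<eta>' where u': "universal_arrow (R P Q h) Z Y' \<eta>'"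
    and pw: "universal_arrow (const_dgm S) (onObj (R S P (\<lambda>x. x)) Z) (onObj (at_pt Q k) Y')
           (Cmp (C S) (tr S Q h (\<lambda>_. k) Y') (onArr (R S P (\<lambda>x. x)) \<eta>'))"
    using pointwise_kan[OF h Z] k by (auto simp: Let_def S)
  obtain t where t: "t \<in> hom (C Q) Y' Y" "Cmp (C P) (onArr (R P Q h) t) \<eta>' = \<eta>"
    using u' Y \<eta> by (auto simp: universal_arrow_def s) metis
  have "iso (C Q) t" using universal_arrow_change_target[OF f u' t] u by simp
  then have "iso (C {pt}) (onArr (at_pt Q k) t)"
    using iso_functor[OF R_Fun[OF order_map_from_pt[OF i(2) k]] t(1)] by simp
  moreover have "\<eta>' \<in> hom (C P) Z (onObj (R P Q h) Y')"
    using u' by (auto simp: universal_arrow_def s)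
  ultimately show ?thesis
    using universal_arrow_change_target[OF R_Fun[OF order_map_to_pt] pw
        Fun_hom[OF R_Fun[OF order_map_from_pt[OF i(2) k]] t(1)]
        cocone_change_target[OF h k S t(1)]] index_subset[OF i(1), of S]
    by (simp add: t(2) S)
qed

text \<open>Let \<open>Y'\<close> be a Kan extension of \<open>h\<^sup>* Y\<close> and \<open>t : Y' \<rightarrow> Y\<close> the comparison. For each \<open>k\<close> the values of both diagrams
are colimits of the same diagram over the slice, so \<open>t\<^sub>k\<close> is invertible; hence \<open>t\<close> is.\<close>

lemma kan_extension_of_univ_cocones:
  assumes h: "order_map le P Q h" and Y: "Y \<in> Obj (C Q)"
    and cocones: "\<And>k. k \<in> Q \<Longrightarrow> univ_cocone {x \<in> P. le (h x) k} Q h k Y"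
  shows "universal_arrow (R P Q h) (onObj (R P Q h) Y) Y (Idn (C P) (onObj (R P Q h) Y))"
proof -
  have i: "index le P" "index le Q" using order_map_index[OF h] by auto
  note f = R_Fun[OF h] and s = Fun_simps[OF R_Fun[OF h]]
  interpret P: category "C P" using C_category[OF i(1)] .
  define Z where "Z = onObj (R P Q h) Y"
  have Z: "Z \<in> Obj (C P)" unfolding Z_def by (rule R_Obj[OF h Y])
  have id: "Idn (C P) Z \<in> hom (C P) Z (onObj (R P Q h) Y)" using P.Idn_hom[OF Z] by (simp add: Z_def)
  obtain Y' \<eta>' where u': "universal_arrow (R P Q h) Z Y' \<eta>'"
    using pointwise_kan[OF h Z] by auto
  then obtain t where t: "t \<in> hom (C Q) Y' Y" "Cmp (C P) (onArr (R P Q h) t) \<eta>' = Idn (C P) Z"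
    using Y id by (auto simp: universal_arrow_def s) metis
  have \<eta>': "\<eta>' \<in> hom (C P) Z (onObj (R P Q h) Y')"
    using u' by (auto simp: universal_arrow_def s)
  have "iso (C Q) t"
  proof (rule iso_pointwise[OF i(2) hom_Arr[OF t(1)]])
    fix k assume k: "k \<in> Q"
    define S where "S = {x \<in> P. le (h x) k}"
    have SP: "S \<subseteq> P" by (auto simp: S_def)
    have iS: "index le S" using index_subset[OF i(1) SP] .
    note pr = order_map_incl[OF i(1) SP] and hS = order_map_restrict[OF h SP]
    note ck = order_map_const[OF iS i(2) k]
    have b: "below le S h (\<lambda>_. k)" by (auto simp: below_def S_def)
    have prZ: "onObj (R S P (\<lambda>x. x)) Z = onObj (R S Q h) Y"
      unfolding Z_def using R_comp_Obj[OF pr h Y] by simp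
    have "Cmp (C S) (tr S Q h (\<lambda>_. k) Y) (onArr (R S P (\<lambda>x. x)) (Idn (C P) Z)) = tr S Q h (\<lambda>_. k) Y"
      using Fun_Idn[OF R_Fun[OF pr] Z] prZ
        category.Cmp_Idn_right[OF C_category[OF iS] tr_hom[OF hS ck b Y]] by simp
    then show "iso (C {pt}) (onArr (at_pt Q k) t)"
      using universal_arrow_change_target[OF R_Fun[OF order_map_to_pt[OF iS]]
        kan_extension_pointwise[OF h u' k S_def]
        Fun_hom[OF R_Fun[OF order_map_from_pt[OF i(2) k]] t(1)]
        cocone_change_target[OF h k S_def t(1) \<eta>']] cocones[OF k]
      by (simp add: t(2) univ_cocone_def prZ[unfolded S_def] S_def)
  qed
  then show ?thesis
    using universal_arrow_change_target[OF f u' t] by (simp add: Z_def)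
qed

text \<open>For \<open>k \<in> J\<close> the slice has \<open>k\<close> as its greatest element, and the cocone is a colimit in any case.\<close>

lemma restriction_universal:
  assumes Q: "index le Q" "J \<subseteq> Q" and Y: "Y \<in> Obj (C Q)"
    and cocones: "\<And>k. k \<in> Q - J \<Longrightarrow> univ_cocone {x \<in> J. le x k} Q (\<lambda>x. x) k Y"
  shows "universal_arrow (R J Q (\<lambda>x. x)) (onObj (R J Q (\<lambda>x. x)) Y) Y (Idn (C J) (onObj (R J Q (\<lambda>x. x)) Y))"
proof (rule kan_extension_of_univ_cocones[OF order_map_incl[OF Q] Y])
  fix k assume k: "k \<in> Q"
  show "univ_cocone {x \<in> J. le x k} Q (\<lambda>x. x) k Y"
  proof (cases "k \<in> J")
    case True
    then show ?thesis
      using Q by (intro univ_cocone_greatest[of k] order_map_incl Y) (auto simp: index_def)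
  qed (use k cocones in auto)
qed

text \<open>Suppose that \<open>Y\<close> is a Kan extension of \<open>Z\<close>. The colimit formula is about the cocone from \<open>Z\<close>, and it becomes
one about the cocone from \<open>Y\<close> as soon as \<open>\<eta> : Z \<rightarrow> i\<^sup>* Y\<close> is invertible. At \<open>j \<in> J\<close> the slice has the
greatest element \<open>j\<close>, so the formula itself says that \<open>\<eta>\<^sub>j\<close> is invertible. This is full faithfulness of Kan
extension along a full inclusion.\<close>

lemma kan_extension_iff_univ_cocone:
  assumes Q: "index le Q" "J \<subseteq> Q" and Y: "Y \<in> Obj (C Q)"
  shows "(\<exists>Z \<eta>. universal_arrow (R J Q (\<lambda>x. x)) Z Y \<eta>) \<longleftrightarrow>
         (\<forall>k \<in> Q - J. univ_cocone {x \<in> J. le x k} Q (\<lambda>x. x) k Y)"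
proof
  assume "\<exists>Z \<eta>. universal_arrow (R J Q (\<lambda>x. x)) Z Y \<eta>"
  then obtain Z \<eta> where u: "universal_arrow (R J Q (\<lambda>x. x)) Z Y \<eta>" by auto
  note inc = order_map_incl[OF Q]
  note s = Fun_simps[OF R_Fun[OF inc]]
  have iJ: "index le J" by (rule index_subset[OF Q])
  have \<eta>: "\<eta> \<in> hom (C J) Z (onObj (R J Q (\<lambda>x. x)) Y)"
    using u by (auto simp: universal_arrow_def s)
  let ?S = "\<lambda>k. {x \<in> J. le x k}"
  have pr: "order_map le (?S k) J (\<lambda>x. x)" for k by (rule order_map_incl[OF iJ]) auto
  have iS: "index le (?S k)" for k by (rule index_subset[OF iJ]) auto
  have incS: "order_map le (?S k) Q (\<lambda>x. x)" for k by (rule order_map_restrict[OF inc]) auto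
  have b: "below le (?S k) (\<lambda>x. x) (\<lambda>_. k)" for k by (auto simp: below_def)
  have pr\<eta>: "onArr (R (?S k) J (\<lambda>x. x)) \<eta> \<in>
      hom (C (?S k)) (onObj (R (?S k) J (\<lambda>x. x)) Z) (onObj (R (?S k) Q (\<lambda>x. x)) Y)" for k
    using Fun_hom[OF R_Fun[OF pr] \<eta>] R_comp_Obj[OF pr inc Y] by simp
  note pw = kan_extension_pointwise[OF inc u _ refl]
  have iso: "iso (C J) \<eta>"
  proof (rule iso_pointwise[OF iJ hom_Arr[OF \<eta>]])
    fix j assume j: "j \<in> J"
    let ?T = "?S j"
    have jQ: "j \<in> Q" and jT: "j \<in> ?T" using j Q by (auto simp: index_def)
    note ck = order_map_const[OF iS[of j] Q(1) jQ] and kk = order_map_from_pt[OF Q(1) jQ]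
    note m = order_map_from_pt[OF iS[of j] jT]
    note trh = tr_hom[OF incS ck b Y]
    interpret E: category "C {pt}" using C_category[OF index_pt] .
    have f: "Cmp (C ?T) (tr ?T Q (\<lambda>x. x) (\<lambda>_. j) Y) (onArr (R ?T J (\<lambda>x. x)) \<eta>)
       \<in> hom (C ?T) (onObj (R ?T J (\<lambda>x. x)) Z) (onObj (const_dgm ?T) (onObj (at_pt Q j) Y))"
      using category.Cmp_hom[OF C_category[OF iS] pr\<eta> trh]
        R_comp_Obj[OF order_map_to_pt[OF iS[of j]] kk Y] by simp
    have "onArr (at_pt ?T j) (Cmp (C ?T) (tr ?T Q (\<lambda>x. x) (\<lambda>_. j) Y) (onArr (R ?T J (\<lambda>x. x)) \<eta>)) =
       Cmp (C {pt}) (onArr (at_pt ?T j) (tr ?T Q (\<lambda>x. x) (\<lambda>_. j) Y)) (onArr (at_pt ?T j) (onArr (R ?T J (\<lambda>x. x)) \<eta>))"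
      by (rule Fun_Cmp[OF R_Fun[OF m] pr\<eta> trh])
    also have "onArr (at_pt ?T j) (onArr (R ?T J (\<lambda>x. x)) \<eta>) = onArr (at_pt J j) \<eta>"
      using R_comp_Arr[OF m pr \<eta>] by simp
    also have "onArr (at_pt ?T j) (tr ?T Q (\<lambda>x. x) (\<lambda>_. j) Y) = Idn (C {pt}) (onObj (at_pt Q j) Y)"
      using tr_left[OF m incS ck b Y] tr_id[OF kk Y] by simp
    also have "Cmp (C {pt}) (Idn (C {pt}) (onObj (at_pt Q j) Y)) (onArr (at_pt J j) \<eta>) = onArr (at_pt J j) \<eta>"
      using Fun_hom[OF R_Fun[OF order_map_from_pt[OF iJ j]] \<eta>]
        R_comp_Obj[OF order_map_from_pt[OF iJ j] inc Y] by (auto intro: E.Cmp_Idn_left)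
    finally show "iso (C {pt}) (onArr (at_pt J j) \<eta>)"
      using universal_arrow_greatest[OF iS jT _ R_Obj[OF kk Y] f] pw[OF jQ] by simp
  qed
  show "\<forall>k \<in> Q - J. univ_cocone (?S k) Q (\<lambda>x. x) k Y"
  proof
    fix k assume "k \<in> Q - J"
    then have k: "k \<in> Q" by auto
    let ?T = "?S k"
    note ck = order_map_const[OF iS[of k] Q(1) k]
    note trh = tr_hom[OF incS ck b Y]
    interpret S: category "C ?T" using C_category[OF iS] .
    have "iso (C ?T) (onArr (R ?T J (\<lambda>x. x)) \<eta>)"
      by (rule iso_functor[OF R_Fun[OF pr] \<eta> iso])
    then obtain r where r: "r \<in> hom (C ?T) (onObj (R ?T Q (\<lambda>x. x)) Y) (onObj (R ?T J (\<lambda>x. x)) Z)"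
      "Cmp (C ?T) r (onArr (R ?T J (\<lambda>x. x)) \<eta>) = Idn (C ?T) (onObj (R ?T J (\<lambda>x. x)) Z)"
      "Cmp (C ?T) (onArr (R ?T J (\<lambda>x. x)) \<eta>) r = Idn (C ?T) (onObj (R ?T Q (\<lambda>x. x)) Y)"
      by (rule isoE[OF _ pr\<eta>])
    have "iso (C ?T) r" by (rule isoI[OF r(1) pr\<eta> r(3,2)])
    from universal_arrow_precompose_iso[OF R_Fun[OF order_map_to_pt[OF iS]] pw[OF k] r(1) this]
    show "univ_cocone ?T Q (\<lambda>x. x) k Y"
      using S.Cmp_assoc[OF r(1) pr\<eta> trh] r(3) S.Cmp_Idn_right[OF trh] by (simp add: univ_cocone_def)
  qed
next
  assume "\<forall>k \<in> Q - J. univ_cocone {x \<in> J. le x k} Q (\<lambda>x. x) k Y"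
  then show "\<exists>Z \<eta>. universal_arrow (R J Q (\<lambda>x. x)) Z Y \<eta>"
    using restriction_universal[OF Q Y] by blast
qed

section \<open>Pasting of colimit cocones on a grid\<close>

text \<open>Finality replaces the corners of the right and of the outer square by all of \<open>B\<close> and of \<open>A\<close>, which differ in
\<open>g 1 1\<close>; the hypothesis says that \<open>X\<close> on \<open>B\<close> is Kan extended from \<open>A\<close>. The grid is given by a
parametrization \<open>g\<close>, since for the reversed order it starts at the opposite vertex.\<close>

lemma univ_cocone_pasting:
  fixes g :: "nat \<Rightarrow> nat \<Rightarrow> 'i"
  assumes le_g: "\<And>i j i' j'. i \<le> 2 \<Longrightarrow> j \<le> 1 \<Longrightarrow> i' \<le> 2 \<Longrightarrow> j' \<le> 1 \<Longrightarrow>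
      le (g i j) (g i' j') \<longleftrightarrow> i \<le> i' \<and> j \<le> j'"
    and Q: "Q = {g 0 0, g 1 0, g 2 0, g 0 1, g 1 1, g 2 1}"
    and X: "X \<in> Obj (C Q)"
    and left: "univ_cocone {g 0 0, g 1 0, g 0 1} Q (\<lambda>x. x) (g 1 1) X"
  shows "univ_cocone {g 1 0, g 2 0, g 1 1} Q (\<lambda>x. x) (g 2 1) X \<longleftrightarrow>
         univ_cocone {g 0 0, g 2 0, g 0 1} Q (\<lambda>x. x) (g 2 1) X"
proof -
  have ne: "g i j = g i' j' \<longleftrightarrow> i = i' \<and> j = j'" if "i \<le> 2" "j \<le> 1" "i' \<le> 2" "j' \<le> 1" for i j i' j'
    using le_g[OF that] le_g[OF that(3,4,1,2)] le_g[OF that(1,2) that(1,2)] le_g[OF that(3,4) that(3,4)]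
    by auto
  define A where "A = {g 0 0, g 1 0, g 2 0, g 0 1}"
  define B where "B = {g 0 0, g 1 0, g 2 0, g 0 1, g 1 1}"
  have iQ: "index le Q" by (auto simp: index_def Q le_g)
  have sub: "A \<subseteq> B" "B \<subseteq> Q" "A \<subseteq> Q" by (auto simp: A_def B_def Q)
  have i: "index le A" "index le B" using index_subset[OF iQ] sub by auto
  have c: "g 2 1 \<in> Q" "below le B (\<lambda>x. x) (\<lambda>_. g 2 1)" "below le A (\<lambda>x. x) (\<lambda>_. g 2 1)"
    by (auto simp: Q A_def B_def below_def le_g)
  \<comment> \<open>The left adjoints of the inclusions into \<open>B\<close> and \<open>A\<close> move each missing element up to the
    least element above it that is present.\<close>
  have right: "univ_cocone {g 1 0, g 2 0, g 1 1} Q (\<lambda>x. x) (g 2 1) X \<longleftrightarrow> univ_cocone B Q (\<lambda>x. x) (g 2 1) X"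
    using univ_cocone_right_adjoint[of "{g 1 0, g 2 0, g 1 1}" B "\<lambda>x. x"
        "\<lambda>x. if x = g 0 0 then g 1 0 else if x = g 0 1 then g 1 1 else x" Q "\<lambda>x. x" "g 2 1" X]
      i order_map_incl[OF iQ sub(2)] c X
    by (auto simp: order_map_def below_def index_def B_def le_g ne)
  have outer: "univ_cocone {g 0 0, g 2 0, g 0 1} Q (\<lambda>x. x) (g 2 1) X \<longleftrightarrow> univ_cocone A Q (\<lambda>x. x) (g 2 1) X"
    using univ_cocone_right_adjoint[of "{g 0 0, g 2 0, g 0 1}" A "\<lambda>x. x"
        "\<lambda>x. if x = g 1 0 then g 2 0 else x" Q "\<lambda>x. x" "g 2 1" X]
      i order_map_incl[OF iQ sub(3)] c X
    by (auto simp: order_map_def below_def index_def A_def le_g ne)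
  \<comment> \<open>The only slice to be checked is the one at \<open>g 1 1\<close>, and it is the corner of the left square.\<close>
  define XB where "XB = onObj (R B Q (\<lambda>x. x)) X"
  have XB: "XB \<in> Obj (C B)" unfolding XB_def by (rule R_Obj[OF order_map_incl[OF iQ sub(2)] X])
  have u: "universal_arrow (R A B (\<lambda>x. x)) (onObj (R A B (\<lambda>x. x)) XB) XB (Idn (C A) (onObj (R A B (\<lambda>x. x)) XB))"
  proof (rule restriction_universal[OF i(2) sub(1) XB])
    fix k assume "k \<in> B - A"
    then have k: "k = g 1 1" by (auto simp: A_def B_def)
    have S: "{x \<in> A. le x (g 1 1)} = {g 0 0, g 1 0, g 0 1}" by (auto simp: A_def le_g)
    have "univ_cocone {g 0 0, g 1 0, g 0 1} B (\<lambda>x. x) (g 1 1) XB \<longleftrightarrow>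
       univ_cocone {g 0 0, g 1 0, g 0 1} Q (\<lambda>x. x) (g 1 1) X"
      unfolding XB_def
      by (rule univ_cocone_restrict[OF order_map_incl[OF iQ sub(2)] order_map_incl[OF i(2)] _ _ X])
         (auto simp: B_def below_def le_g)
    then show "univ_cocone {x \<in> A. le x k} B (\<lambda>x. x) k XB"
      using left unfolding k S by simp
  qed
  have "univ_cocone A Q (\<lambda>x. x) (g 2 1) X \<longleftrightarrow> univ_cocone B Q (\<lambda>x. x) (g 2 1) X"
    using i c(1,2)
    by (intro univ_cocone_reindex[OF order_map_incl[OF i(2) sub(1)] order_map_incl[OF iQ sub(2)] _ _ X]
          bij_betw_of_universal_Idn[OF R_Fun[OF order_map_incl[OF i(2) sub(1)]] u[unfolded XB_def]]
          R_Obj order_map_to_pt) auto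
  then show ?thesis using right outer by simp
qed

end

lemma index_converse: "index (\<lambda>x y. le y x) = index le"
  by (simp add: index_def fun_eq_iff)

lemma order_map_converse: "order_map (\<lambda>x y. le y x) = order_map le"
  by (auto simp: order_map_def fun_eq_iff index_converse[of le])

lemma below_converse: "below (\<lambda>x y. le y x) P h h' \<longleftrightarrow> below le P h' h"
  by (simp add: below_def)

text \<open>The arrow of \<open>C P\<close> belonging to \<open>h \<le> h'\<close> has the opposite direction in the opposite category, where it belongs to
\<open>h' \<ge> h\<close>.\<close>

lemma diagrams_op:
  assumes "diagrams le C R tr pt"
  shows "diagrams (\<lambda>x y. le y x) (\<lambda>P. op_cat (C P)) (\<lambda>P Q h. op_fun (R P Q h))
           (\<lambda>P Q h h' X. tr P Q h' h X) pt"
proof -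
  interpret diagrams le C R tr pt by fact
  note [simp] = index_converse[of le] order_map_converse[of le] below_converse[of le]
  show ?thesis
  proof (rule diagrams.intro, goal_cases)
    case 1 then show ?case by (rule le_pt)
  next
    case (2 P) then show ?case by (simp add: C_category category_op)
  next
    case (3 P Q h) then show ?case by (simp add: R_Fun op_fun_Fun)
  next
    case (4 P h h' Q) then show ?case using R_cong[of P h h' Q] by simp
  next
    case (5 P) then show ?case by (simp add: R_id op_fun_id)
  next
    case (6 P Q h S g) then show ?case by (simp add: R_comp op_fun_comp)
  next
    case (7 P Q h h' X) then show ?case by (simp add: tr_hom)
  next
    case (8 P Q h h' f X Y) then show ?case by (simp add: tr_natural)
  next
    case (9 P Q h X) then show ?case by (simp add: tr_id)
  next
    case (10 P Q h h' h'' X) then show ?case by (simp add: tr_comp)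
  next
    case (11 P Q h S g g' X) then show ?case by (simp add: tr_left)
  next
    case (12 P Q h h' S g X) then show ?case by (simp add: tr_right)
  next
    case (13 P f) then show ?case by (simp add: iso_pointwise)
  qed
qed

section \<open>Finite posets as index categories\<close>

lemma code_le_trans: "code_le x y \<Longrightarrow> code_le y z \<Longrightarrow> code_le x z"
  by (induction x y arbitrary: z rule: code_le.induct) (case_tac z; auto)+

lemma poset_simps:
  "Obj (poset P) = P"
  "Arr (poset P) = {Pr x y | x y. x \<in> P \<and> y \<in> P \<and> code_le x y}"
  "x \<in> P \<Longrightarrow> y \<in> P \<Longrightarrow> code_le x y \<Longrightarrow> Dom (poset P) (Pr x y) = x"
  "x \<in> P \<Longrightarrow> y \<in> P \<Longrightarrow> code_le x y \<Longrightarrow> Cod (poset P) (Pr x y) = y"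
  "x \<in> P \<Longrightarrow> Idn (poset P) x = Pr x x"
  by (auto simp: poset_def mk_cat_def)

lemma poset_hom: "f \<in> hom (poset P) x y \<longleftrightarrow> f = Pr x y \<and> x \<in> P \<and> y \<in> P \<and> code_le x y"
  by (auto simp: hom_def poset_def mk_cat_def)

lemma poset_Cmp: "x \<in> P \<Longrightarrow> y \<in> P \<Longrightarrow> z \<in> P \<Longrightarrow> code_le x y \<Longrightarrow> code_le y z \<Longrightarrow>
    Cmp (poset P) (Pr y z) (Pr x y) = Pr x z"
  by (auto simp: poset_def mk_cat_def)

lemma category_poset: "index code_le P \<Longrightarrow> category (poset P)"
  unfolding poset_def index_def by (rule category_mk_cat) (auto intro: code_le_trans)

lemma monotone_fun_simps:
  "Src (monotone_fun P Q h) = poset P" "Trg (monotone_fun P Q h) = poset Q"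
  "x \<in> P \<Longrightarrow> onObj (monotone_fun P Q h) x = h x"
  "x \<in> P \<Longrightarrow> y \<in> P \<Longrightarrow> code_le x y \<Longrightarrow> onArr (monotone_fun P Q h) (Pr x y) = Pr (h x) (h y)"
  by (auto simp: monotone_fun_def mk_fun_def poset_simps)

lemma monotone_fun_Fun: "order_map code_le P Q h \<Longrightarrow> monotone_fun P Q h \<in> Fun (poset P) (poset Q)"
  by (rule FunI)
     (auto simp: monotone_fun_simps order_map_index category_poset poset_simps(1,2,5) poset_hom poset_Cmp
       order_map_def index_def Pi_iff dest: code_le_trans,
      auto simp: monotone_fun_def mk_fun_def poset_simps(1,2))

lemma monotone_fun_cong: "(\<And>x. x \<in> P \<Longrightarrow> h x = h' x) \<Longrightarrow> monotone_fun P Q h = monotone_fun P Q h'"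
  by (auto simp: monotone_fun_def mk_fun_def poset_simps intro!: restrict_ext)

lemma monotone_fun_id: "monotone_fun P P (\<lambda>x. x) = id_fun (poset P)"
  by (auto simp: monotone_fun_def id_fun_def mk_fun_def poset_simps intro!: restrict_ext)

lemma monotone_fun_comp:
  "order_map code_le P Q h \<Longrightarrow> monotone_fun Q S g \<odot> monotone_fun P Q h = monotone_fun P S (\<lambda>x. g (h x))"
  by (auto simp: monotone_fun_def comp_fun_def mk_fun_def poset_simps order_map_def Pi_iff intro!: restrict_ext)

definition monotone_nat :: "'x code set \<Rightarrow> 'x code set \<Rightarrow> ('x code \<Rightarrow> 'x code) \<Rightarrow> ('x code \<Rightarrow> 'x code) \<Rightarrow> 'x snat" where
  "monotone_nat P Q h h' = mk_nat (monotone_fun P Q h) (monotone_fun P Q h') (\<lambda>x. Pr (h x) (h' x))"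

lemma monotone_nat_Nat:
  "order_map code_le P Q h \<Longrightarrow> order_map code_le P Q h' \<Longrightarrow> below code_le P h h' \<Longrightarrow>
    monotone_nat P Q h h' \<in> Nat (monotone_fun P Q h) (monotone_fun P Q h')"
  by (rule NatI[OF monotone_fun_Fun monotone_fun_Fun])
     (auto simp: monotone_nat_def mk_nat_def monotone_fun_simps poset_simps poset_hom poset_Cmp
       order_map_def Pi_iff below_def)

lemma monotone_nat_id: "order_map code_le P Q h \<Longrightarrow> monotone_nat P Q h h = id_nat (monotone_fun P Q h)"
  by (auto simp: monotone_nat_def id_nat_def mk_nat_def monotone_fun_simps poset_simps order_map_def Pi_iff
      intro!: restrict_ext)

lemma monotone_nat_vcomp:
  "order_map code_le P Q h \<Longrightarrow> order_map code_le P Q h' \<Longrightarrow> order_map code_le P Q h'' \<Longrightarrow>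
   below code_le P h h' \<Longrightarrow> below code_le P h' h'' \<Longrightarrow>
   monotone_nat P Q h' h'' \<bullet> monotone_nat P Q h h' = monotone_nat P Q h h''"
  by (auto simp: monotone_nat_def vcomp_def mk_nat_def monotone_fun_simps poset_simps poset_Cmp
      order_map_def Pi_iff below_def intro!: restrict_ext)

lemma monotone_nat_whisker_right:
  "order_map code_le P Q h \<Longrightarrow>
   monotone_nat Q S g g' \<triangleleft> monotone_fun P Q h = monotone_nat P S (\<lambda>x. g (h x)) (\<lambda>x. g' (h x))"
  by (auto simp: monotone_nat_def whisker_right_def mk_nat_def monotone_fun_comp monotone_fun_simps poset_simps
      order_map_def Pi_iff intro!: restrict_ext)

lemma monotone_nat_whisker_left:
  "order_map code_le P Q h \<Longrightarrow> order_map code_le P Q h' \<Longrightarrow> below code_le P h h' \<Longrightarrow>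
   monotone_fun Q S g \<triangleright> monotone_nat P Q h h' = monotone_nat P S (\<lambda>x. g (h x)) (\<lambda>x. g (h' x))"
  by (auto simp: monotone_nat_def whisker_left_def mk_nat_def monotone_fun_comp monotone_fun_simps poset_simps
      order_map_def Pi_iff below_def intro!: restrict_ext)

lemma chain_0: "chain 0 = {Num 0}"
  by (simp add: chain_def)

lemma point_poset: "k \<in> Q \<Longrightarrow> point (poset Q) k = monotone_fun {Num 0} Q (\<lambda>_. k)"
  by (auto simp: point_def monotone_fun_def mk_fun_def term_cat_def chain_0 poset_simps)

lemma to_term_poset: "to_term (poset S) = monotone_fun S {Num 0} (\<lambda>_. Num 0)"
  by (auto simp: to_term_def monotone_fun_def mk_fun_def term_cat_def chain_0 poset_simps)

context prederivator
begin

lemma small_poset: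
  assumes "index code_le P"
  shows "small_cat small (poset P)"
proof -
  have "Arr (poset P) \<subseteq> case_prod Pr ` (P \<times> P)" by (auto simp: poset_simps)
  moreover have "finite P" using assms by (simp add: index_def)
  ultimately have "finite (Arr (poset P))" by (meson finite_SigmaI finite_imageI finite_subset)
  then show ?thesis
    using assms \<open>finite P\<close> by (simp add: small_cat_def category_poset small_finite poset_simps(1))
qed

definition dgm :: "'x code set \<Rightarrow> ('o, 'a) cat" where
  "dgm P = at_cat \<D> (poset P)"

definition restr :: "'x code set \<Rightarrow> 'x code set \<Rightarrow> ('x code \<Rightarrow> 'x code) \<Rightarrow> ('o, 'a, 'o, 'a) functr" where
  "restr P Q h = at_fun \<D> (monotone_fun P Q h)"

text \<open>The transformation between monotone maps \<open>h \<le> h'\<close> is unique, which is why \<open>h\<close> and \<open>h'\<close> suffice as arguments.\<close>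

definition trans_map ::
  "'x code set \<Rightarrow> 'x code set \<Rightarrow> ('x code \<Rightarrow> 'x code) \<Rightarrow> ('x code \<Rightarrow> 'x code) \<Rightarrow> 'o \<Rightarrow> 'a" where
  "trans_map P Q h h' X = component (at_nat \<D> (monotone_nat P Q h h')) X"

lemma at_monotone_fun: "order_map code_le P Q h \<Longrightarrow> at_fun \<D> (monotone_fun P Q h) \<in> Fun (dgm Q) (dgm P)"
  unfolding dgm_def by (rule at_fun) (auto intro: small_poset monotone_fun_Fun order_map_index)

lemma at_monotone_nat:
  "order_map code_le P Q h \<Longrightarrow> order_map code_le P Q h' \<Longrightarrow> below code_le P h h' \<Longrightarrow>
   at_nat \<D> (monotone_nat P Q h h') \<in> Nat (at_fun \<D> (monotone_fun P Q h)) (at_fun \<D> (monotone_fun P Q h'))"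
  by (rule at_nat[of "poset P" "poset Q"])
     (auto intro: small_poset monotone_fun_Fun monotone_nat_Nat order_map_index)

end

context derivator
begin

lemma dgm_diagrams: "diagrams code_le dgm restr trans_map (Num 0)"
proof (rule diagrams.intro, goal_cases)
  case 1 then show ?case by simp
next
  case (2 P) then show ?case unfolding dgm_def by (intro at_cat small_poset)
next
  case (3 P Q h) then show ?case by (simp add: restr_def at_monotone_fun)
next
  case (4 P h h' Q) then show ?case using monotone_fun_cong[of P h h' Q] by (simp add: restr_def)
next
  case (5 P) then show ?case by (simp add: restr_def monotone_fun_id at_id_fun small_poset dgm_def)
next
  case (6 P Q h S g)
  then show ?case
    unfolding restr_def monotone_fun_comp[OF 6(1), symmetric]
    by (intro at_comp_fun[of "poset P" "poset Q" "poset S"])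
       (auto intro: small_poset monotone_fun_Fun order_map_index)
next
  case (7 P Q h h' X)
  then show ?case
    unfolding trans_map_def restr_def by (intro Nat_hom[OF at_monotone_nat at_monotone_fun])
next
  case (8 P Q h h' f X Y)
  then show ?case
    unfolding trans_map_def restr_def by (intro Nat_natural[OF at_monotone_nat at_monotone_fun])
next
  case (9 P Q h X)
  have "at_nat \<D> (monotone_nat P Q h h) = id_nat (at_fun \<D> (monotone_fun P Q h))"
    unfolding monotone_nat_id[OF 9(1)]
    by (intro at_id_nat[of "poset P" "poset Q"])
       (use 9 in \<open>auto intro: small_poset monotone_fun_Fun order_map_index\<close>)
  then show ?case
    using 9 Fun_simps[OF at_monotone_fun[OF 9(1)]]
    by (simp add: trans_map_def restr_def id_nat_def mk_nat_def)
next
  case (10 P Q h h' h'' X)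
  have "at_nat \<D> (monotone_nat P Q h h'') =
      at_nat \<D> (monotone_nat P Q h' h'') \<bullet> at_nat \<D> (monotone_nat P Q h h')"
    unfolding monotone_nat_vcomp[OF 10(1-5), symmetric]
    by (intro at_vcomp[of "poset P" "poset Q" "monotone_fun P Q h" "monotone_fun P Q h'" "monotone_fun P Q h''"])
       (use 10 in \<open>auto intro: small_poset monotone_fun_Fun monotone_nat_Nat order_map_index\<close>)
  then show ?case
    using 10(6) Fun_simps[OF at_monotone_fun[OF 10(1)]] NSrc_Nat[OF at_monotone_nat[OF 10(1,2,4)]]
    by (simp add: trans_map_def vcomp_def mk_nat_def)
next
  case (11 P Q h S g g' X)
  have "at_nat \<D> (monotone_nat P S (\<lambda>x. g (h x)) (\<lambda>x. g' (h x))) =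
      at_fun \<D> (monotone_fun P Q h) \<triangleright> at_nat \<D> (monotone_nat Q S g g')"
    unfolding monotone_nat_whisker_right[OF 11(1), symmetric]
    by (intro at_whisker_right[of "poset P" "poset Q" "poset S" "monotone_fun Q S g" "monotone_fun Q S g'"])
       (use 11 in \<open>auto intro: small_poset monotone_fun_Fun monotone_nat_Nat order_map_index\<close>)
  then show ?case
    using 11(5) Fun_simps[OF at_monotone_fun[OF 11(2)]] NSrc_Nat[OF at_monotone_nat[OF 11(2-4)]]
    by (simp add: trans_map_def restr_def whisker_left_def mk_nat_def comp_fun_simps)
next
  case (12 P Q h h' S g X)
  have "at_nat \<D> (monotone_nat P S (\<lambda>x. g (h x)) (\<lambda>x. g (h' x))) =
      at_nat \<D> (monotone_nat P Q h h') \<triangleleft> at_fun \<D> (monotone_fun Q S g)"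
    unfolding monotone_nat_whisker_left[OF 12(1-3), symmetric]
    by (intro at_whisker_left[of "poset P" "poset Q" "poset S" "monotone_fun P Q h" "monotone_fun P Q h'"])
       (use 12 in \<open>auto intro: small_poset monotone_fun_Fun monotone_nat_Nat order_map_index\<close>)
  then show ?case
    using 12(5) Fun_simps[OF at_monotone_fun[OF 12(4)]] NSrc_Nat[OF at_monotone_nat[OF 12(1-3)]]
    by (simp add: trans_map_def restr_def whisker_right_def mk_nat_def comp_fun_simps)
next
  case (13 P f)
  then show ?case
    using Der2[OF small_poset[OF 13(1)], of f]
    by (simp add: dgm_def restr_def poset_simps(1) point_poset term_cat_def chain_0)
qed

end

section \<open>Slices of posets\<close>

context
  fixes P S :: "'x code set" and c :: "'x code \<Rightarrow> 'x code"
    and ok :: "'x code \<Rightarrow> 'x code \<Rightarrow> 'x code \<Rightarrow> bool"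
  assumes P: "index code_le P" and S: "S \<subseteq> P"
    and ok: "\<forall>x \<in> S. \<forall>y \<in> S. code_le x y \<longrightarrow> ok (Pr x (c x)) (Pr y (c y)) (Pr x y)"
begin

text \<open>The slices and coslices of a monotone map at a point are of this form: an element \<open>x\<close> of a subset \<open>S\<close>
of \<open>P\<close> is tagged with the arrow \<open>c x\<close>, and \<open>ok\<close> is the commutativity of a triangle, which is automatic in a
poset. So they are isomorphic, by \<open>tag\<close> and \<open>untag\<close>, to the poset \<open>S\<close>.\<close>

definition tagged_cat :: "'x scat" where
  "tagged_cat = pair_cat (poset P) ((\<lambda>x. Pr x (c x)) ` S) ok"

definition tag :: "'x sfun" where
  "tag = mk_fun (poset S) tagged_cat (\<lambda>x. Pr x (c x))
     (\<lambda>f. Pr (Pr (Pr (pfst f) (c (pfst f))) (Pr (psnd f) (c (psnd f)))) f)"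

definition untag :: "'x sfun" where
  "untag = mk_fun tagged_cat (poset S) pfst psnd"

lemma tagged_cat_eq: "tagged_cat =
    mk_cat ((\<lambda>x. Pr x (c x)) ` S)
      {Pr (Pr (Pr x (c x)) (Pr y (c y))) (Pr x y) | x y. x \<in> S \<and> y \<in> S \<and> code_le x y}
      (\<lambda>t. pfst (pfst t)) (\<lambda>t. psnd (pfst t)) (\<lambda>a. Pr (Pr a a) (Idn (poset P) (pfst a)))
      (\<lambda>s t. Pr (Pr (pfst (pfst t)) (psnd (pfst s))) (Cmp (poset P) (psnd s) (psnd t)))"
proof -
  have "{Pr (Pr a b) g | a b g. a \<in> (\<lambda>x. Pr x (c x)) ` S \<and> b \<in> (\<lambda>x. Pr x (c x)) ` S \<and>
      g \<in> hom (poset P) (pfst a) (pfst b) \<and> ok a b g} =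
    {Pr (Pr (Pr x (c x)) (Pr y (c y))) (Pr x y) | x y. x \<in> S \<and> y \<in> S \<and> code_le x y}"
    using S ok by (auto simp: poset_hom)
  then show ?thesis by (simp add: tagged_cat_def pair_cat_def)
qed

lemma tagged_Obj: "Obj tagged_cat = (\<lambda>x. Pr x (c x)) ` S"
  by (simp add: tagged_cat_eq mk_cat_def)

lemma tagged_Arr: "Arr tagged_cat =
    {Pr (Pr (Pr x (c x)) (Pr y (c y))) (Pr x y) | x y. x \<in> S \<and> y \<in> S \<and> code_le x y}"
  by (simp add: tagged_cat_eq mk_cat_def)

lemma tagged_hom: "f \<in> hom tagged_cat a b \<longleftrightarrow>
    (\<exists>x y. a = Pr x (c x) \<and> b = Pr y (c y) \<and> f = Pr (Pr a b) (Pr x y) \<and> x \<in> S \<and> y \<in> S \<and> code_le x y)"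
  by (auto simp: hom_def tagged_cat_eq mk_cat_def)

lemma tagged_Idn: "x \<in> S \<Longrightarrow> Idn tagged_cat (Pr x (c x)) = Pr (Pr (Pr x (c x)) (Pr x (c x))) (Pr x x)"
  using S by (auto simp: tagged_cat_eq mk_cat_def poset_simps)

lemma tagged_Cmp:
  assumes "x \<in> S" "y \<in> S" "z \<in> S" "code_le x y" "code_le y z"
  shows "Cmp tagged_cat (Pr (Pr (Pr y (c y)) (Pr z (c z))) (Pr y z)) (Pr (Pr (Pr x (c x)) (Pr y (c y))) (Pr x y)) =
    Pr (Pr (Pr x (c x)) (Pr z (c z))) (Pr x z)"
proof -
  have "Cmp (poset P) (Pr y z) (Pr x y) = Pr x z" using assms S by (intro poset_Cmp) auto
  then show ?thesis using assms by (simp add: tagged_cat_eq mk_cat_def)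
qed

lemma tagged_category: "category tagged_cat"
proof -
  have cmp: "Cmp (poset P) (Pr y z) (Pr x y) = Pr x z"
    if "x \<in> S" "y \<in> S" "z \<in> S" "code_le x y" "code_le y z" for x y z
    using that S by (intro poset_Cmp) auto
  have idn: "Idn (poset P) x = Pr x x" and refl: "code_le x x" if "x \<in> S" for x
    using that S P by (auto simp: poset_simps(5) index_def)
  show ?thesis
    unfolding tagged_cat_eq
  proof (rule category_mk_cat, goal_cases)
    case (5 f g h)
    then obtain x y z w where "f = Pr (Pr (Pr x (c x)) (Pr y (c y))) (Pr x y)"
      "g = Pr (Pr (Pr y (c y)) (Pr z (c z))) (Pr y z)" "h = Pr (Pr (Pr z (c z)) (Pr w (c w))) (Pr z w)"
      "x \<in> S" "y \<in> S" "z \<in> S" "w \<in> S" "code_le x y" "code_le y z" "code_le z w"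
      by auto
    then show ?case
      using code_le_trans[of x y z] code_le_trans[of y z w] by (simp add: cmp)
  qed (auto simp: cmp idn refl dest: code_le_trans)
qed

lemma refl_S: "x \<in> S \<Longrightarrow> code_le x x"
  using P S by (auto simp: index_def)

lemma tag_Fun: "tag \<in> Fun (poset S) tagged_cat"
proof (rule FunI)
  show "category (poset S)" by (rule category_poset[OF index_subset[OF P S]])
  show "category tagged_cat" by (rule tagged_category)
  show "onArr tag f \<in> hom tagged_cat (onObj tag a) (onObj tag b)" if "f \<in> hom (poset S) a b" for f a b
    using that by (auto simp: poset_hom tag_def mk_fun_def tagged_hom poset_simps(1,2))
  show "onArr tag (Idn (poset S) a) = Idn tagged_cat (onObj tag a)" if "a \<in> Obj (poset S)" for a
    using that by (simp add: tag_def mk_fun_def tagged_Idn poset_simps(1,2,5) refl_S)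
  show "onArr tag (Cmp (poset S) g f) = Cmp tagged_cat (onArr tag g) (onArr tag f)"
    if "f \<in> hom (poset S) x y" "g \<in> hom (poset S) y z" for f g x y z
    using that code_le_trans[of x y z] by (simp add: poset_hom poset_Cmp tag_def mk_fun_def tagged_Cmp poset_simps(1,2))
qed (auto simp: tag_def mk_fun_def poset_simps(1,2) tagged_Obj)

lemma untag_Fun: "untag \<in> Fun tagged_cat (poset S)"
proof (rule FunI)
  show "category (poset S)" by (rule category_poset[OF index_subset[OF P S]])
  show "category tagged_cat" by (rule tagged_category)
  show "onArr untag f \<in> hom (poset S) (onObj untag a) (onObj untag b)" if "f \<in> hom tagged_cat a b" for f a b
    using that by (auto simp: poset_hom untag_def mk_fun_def tagged_hom tagged_Obj tagged_Arr)
  show "onArr untag (Idn tagged_cat a) = Idn (poset S) (onObj untag a)" if "a \<in> Obj tagged_cat" for a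
    using that by (auto simp: untag_def mk_fun_def tagged_Idn tagged_Obj tagged_Arr poset_simps(5) refl_S)
  show "onArr untag (Cmp tagged_cat g f) = Cmp (poset S) (onArr untag g) (onArr untag f)"
    if f: "f \<in> hom tagged_cat a b" and g: "g \<in> hom tagged_cat b d" for f g a b d
  proof -
    obtain x y where xy: "a = Pr x (c x)" "b = Pr y (c y)" "f = Pr (Pr a b) (Pr x y)" "x \<in> S" "y \<in> S" "code_le x y"
      using f by (auto simp: tagged_hom)
    obtain z where z: "d = Pr z (c z)" "g = Pr (Pr b d) (Pr y z)" "z \<in> S" "code_le y z"
      using g xy(2) by (auto simp: tagged_hom)
    have "code_le x z" using xy z code_le_trans by blast
    then show ?thesis
      using xy z by (simp add: tagged_Cmp poset_Cmp untag_def mk_fun_def tagged_Arr)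
  qed
qed (auto simp: untag_def mk_fun_def poset_simps(1) tagged_Obj)

lemma untag_tag: "untag \<odot> tag = id_fun (poset S)"
  by (auto simp: untag_def tag_def comp_fun_def id_fun_def mk_fun_def poset_simps(1,2) tagged_Obj tagged_Arr
      intro!: restrict_ext)

lemma tag_untag: "tag \<odot> untag = id_fun tagged_cat"
  by (auto simp: untag_def tag_def comp_fun_def id_fun_def mk_fun_def poset_simps(1,2) tagged_Obj tagged_Arr
      intro!: restrict_ext)

lemma tagged_proj: "mk_fun tagged_cat (poset P) pfst psnd = monotone_fun S P (\<lambda>x. x) \<odot> untag"
  by (auto simp: untag_def monotone_fun_def comp_fun_def mk_fun_def poset_simps(1,2) tagged_Obj tagged_Arr
      intro!: restrict_ext)

lemma tagged_to_term: "to_term tagged_cat = to_term (poset S) \<odot> untag"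
  by (auto simp: untag_def to_term_def comp_fun_def mk_fun_def poset_simps(1,2) tagged_Obj tagged_Arr
      intro!: restrict_ext)

lemma tagged_proj_comp:
  "monotone_fun P Q h \<odot> mk_fun tagged_cat (poset P) pfst psnd = monotone_fun S Q h \<odot> untag"
proof -
  have SP: "x \<in> P" if "x \<in> S" for x using that S by auto
  show ?thesis
    by (auto simp: comp_fun_def mk_fun_def monotone_fun_def untag_def poset_simps(1,2) tagged_Obj tagged_Arr SP
        intro!: restrict_ext)
qed

lemma tagged_point:
  assumes "index code_le Q" "k \<in> Q"
  shows "point (poset Q) k \<odot> to_term tagged_cat = monotone_fun S Q (\<lambda>_. k) \<odot> untag"
  using assms
  by (auto simp: comp_fun_def mk_fun_def monotone_fun_def untag_def poset_simps(1,2,5) tagged_Obj tagged_Arr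
      point_def to_term_def term_cat_def chain_0 index_def intro!: restrict_ext)

lemma tagged_nat:
  assumes "\<And>x. x \<in> S \<Longrightarrow> c x = Pr (h x) (h' x)"
  shows "mk_nat (monotone_fun S Q h \<odot> untag) (monotone_fun S Q h' \<odot> untag) psnd = monotone_nat S Q h h' \<triangleleft> untag"
  using assms
  by (auto simp: monotone_nat_def whisker_right_def mk_nat_def comp_fun_simps untag_def mk_fun_def poset_simps(1,2)
      tagged_Obj monotone_fun_simps intro!: restrict_ext)

lemma tagged_finite: "finite (Obj tagged_cat)" "finite (Arr tagged_cat)"
proof -
  have S': "finite S" using P S by (auto simp: index_def intro: finite_subset)
  then show "finite (Obj tagged_cat)" by (simp add: tagged_Obj)
  have "Arr tagged_cat \<subseteq> (\<lambda>(x, y). Pr (Pr (Pr x (c x)) (Pr y (c y))) (Pr x y)) ` (S \<times> S)"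
    by (auto simp: tagged_Arr)
  then show "finite (Arr tagged_cat)"
    using S' by (meson finite_SigmaI finite_imageI finite_subset)
qed

end

context prederivator
begin

text \<open>Diagrams over a slice are identified with diagrams over the subposet \<open>S\<close> by an isomorphism \<open>V\<close> of
categories, namely restriction along \<open>untag\<close>. The projections and the transformation of (Der4) factor
through \<open>untag\<close>, so their images under \<open>\<D>\<close> are those belonging to \<open>S\<close>, followed by \<open>V\<close>.\<close>

lemma at_tagged:
  assumes P: "index code_le P" and S: "S \<subseteq> P"
    and ok: "\<forall>x \<in> S. \<forall>y \<in> S. code_le x y \<longrightarrow> ok (Pr x (c x)) (Pr y (c y)) (Pr x y)"
  defines "I \<equiv> tagged_cat P S c ok" and "U \<equiv> untag P S c ok"
  obtains V where "small_cat small I" "to_term I \<in> Fun I (poset {Num 0})" "V \<in> Fun (dgm S) (at_cat \<D> I)"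
    "\<And>a b. a \<in> Obj (dgm S) \<Longrightarrow> b \<in> Obj (dgm S) \<Longrightarrow>
       bij_betw (onArr V) (hom (dgm S) a b) (hom (at_cat \<D> I) (onObj V a) (onObj V b))"
    "at_fun \<D> (mk_fun I (poset P) pfst psnd) = V \<odot> restr S P (\<lambda>x. x)"
    "at_fun \<D> (to_term I) = V \<odot> restr S {Num 0} (\<lambda>_. Num 0)"
    "\<And>Q h h' X. order_map code_le S Q h \<Longrightarrow> order_map code_le S Q h' \<Longrightarrow> below code_le S h h' \<Longrightarrow>
       X \<in> Obj (dgm Q) \<Longrightarrow>
       component (at_nat \<D> (monotone_nat S Q h h' \<triangleleft> U)) X = onArr V (trans_map S Q h h' X)"
proof -
  note hyps = P S ok
  have iS: "index code_le S" by (rule index_subset[OF P S])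
  have sI: "small_cat small I"
    unfolding I_def small_cat_def
    using tagged_category[of P S ok c] tagged_finite[of P S ok c] hyps small_finite by simp
  note sP = small_poset[OF P] and sS = small_poset[OF iS]
  have pt: "index code_le {Num 0}" by (simp add: index_def)
  note spt = small_poset[OF pt]
  have U: "U \<in> Fun I (poset S)" and T: "tag P S c ok \<in> Fun (poset S) I"
    unfolding I_def U_def using untag_Fun[of P S ok c] tag_Fun[of P S ok c] hyps by auto
  let ?V = "at_fun \<D> U" and ?W = "at_fun \<D> (tag P S c ok)"
  have V: "?V \<in> Fun (dgm S) (at_cat \<D> I)" and W: "?W \<in> Fun (at_cat \<D> I) (dgm S)"
    unfolding dgm_def by (rule at_fun[OF sI sS U], rule at_fun[OF sS sI T])
  have "?W \<odot> ?V = id_fun (dgm S)"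
    using at_comp_fun[OF sS sI sS T U] untag_tag[of P S ok c] hyps at_id_fun[OF sS]
    by (simp add: U_def dgm_def)
  moreover have "?V \<odot> ?W = id_fun (at_cat \<D> I)"
    using at_comp_fun[OF sI sS sI U T] tag_untag[of P S ok c] hyps at_id_fun[OF sI]
    by (simp add: U_def I_def)
  ultimately have bij: "bij_betw (onArr ?V) (hom (dgm S) a b) (hom (at_cat \<D> I) (onObj ?V a) (onObj ?V b))"
    if "a \<in> Obj (dgm S)" "b \<in> Obj (dgm S)" for a b
    using bij_betw_hom_of_inverse_functors[OF V W _ _ that] by simp
  have "at_fun \<D> (mk_fun I (poset P) pfst psnd) = ?V \<odot> restr S P (\<lambda>x. x)"
    using at_comp_fun[OF sI sS sP U monotone_fun_Fun[OF order_map_incl[OF P S]]]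
      tagged_proj[of P S ok c] hyps by (simp add: I_def U_def restr_def)
  moreover have "at_fun \<D> (to_term I) = ?V \<odot> restr S {Num 0} (\<lambda>_. Num 0)"
    using at_comp_fun[OF sI sS spt U monotone_fun_Fun[OF order_map_const[OF iS pt]]]
      tagged_to_term[of P S ok c] hyps by (simp add: I_def U_def restr_def to_term_poset)
  moreover have "component (at_nat \<D> (monotone_nat S Q h h' \<triangleleft> U)) X = onArr ?V (trans_map S Q h h' X)"
    if h: "order_map code_le S Q h" "order_map code_le S Q h'" "below code_le S h h'" "X \<in> Obj (dgm Q)" for Q h h' X
    using at_whisker_right[OF sI sS small_poset[OF order_map_index(2)[OF h(1)]] monotone_fun_Fun[OF h(1)]
        monotone_fun_Fun[OF h(2)] monotone_nat_Nat[OF h(1-3)] U]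
      NSrc_Nat[OF at_monotone_nat[OF h(1-3)]] Fun_simps[OF at_monotone_fun[OF h(1)]] h(4)
    by (simp add: whisker_left_def mk_nat_def comp_fun_simps trans_map_def)
  moreover have "to_term I \<in> Fun I (poset {Num 0})"
    using comp_fun_Fun[OF U monotone_fun_Fun[OF order_map_const[OF iS pt]]]
      tagged_to_term[of P S ok c] hyps by (simp add: I_def U_def to_term_poset)
  ultimately show thesis using that[OF sI _ V bij] by blast
qed

end

lemma slice_monotone_fun:
  assumes h: "order_map code_le P Q h" and k: "k \<in> Q"
  defines "S \<equiv> {x \<in> P. code_le (h x) k}" and "c \<equiv> \<lambda>x. Pr (h x) k"
    and "ok \<equiv> \<lambda>a b g. Cmp (poset Q) (psnd b) (onArr (monotone_fun P Q h) g) = psnd a"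
  shows "slice (monotone_fun P Q h) k = tagged_cat P S c ok"
    and "slice_proj (monotone_fun P Q h) k = mk_fun (tagged_cat P S c ok) (poset P) pfst psnd"
    and "slice_nat (monotone_fun P Q h) k = monotone_nat S Q h (\<lambda>_. k) \<triangleleft> untag P S c ok"
    and "\<forall>x \<in> S. \<forall>y \<in> S. code_le x y \<longrightarrow> ok (Pr x (c x)) (Pr y (c y)) (Pr x y)"
proof -
  have P: "index code_le P" and iQ: "index code_le Q" and SP: "S \<subseteq> P" using h by (auto simp: order_map_def S_def)
  show ok: "\<forall>x \<in> S. \<forall>y \<in> S. code_le x y \<longrightarrow> ok (Pr x (c x)) (Pr y (c y)) (Pr x y)"
    using h k by (auto simp: ok_def c_def S_def monotone_fun_simps poset_Cmp order_map_def Pi_iff)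
  have "{Pr j f | j f. j \<in> P \<and> f \<in> hom (poset Q) (onObj (monotone_fun P Q h) j) k} = (\<lambda>x. Pr x (c x)) ` S"
    using h k by (auto simp: poset_hom monotone_fun_simps S_def c_def order_map_def Pi_iff)
  then show sl: "slice (monotone_fun P Q h) k = tagged_cat P S c ok"
    by (simp add: slice_def tagged_cat_def[where c = c and ok = ok, OF P SP ok] monotone_fun_simps poset_simps(1),
        simp add: ok_def)
  show "slice_proj (monotone_fun P Q h) k = mk_fun (tagged_cat P S c ok) (poset P) pfst psnd"
    by (simp add: slice_proj_def sl monotone_fun_simps)
  show "slice_nat (monotone_fun P Q h) k = monotone_nat S Q h (\<lambda>_. k) \<triangleleft> untag P S c ok"
    unfolding slice_nat_def slice_proj_def monotone_fun_simps sl
      tagged_proj_comp[where c = c and ok = ok, OF P SP ok]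
      tagged_point[where c = c and ok = ok, OF P SP ok iQ k]
    by (rule tagged_nat[where c = c and ok = ok, OF P SP ok]) (auto simp: c_def)
qed

lemma coslice_monotone_fun:
  assumes h: "order_map code_le P Q h" and k: "k \<in> Q"
  defines "S \<equiv> {x \<in> P. code_le k (h x)}" and "c \<equiv> \<lambda>x. Pr k (h x)"
    and "ok \<equiv> \<lambda>a b g. Cmp (poset Q) (onArr (monotone_fun P Q h) g) (psnd a) = psnd b"
  shows "coslice (monotone_fun P Q h) k = tagged_cat P S c ok"
    and "coslice_proj (monotone_fun P Q h) k = mk_fun (tagged_cat P S c ok) (poset P) pfst psnd"
    and "coslice_nat (monotone_fun P Q h) k = monotone_nat S Q (\<lambda>_. k) h \<triangleleft> untag P S c ok"
    and "\<forall>x \<in> S. \<forall>y \<in> S. code_le x y \<longrightarrow> ok (Pr x (c x)) (Pr y (c y)) (Pr x y)"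
proof -
  have P: "index code_le P" and iQ: "index code_le Q" and SP: "S \<subseteq> P" using h by (auto simp: order_map_def S_def)
  show ok: "\<forall>x \<in> S. \<forall>y \<in> S. code_le x y \<longrightarrow> ok (Pr x (c x)) (Pr y (c y)) (Pr x y)"
    using h k by (auto simp: ok_def c_def S_def monotone_fun_simps poset_Cmp order_map_def Pi_iff)
  have "{Pr j f | j f. j \<in> P \<and> f \<in> hom (poset Q) k (onObj (monotone_fun P Q h) j)} = (\<lambda>x. Pr x (c x)) ` S"
    using h k by (auto simp: poset_hom monotone_fun_simps S_def c_def order_map_def Pi_iff)
  then show sl: "coslice (monotone_fun P Q h) k = tagged_cat P S c ok"
    by (simp add: coslice_def tagged_cat_def[where c = c and ok = ok, OF P SP ok] monotone_fun_simps poset_simps(1),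
        simp add: ok_def)
  show "coslice_proj (monotone_fun P Q h) k = mk_fun (tagged_cat P S c ok) (poset P) pfst psnd"
    by (simp add: coslice_proj_def sl monotone_fun_simps)
  show "coslice_nat (monotone_fun P Q h) k = monotone_nat S Q (\<lambda>_. k) h \<triangleleft> untag P S c ok"
    unfolding coslice_nat_def coslice_proj_def monotone_fun_simps sl
      tagged_proj_comp[where c = c and ok = ok, OF P SP ok]
      tagged_point[where c = c and ok = ok, OF P SP ok iQ k]
    by (rule tagged_nat[where c = c and ok = ok, OF P SP ok]) (auto simp: c_def)
qed

section \<open>Pointwise Kan extensions in a derivator\<close>

text \<open>Evaluated at \<open>Z\<close>, the map of (Der4) is the transpose along \<open>p\<^sub>! \<stileturn> p\<^sup>*\<close> of the cocone
\<open>pr\<^sup>* Z \<rightarrow> pr\<^sup>* u\<^sup>* u\<^sub>! Z \<rightarrow> p\<^sup>* k\<^sup>* u\<^sub>! Z\<close>.\<close>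

lemma component_slice_mate:
  assumes a: "adjunction ul U \<eta> \<epsilon>" "U \<in> Fun CQ CP" and b: "adjunction pl G \<eta>' \<epsilon>'" "G \<in> Fun E CI"
    and proj: "at_fun \<D> (slice_proj u k) \<in> Fun CP CI" and Z: "Z \<in> Obj CP"
  shows "component (slice_mate \<D> u k ul \<eta> pl \<epsilon>') Z =
     Cmp E (component \<epsilon>' (onObj (at_fun \<D> (point (Trg u) k)) (onObj ul Z)))
       (Cmp E (onArr pl (component (at_nat \<D> (slice_nat u k)) (onObj ul Z)))
          (onArr pl (onArr (at_fun \<D> (slice_proj u k)) (component \<eta> Z))))"
    and "Src (NSrc (slice_mate \<D> u k ul \<eta> pl \<epsilon>')) = CP" "Trg (NSrc (slice_mate \<D> u k ul \<eta> pl \<epsilon>')) = E"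
proof -
  note s = Fun_simps[OF adjunctionD(1)[OF a]] Fun_simps[OF a(2)] Fun_simps[OF adjunctionD(1)[OF b]]
    Fun_simps[OF proj]
  have n: "NSrc \<eta> = id_fun CP" using a(1) by (auto simp: adjunction_def Nat_def s)
  have \<eta>: "component \<eta> Z \<in> Arr CP" using adjunctionD(2)[OF a Z] hom_Arr by metis
  note simps = slice_mate_def vcomp_def whisker_left_def whisker_right_def mk_nat_def comp_fun_simps id_fun_simps s n
  show "Src (NSrc (slice_mate \<D> u k ul \<eta> pl \<epsilon>')) = CP" "Trg (NSrc (slice_mate \<D> u k ul \<eta> pl \<epsilon>')) = E"
    by (simp_all add: simps)
  show "component (slice_mate \<D> u k ul \<eta> pl \<epsilon>') Z =
     Cmp E (component \<epsilon>' (onObj (at_fun \<D> (point (Trg u) k)) (onObj ul Z)))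
       (Cmp E (onArr pl (component (at_nat \<D> (slice_nat u k)) (onObj ul Z)))
          (onArr pl (onArr (at_fun \<D> (slice_proj u k)) (component \<eta> Z))))"
    using Z \<eta> by (simp add: simps)
qed

lemma component_coslice_mate:
  assumes a: "adjunction U ur \<eta> \<epsilon>" "ur \<in> Fun CP CQ" and b: "adjunction G pr \<eta>' \<epsilon>'" "pr \<in> Fun CI E"
    and proj: "at_fun \<D> (coslice_proj u k) \<in> Fun CP CI" and Z: "Z \<in> Obj CP"
  shows "component (coslice_mate \<D> u k ur \<epsilon> pr \<eta>') Z =
     Cmp E (onArr pr (onArr (at_fun \<D> (coslice_proj u k)) (component \<epsilon> Z)))
       (Cmp E (onArr pr (component (at_nat \<D> (coslice_nat u k)) (onObj ur Z)))
          (component \<eta>' (onObj (at_fun \<D> (point (Trg u) k)) (onObj ur Z))))"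
    and "Src (NSrc (coslice_mate \<D> u k ur \<epsilon> pr \<eta>')) = CP" "Trg (NSrc (coslice_mate \<D> u k ur \<epsilon> pr \<eta>')) = E"
proof -
  note s = Fun_simps[OF adjunctionD(1)[OF a]] Fun_simps[OF a(2)] Fun_simps[OF adjunctionD(1)[OF b]]
    Fun_simps[OF proj] Fun_simps[OF b(2)]
  have n: "NSrc \<epsilon> = U \<odot> ur" "NSrc \<eta>' = id_fun E" using a(1) b(1) by (auto simp: adjunction_def Nat_def s)
  have \<epsilon>: "component \<epsilon> Z \<in> Arr CP" using adjunctionD(3)[OF a Z] hom_Arr by metis
  note simps = coslice_mate_def vcomp_def whisker_left_def whisker_right_def mk_nat_def comp_fun_simps id_fun_simps s n
  show "Src (NSrc (coslice_mate \<D> u k ur \<epsilon> pr \<eta>')) = CP" "Trg (NSrc (coslice_mate \<D> u k ur \<epsilon> pr \<eta>')) = E"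
    by (simp_all add: simps)
  show "component (coslice_mate \<D> u k ur \<epsilon> pr \<eta>') Z =
     Cmp E (onArr pr (onArr (at_fun \<D> (coslice_proj u k)) (component \<epsilon> Z)))
       (Cmp E (onArr pr (component (at_nat \<D> (coslice_nat u k)) (onObj ur Z)))
          (component \<eta>' (onObj (at_fun \<D> (point (Trg u) k)) (onObj ur Z))))"
    using Z \<epsilon> by (simp add: simps)
qed

context derivator
begin

text \<open>By (Der4) the transpose of the cocone over the slice is invertible, so the cocone is universal
(\<open>universal_arrow_iff_iso_transpose\<close>); the isomorphism \<open>V\<close> moves it to the subposet.\<close>

lemma dgm_kan_diagrams: "kan_diagrams code_le dgm restr trans_map (Num 0)"
proof (rule kan_diagrams.intro[OF dgm_diagrams kan_diagrams_axioms.intro])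
  interpret diagrams code_le dgm restr trans_map "Num 0" by (rule dgm_diagrams)
  fix P Q h Z
  assume h: "order_map code_le P Q h" and Z: "Z \<in> Obj (dgm P)"
  note iP = order_map_index(1)[OF h] and iQ = order_map_index(2)[OF h]
  note sP = small_poset[OF iP] and sQ = small_poset[OF iQ]
  have U: "restr P Q h \<in> Fun (dgm Q) (dgm P)" by (rule R_Fun[OF h])
  obtain ul \<eta> \<epsilon> where a: "adjunction ul (restr P Q h) \<eta> \<epsilon>"
    using Der3_left[OF sP sQ monotone_fun_Fun[OF h]] by (auto simp: restr_def)
  let ?Y = "onObj ul Z"
  have Y: "?Y \<in> Obj (dgm Q)" using Fun_Obj[OF adjunctionD(1)[OF a U] Z] .
  have "universal_arrow (restr {x \<in> P. code_le (h x) k} {Num 0} (\<lambda>_. Num 0))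
      (onObj (restr {x \<in> P. code_le (h x) k} P (\<lambda>x. x)) Z) (onObj (restr {Num 0} Q (\<lambda>_. k)) ?Y)
      (Cmp (dgm {x \<in> P. code_le (h x) k}) (trans_map {x \<in> P. code_le (h x) k} Q h (\<lambda>_. k) ?Y)
        (onArr (restr {x \<in> P. code_le (h x) k} P (\<lambda>x. x)) (component \<eta> Z)))" (is "universal_arrow ?const ?prZ ?Yk ?f")
    if k: "k \<in> Q" for k
  proof -
    define S where "S = {x \<in> P. code_le (h x) k}"
    define c where "c = (\<lambda>x. Pr (h x) k)"
    define ok where "ok = (\<lambda>a b g. Cmp (poset Q) (psnd b) (onArr (monotone_fun P Q h) g) = psnd a)"
    define I where "I = tagged_cat P S c ok"
    note sl = slice_monotone_fun[OF h k, folded S_def c_def ok_def]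
    have ok: "\<forall>x \<in> S. \<forall>y \<in> S. code_le x y \<longrightarrow> ok (Pr x (c x)) (Pr y (c y)) (Pr x y)"
      using sl(4) by (simp add: ok_def c_def)
    have SP: "S \<subseteq> P" by (auto simp: S_def)
    have iS: "index code_le S" by (rule index_subset[OF iP SP])
    note pr = order_map_incl[OF iP SP] and hS = order_map_restrict[OF h SP]
    note ck = order_map_const[OF iS iQ k]
    have b: "below code_le S h (\<lambda>_. k)" by (auto simp: below_def S_def)
    note prF = R_Fun[OF pr] and cF = R_Fun[OF order_map_to_pt[OF iS]]
    obtain V where sI: "small_cat small I" and tF: "to_term I \<in> Fun I (poset {Num 0})" and V: "V \<in> Fun (dgm S) (at_cat \<D> I)"
      and bij: "\<And>a b. a \<in> Obj (dgm S) \<Longrightarrow> b \<in> Obj (dgm S) \<Longrightarrow>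
         bij_betw (onArr V) (hom (dgm S) a b) (hom (at_cat \<D> I) (onObj V a) (onObj V b))"
      and V1: "at_fun \<D> (mk_fun I (poset P) pfst psnd) = V \<odot> restr S P (\<lambda>x. x)"
      and V2: "at_fun \<D> (to_term I) = V \<odot> restr S {Num 0} (\<lambda>_. Num 0)"
      and V3: "\<And>Q h h' X. order_map code_le S Q h \<Longrightarrow> order_map code_le S Q h' \<Longrightarrow> below code_le S h h' \<Longrightarrow>
         X \<in> Obj (dgm Q) \<Longrightarrow>
         component (at_nat \<D> (monotone_nat S Q h h' \<triangleleft> untag P S c ok)) X = onArr V (trans_map S Q h h' X)"
      using at_tagged[OF iP SP ok] unfolding I_def by blast
    note sl' = sl(1-3)[folded I_def]
    let ?G = "V \<odot> restr S {Num 0} (\<lambda>_. Num 0)"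
    have G: "?G \<in> Fun (dgm {Num 0}) (at_cat \<D> I)" by (rule comp_fun_Fun[OF cF V])
    have spt: "small_cat small (poset {Num 0})" by (rule small_poset) simp
    obtain pl \<eta>' \<epsilon>' where p: "adjunction pl ?G \<eta>' \<epsilon>'"
      using Der3_left[OF sI spt tF] by (auto simp: V2)
    let ?m = "slice_mate \<D> (monotone_fun P Q h) k ul \<eta> pl \<epsilon>'"
    have mate: "nat_iso ?m"
      by (rule Der4_left[OF sP sQ monotone_fun_Fun[OF h], of k ul \<eta> \<epsilon> pl \<eta>' \<epsilon>'])
         (use k a p in \<open>auto simp: poset_simps(1) restr_def sl' V2\<close>)
    have proj: "at_fun \<D> (slice_proj (monotone_fun P Q h) k) \<in> Fun (dgm P) (at_cat \<D> I)"
      unfolding sl' V1 by (rule comp_fun_Fun[OF prF V])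
    note m = component_slice_mate[OF a U p G proj Z]
    have iso: "iso (dgm {Num 0}) (component ?m Z)"
      using mate Z unfolding nat_iso_def m(2,3) by blast
    define Yk where "Yk = onObj (restr {Num 0} Q (\<lambda>_. k)) ?Y"
    have Yk: "Yk \<in> Obj (dgm {Num 0})" unfolding Yk_def by (rule R_Obj[OF order_map_from_pt[OF iQ k] Y])
    define t where "t = trans_map S Q h (\<lambda>_. k) ?Y"
    define e where "e = onArr (restr S P (\<lambda>x. x)) (component \<eta> Z)"
    define prZ where "prZ = onObj (restr S P (\<lambda>x. x)) Z"
    have e: "e \<in> hom (dgm S) prZ (onObj (restr S Q h) ?Y)"
      unfolding e_def prZ_def
      using Fun_hom[OF prF adjunctionD(2)[OF a U Z]] R_comp_Obj[OF pr h Y] by simp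
    have t: "t \<in> hom (dgm S) (onObj (restr S Q h) ?Y) (onObj (const_dgm S) Yk)"
      unfolding t_def Yk_def R_comp_Obj[OF order_map_to_pt[OF iS] order_map_from_pt[OF iQ k] Y]
      by (rule tr_hom[OF hS ck b Y])
    have f: "Cmp (dgm S) t e \<in> hom (dgm S) prZ (onObj (const_dgm S) Yk)"
      by (rule category.Cmp_hom[OF C_category[OF iS] e t])
    have "component ?m Z = Cmp (dgm {Num 0}) (component \<epsilon>' Yk)
        (Cmp (dgm {Num 0}) (onArr pl (onArr V t)) (onArr pl (onArr V e)))"
      unfolding m(1) monotone_fun_simps sl' V1 V3[OF hS ck b Y] t_def Yk_def e_def
      using adjunctionD(2)[OF a U Z] Fun_simps[OF prF]
      by (simp add: restr_def point_poset k comp_fun_simps hom_Arr)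
    also have "Cmp (dgm {Num 0}) (onArr pl (onArr V t)) (onArr pl (onArr V e)) =
        onArr pl (onArr V (Cmp (dgm S) t e))"
      using Fun_Cmp[OF V e t] Fun_Cmp[OF adjunctionD(1)[OF p G] Fun_hom[OF V e] Fun_hom[OF V t]] by simp
    finally have "universal_arrow ?G (onObj V prZ) Yk (onArr V (Cmp (dgm S) t e))"
      using universal_arrow_iff_iso_transpose[OF p G Yk] Fun_hom[OF V f] iso Yk Fun_simps[OF cF]
      by (simp add: comp_fun_simps)
    then have "universal_arrow (const_dgm S) prZ Yk (Cmp (dgm S) t e)"
      using universal_arrow_along_functor[OF cF V bij f Yk] hom_objs[OF C_category[OF iS] f]
        Fun_Obj[OF cF] by auto
    then show ?thesis by (simp add: S_def Yk_def t_def e_def prZ_def)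
  qed
  then show "\<exists>Y \<eta>. universal_arrow (restr P Q h) Z Y \<eta> \<and>
      (\<forall>k \<in> Q. let S = {x \<in> P. code_le (h x) k} in
         universal_arrow (const_dgm S) (onObj (restr S P (\<lambda>x. x)) Z) (onObj (at_pt Q k) Y)
           (Cmp (dgm S) (trans_map S Q h (\<lambda>_. k) Y) (onArr (restr S P (\<lambda>x. x)) \<eta>)))"
    unfolding Let_def using adjunction_unit_universal[OF a U Z] by blast
qed

text \<open>A right adjoint of \<open>u\<^sup>*\<close> is a left adjoint of the opposite functor, and the elements below \<open>k\<close> for the
reversed order form the coslice, so this is the other half of (Der3) and (Der4).\<close>

lemma dgm_kan_diagrams_op:
  "kan_diagrams (\<lambda>x y. code_le y x) (\<lambda>P. op_cat (dgm P)) (\<lambda>P Q h. op_fun (restr P Q h))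
     (\<lambda>P Q h h' X. trans_map P Q h' h X) (Num 0)"
proof (rule kan_diagrams.intro[OF diagrams_op[OF dgm_diagrams] kan_diagrams_axioms.intro],
    unfold order_map_converse[of code_le])
  interpret diagrams code_le dgm restr trans_map "Num 0" by (rule dgm_diagrams)
  fix P Q h Z
  assume h: "order_map code_le P Q h" and "Z \<in> Obj (op_cat (dgm P))"
  then have Z: "Z \<in> Obj (dgm P)" by simp
  note iP = order_map_index(1)[OF h] and iQ = order_map_index(2)[OF h]
  note sP = small_poset[OF iP] and sQ = small_poset[OF iQ]
  have U: "restr P Q h \<in> Fun (dgm Q) (dgm P)" by (rule R_Fun[OF h])
  obtain ur \<eta> \<epsilon> where a: "adjunction (restr P Q h) ur \<eta> \<epsilon>"
    using Der3_right[OF sP sQ monotone_fun_Fun[OF h]] by (auto simp: restr_def)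
  have ur: "ur \<in> Fun (dgm P) (dgm Q)" by (rule adjunction_right_Fun[OF a U])
  let ?Y = "onObj ur Z"
  have Y: "?Y \<in> Obj (dgm Q)" using Fun_Obj[OF ur Z] .
  have "universal_arrow (op_fun (restr {x \<in> P. code_le k (h x)} {Num 0} (\<lambda>_. Num 0)))
      (onObj (restr {x \<in> P. code_le k (h x)} P (\<lambda>x. x)) Z) (onObj (restr {Num 0} Q (\<lambda>_. k)) ?Y)
      (Cmp (dgm {x \<in> P. code_le k (h x)}) (onArr (restr {x \<in> P. code_le k (h x)} P (\<lambda>x. x)) (component \<epsilon> Z))
        (trans_map {x \<in> P. code_le k (h x)} Q (\<lambda>_. k) h ?Y))"
    if k: "k \<in> Q" for k
  proof -
    define S where "S = {x \<in> P. code_le k (h x)}"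
    define c where "c = (\<lambda>x. Pr k (h x))"
    define ok where "ok = (\<lambda>a b g. Cmp (poset Q) (onArr (monotone_fun P Q h) g) (psnd a) = psnd b)"
    define I where "I = tagged_cat P S c ok"
    note sl = coslice_monotone_fun[OF h k, folded S_def c_def ok_def]
    have ok: "\<forall>x \<in> S. \<forall>y \<in> S. code_le x y \<longrightarrow> ok (Pr x (c x)) (Pr y (c y)) (Pr x y)"
      using sl(4) by (simp add: ok_def c_def)
    have SP: "S \<subseteq> P" by (auto simp: S_def)
    have iS: "index code_le S" by (rule index_subset[OF iP SP])
    note pr = order_map_incl[OF iP SP] and hS = order_map_restrict[OF h SP]
    note ck = order_map_const[OF iS iQ k]
    have b: "below code_le S (\<lambda>_. k) h" by (auto simp: below_def S_def)
    note prF = R_Fun[OF pr] and cF = R_Fun[OF order_map_to_pt[OF iS]]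
    obtain V where sI: "small_cat small I" and tF: "to_term I \<in> Fun I (poset {Num 0})" and V: "V \<in> Fun (dgm S) (at_cat \<D> I)"
      and bij: "\<And>a b. a \<in> Obj (dgm S) \<Longrightarrow> b \<in> Obj (dgm S) \<Longrightarrow>
         bij_betw (onArr V) (hom (dgm S) a b) (hom (at_cat \<D> I) (onObj V a) (onObj V b))"
      and V1: "at_fun \<D> (mk_fun I (poset P) pfst psnd) = V \<odot> restr S P (\<lambda>x. x)"
      and V2: "at_fun \<D> (to_term I) = V \<odot> restr S {Num 0} (\<lambda>_. Num 0)"
      and V3: "\<And>Q h h' X. order_map code_le S Q h \<Longrightarrow> order_map code_le S Q h' \<Longrightarrow> below code_le S h h' \<Longrightarrow>
         X \<in> Obj (dgm Q) \<Longrightarrow>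
         component (at_nat \<D> (monotone_nat S Q h h' \<triangleleft> untag P S c ok)) X = onArr V (trans_map S Q h h' X)"
      using at_tagged[OF iP SP ok] unfolding I_def by blast
    note sl' = sl(1-3)[folded I_def]
    let ?G = "V \<odot> restr S {Num 0} (\<lambda>_. Num 0)"
    have G: "?G \<in> Fun (dgm {Num 0}) (at_cat \<D> I)" by (rule comp_fun_Fun[OF cF V])
    have spt: "small_cat small (poset {Num 0})" by (rule small_poset) simp
    obtain ptr \<eta>' \<epsilon>' where p: "adjunction ?G ptr \<eta>' \<epsilon>'"
      using Der3_right[OF sI spt tF] by (auto simp: V2)
    have ptr: "ptr \<in> Fun (at_cat \<D> I) (dgm {Num 0})" by (rule adjunction_right_Fun[OF p G])
    let ?m = "coslice_mate \<D> (monotone_fun P Q h) k ur \<epsilon> ptr \<eta>'"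
    have mate: "nat_iso ?m"
      by (rule Der4_right[OF sP sQ monotone_fun_Fun[OF h], of k ur \<eta> \<epsilon> ptr \<eta>' \<epsilon>'])
         (use k a p in \<open>auto simp: poset_simps(1) restr_def sl' V2\<close>)
    have proj: "at_fun \<D> (coslice_proj (monotone_fun P Q h) k) \<in> Fun (dgm P) (at_cat \<D> I)"
      unfolding sl' V1 by (rule comp_fun_Fun[OF prF V])
    note m = component_coslice_mate[OF a ur p ptr proj Z]
    have iso: "iso (dgm {Num 0}) (component ?m Z)"
      using mate Z unfolding nat_iso_def m(2,3) by blast
    define Yk where "Yk = onObj (restr {Num 0} Q (\<lambda>_. k)) ?Y"
    have Yk: "Yk \<in> Obj (dgm {Num 0})" unfolding Yk_def by (rule R_Obj[OF order_map_from_pt[OF iQ k] Y])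
    define t where "t = trans_map S Q (\<lambda>_. k) h ?Y"
    define e where "e = onArr (restr S P (\<lambda>x. x)) (component \<epsilon> Z)"
    define prZ where "prZ = onObj (restr S P (\<lambda>x. x)) Z"
    have e: "e \<in> hom (dgm S) (onObj (restr S Q h) ?Y) prZ"
      unfolding e_def prZ_def
      using Fun_hom[OF prF adjunctionD(3)[OF a ur Z]] R_comp_Obj[OF pr h Y] by simp
    have t: "t \<in> hom (dgm S) (onObj (const_dgm S) Yk) (onObj (restr S Q h) ?Y)"
      unfolding t_def Yk_def R_comp_Obj[OF order_map_to_pt[OF iS] order_map_from_pt[OF iQ k] Y]
      by (rule tr_hom[OF ck hS b Y])
    have f: "Cmp (dgm S) e t \<in> hom (dgm S) (onObj (const_dgm S) Yk) prZ"
      by (rule category.Cmp_hom[OF C_category[OF iS] t e])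
    have "component ?m Z = Cmp (dgm {Num 0}) (onArr ptr (onArr V e))
        (Cmp (dgm {Num 0}) (onArr ptr (onArr V t)) (component \<eta>' Yk))"
      unfolding m(1) monotone_fun_simps sl' V1 V3[OF ck hS b Y] t_def Yk_def e_def
      using adjunctionD(3)[OF a ur Z] Fun_simps[OF prF]
      by (simp add: restr_def point_poset k comp_fun_simps hom_Arr)
    also have "\<dots> = Cmp (dgm {Num 0}) (onArr ptr (onArr V (Cmp (dgm S) e t))) (component \<eta>' Yk)"
      using Fun_Cmp[OF V t e] Fun_Cmp[OF ptr Fun_hom[OF V t] Fun_hom[OF V e]]
        category.Cmp_assoc[OF C_category[OF index_pt], OF _ Fun_hom[OF ptr Fun_hom[OF V t]] Fun_hom[OF ptr Fun_hom[OF V e]]]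
        adjunctionD(2)[OF p ptr Yk] Yk Fun_simps[OF cF] by (simp add: comp_fun_simps)
    finally have "universal_arrow (op_fun ?G) (onObj V prZ) Yk (onArr V (Cmp (dgm S) e t))"
      using universal_arrow_iff_iso_transpose[OF adjunction_op[OF p] op_fun_Fun[OF G], of Yk "onArr V (Cmp (dgm S) e t)"]
        Fun_hom[OF V f] iso Yk Fun_simps[OF cF]
      by (simp add: comp_fun_simps)
    then have "universal_arrow (op_fun (const_dgm S)) prZ Yk (Cmp (dgm S) e t)"
      using universal_arrow_along_functor[OF op_fun_Fun[OF cF] op_fun_Fun[OF V], of prZ "Cmp (dgm S) e t" Yk]
        bij f Yk hom_objs[OF C_category[OF iS] f] Fun_Obj[OF cF] by (simp add: op_fun_comp)
    then show ?thesis by (simp add: S_def Yk_def t_def e_def prZ_def)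
  qed
  moreover have "universal_arrow (op_fun (restr P Q h)) Z ?Y (component \<epsilon> Z)"
    using adjunction_unit_universal[OF adjunction_op[OF a] op_fun_Fun[OF U], of Z] Z by simp
  ultimately show "\<exists>Y \<eta>. universal_arrow (op_fun (restr P Q h)) Z Y \<eta> \<and>
      (\<forall>k \<in> Q. let S = {x \<in> P. code_le k (h x)} in
         universal_arrow (op_fun (const_dgm S)) (onObj (op_fun (restr S P (\<lambda>x. x))) Z)
           (onObj (op_fun (at_pt Q k)) Y)
           (Cmp (op_cat (dgm S)) (trans_map S Q (\<lambda>_. k) h Y) (onArr (op_fun (restr S P (\<lambda>x. x))) \<eta>)))"
    unfolding Let_def op_simps by blast
qed

end

section \<open>Pasting of squares\<close>

context kan_diagrams
begin

text \<open>For a face, \<open>h\<close> embeds the square into the grid, \<open>J\<close> is a corner and \<open>k\<close> the remaining vertex.\<close>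

lemma kan_extension_of_restriction_iff:
  assumes h: "order_map le P Q h" "\<And>x y. x \<in> P \<Longrightarrow> y \<in> P \<Longrightarrow> le (h x) (h y) \<Longrightarrow> le x y" "inj_on h P"
    and J: "P = insert k J" "k \<notin> J" "\<And>x. x \<in> J \<Longrightarrow> le x k" and X: "X \<in> Obj (C Q)"
  shows "(\<exists>Z \<eta>. universal_arrow (R J P (\<lambda>x. x)) Z (onObj (R P Q h) X) \<eta>) \<longleftrightarrow>
         univ_cocone (h ` J) Q (\<lambda>x. x) (h k) X"
proof -
  have "J \<subseteq> P" "k \<in> P" "P - J = {k}" "{x \<in> J. le x k} = J" using J by auto
  then show ?thesis
    using kan_extension_iff_univ_cocone[OF order_map_index(1)[OF h(1)] _ R_Obj[OF h(1) X]]
      univ_cocone_embedding[OF h _ _ J(3) X] by simp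
qed

end

abbreviation grid :: "'x code set" where
  "grid \<equiv> prod_poset (chain 2) (chain 1)"

abbreviation embed :: "nat \<Rightarrow> 'x code \<Rightarrow> 'x code" where
  "embed i \<equiv> \<lambda>x. Pr (coface i (pfst x)) (psnd x)"

lemma chain_1: "chain 1 = {Num 0, Num 1}" and chain_2: "chain 2 = {Num 0, Num 1, Num 2}"
  by (auto simp: chain_def image_def)

lemma square_eq: "square = {Pr (Num 0) (Num 0), Pr (Num 1) (Num 0), Pr (Num 0) (Num 1), Pr (Num 1) (Num 1)}"
  unfolding square_def prod_poset_def chain_1 by auto

lemma grid_eq: "grid = {Pr (Num 0) (Num 0), Pr (Num 1) (Num 0), Pr (Num 2) (Num 0),
    Pr (Num 0) (Num 1), Pr (Num 1) (Num 1), Pr (Num 2) (Num 1)}"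
  unfolding prod_poset_def chain_1 chain_2 by auto

lemma order_map_embed: "order_map code_le square grid (embed i)"
  by (auto simp: order_map_def index_def square_eq numeral_2_eq_2
      grid_eq[unfolded One_nat_def numeral_2_eq_2])

lemma embed_reflects: "x \<in> square \<Longrightarrow> y \<in> square \<Longrightarrow> code_le (embed i x) (embed i y) \<Longrightarrow> code_le x y"
  by (auto simp: square_eq split: if_splits)

lemma inj_embed: "inj_on (embed i) square"
  by (auto simp: inj_on_def square_eq split: if_splits)

context derivator
begin

text \<open>The instances of \<open>univ_cocone\<close> for \<open>\<D>(P)\<close> and for \<open>\<D>(P)\<^sup>o\<^sup>p\<close>: colimit cocones and limit cones.\<close>

abbreviation colim_cocone :: "'x code set \<Rightarrow> 'x code set \<Rightarrow> ('x code \<Rightarrow> 'x code) \<Rightarrow> 'x code \<Rightarrow> 'o \<Rightarrow> bool" where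
  "colim_cocone \<equiv> diagrams.univ_cocone restr trans_map (Num 0)"

abbreviation lim_cone :: "'x code set \<Rightarrow> 'x code set \<Rightarrow> ('x code \<Rightarrow> 'x code) \<Rightarrow> 'x code \<Rightarrow> 'o \<Rightarrow> bool" where
  "lim_cone \<equiv> diagrams.univ_cocone (\<lambda>P Q h. op_fun (restr P Q h)) (\<lambda>P Q h h' X. trans_map P Q h' h X) (Num 0)"

lemma coCartesian_face_iff:
  assumes "X \<in> Obj (dgm grid)"
  shows "coCartesian \<D> (face \<D> i X) \<longleftrightarrow>
    colim_cocone (embed i ` ul_corner) grid (\<lambda>x. x) (embed i (Pr (Num 1) (Num 1))) X"
proof -
  have sq: "index code_le (square :: 'x code set)" by (rule order_map_index(1)[OF order_map_embed])
  have sub: "(ul_corner :: 'x code set) \<subseteq> square" by (auto simp: ul_corner_def square_eq)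
  have u: "order_map code_le (ul_corner :: 'x code set) square (\<lambda>x. x)" by (rule order_map_incl[OF sq sub])
  have "coCartesian \<D> (face \<D> i X) \<longleftrightarrow>
      (\<exists>Z \<eta>. universal_arrow (restr ul_corner square (\<lambda>x. x)) Z (onObj (restr square grid (embed i)) X) \<eta>)"
    unfolding coCartesian_def face_def coface_times_id_def incl_ul_def restr_def
    by (intro kan_extension_iff_universal_arrow[OF at_monotone_fun[OF u]]
        Der3_left[OF small_poset[OF order_map_index(1)[OF u]] small_poset[OF sq]] monotone_fun_Fun u)
  also have "\<dots> \<longleftrightarrow> colim_cocone (embed i ` ul_corner) grid (\<lambda>x. x) (embed i (Pr (Num 1) (Num 1))) X"
    by (rule kan_diagrams.kan_extension_of_restriction_iff[OF dgm_kan_diagrams order_map_embed embed_reflects inj_embed _ _ _ assms])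
       (auto simp: square_eq ul_corner_def)
  finally show ?thesis .
qed

lemma Cartesian_face_iff:
  assumes "X \<in> Obj (dgm grid)"
  shows "Cartesian \<D> (face \<D> i X) \<longleftrightarrow>
    lim_cone (embed i ` lr_corner) grid (\<lambda>x. x) (embed i (Pr (Num 0) (Num 0))) X"
proof -
  have sq: "index code_le (square :: 'x code set)" by (rule order_map_index(1)[OF order_map_embed])
  have sub: "(lr_corner :: 'x code set) \<subseteq> square" by (auto simp: lr_corner_def square_eq)
  have u: "order_map code_le (lr_corner :: 'x code set) square (\<lambda>x. x)" by (rule order_map_incl[OF sq sub])
  have "Cartesian \<D> (face \<D> i X) \<longleftrightarrow>
      (\<exists>Z \<eta>. universal_arrow (op_fun (restr lr_corner square (\<lambda>x. x))) Z
         (onObj (op_fun (restr square grid (embed i))) X) \<eta>)"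
    unfolding Cartesian_def face_def coface_times_id_def incl_lr_def restr_def op_simps
    by (intro right_kan_extension_iff_universal_arrow[OF at_monotone_fun[OF u]]
        Der3_right[OF small_poset[OF order_map_index(1)[OF u]] small_poset[OF sq]] monotone_fun_Fun u)
  also have "\<dots> \<longleftrightarrow> lim_cone (embed i ` lr_corner) grid (\<lambda>x. x) (embed i (Pr (Num 0) (Num 0))) X"
  proof (rule kan_diagrams.kan_extension_of_restriction_iff[OF dgm_kan_diagrams_op])
    show "order_map (\<lambda>x y. code_le y x) square grid (embed i)"
      unfolding order_map_converse[of code_le] by (rule order_map_embed)
    show "code_le y x" if "x \<in> square" "y \<in> square" "code_le (embed i y) (embed i x)" for x y :: "'x code"
      using embed_reflects[OF that(2,1,3)] .
    show "X \<in> Obj (op_cat (dgm grid))" using assms by simp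
  qed (rule inj_embed, auto simp: square_eq lr_corner_def)
  finally show ?thesis .
qed

end

text \<open>The theorem is the pasting law, read through the descriptions of coCartesian and Cartesian faces by colimit
cocones and limit cones.\<close>

thm_deps kan_diagrams.univ_cocone_pasting derivator.coCartesian_face_iff derivator.Cartesian_face_iff

theorem proposition3p14:
  fixes small :: "'x code set \<Rightarrow> bool"
    and \<D> :: "('x, 'o, 'a) prederiv"
    and X :: 'o
  assumes "derivator small \<D>"
    and "X \<in> Obj (at_cat \<D> (poset (prod_poset (chain 2) (chain 1))))"
  shows "(coCartesian \<D> (face \<D> 2 X) \<longrightarrow>
            (coCartesian \<D> (face \<D> 0 X) \<longleftrightarrow> coCartesian \<D> (face \<D> 1 X))) \<and>
         (Cartesian \<D> (face \<D> 0 X) \<longrightarrow>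
            (Cartesian \<D> (face \<D> 2 X) \<longleftrightarrow> Cartesian \<D> (face \<D> 1 X)))"
proof -
  interpret derivator small \<D> by fact
  have X: "X \<in> Obj (dgm grid)" using assms(2) by (simp add: dgm_def)
  have ul: "embed 2 ` ul_corner = {Pr (Num 0) (Num 0), Pr (Num 1) (Num 0), Pr (Num 0) (Num 1)}"
    "embed 0 ` ul_corner = {Pr (Num 1) (Num 0), Pr (Num 2) (Num 0), Pr (Num 1) (Num 1)}"
    "embed 1 ` ul_corner = {Pr (Num 0) (Num 0), Pr (Num 2) (Num 0), Pr (Num 0) (Num 1)}"
    by (simp_all add: ul_corner_def numeral_2_eq_2)
  have lr: "embed 0 ` lr_corner = {Pr (Num 2) (Num 1), Pr (Num 1) (Num 1), Pr (Num 2) (Num 0)}"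
    "embed 2 ` lr_corner = {Pr (Num 1) (Num 1), Pr (Num 0) (Num 1), Pr (Num 1) (Num 0)}"
    "embed 1 ` lr_corner = {Pr (Num 2) (Num 1), Pr (Num 0) (Num 1), Pr (Num 2) (Num 0)}"
    by (auto simp: lr_corner_def numeral_2_eq_2)
  \<comment> \<open>For the reversed order the grid starts at \<open>21\<close>, and the roles of \<open>d\<^sub>0\<close> and \<open>d\<^sub>2\<close> are exchanged.\<close>
  have le_rev: "code_le (Pr (Num (2 - i')) (Num (1 - j')) :: 'x code) (Pr (Num (2 - i)) (Num (1 - j))) \<longleftrightarrow>
      i \<le> i' \<and> j \<le> j'" if "i \<le> 2" "j \<le> 1" "i' \<le> 2" "j' \<le> 1" for i j i' j' :: nat
    using that by auto
  have grid_rev: "(grid :: 'x code set) = {Pr (Num (2 - 0)) (Num (1 - 0)), Pr (Num (2 - 1)) (Num (1 - 0)),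
      Pr (Num (2 - 2)) (Num (1 - 0)), Pr (Num (2 - 0)) (Num (1 - 1)), Pr (Num (2 - 1)) (Num (1 - 1)),
      Pr (Num (2 - 2)) (Num (1 - 1))}"
    by (auto simp: grid_eq[unfolded One_nat_def])
  have "colim_cocone {Pr (Num 0) (Num 0), Pr (Num 1) (Num 0), Pr (Num 0) (Num 1)} grid (\<lambda>x. x) (Pr (Num 1) (Num 1)) X \<Longrightarrow>
      colim_cocone {Pr (Num 1) (Num 0), Pr (Num 2) (Num 0), Pr (Num 1) (Num 1)} grid (\<lambda>x. x) (Pr (Num 2) (Num 1)) X \<longleftrightarrow>
      colim_cocone {Pr (Num 0) (Num 0), Pr (Num 2) (Num 0), Pr (Num 0) (Num 1)} grid (\<lambda>x. x) (Pr (Num 2) (Num 1)) X"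
    using X by (intro kan_diagrams.univ_cocone_pasting[OF dgm_kan_diagrams, where g = "\<lambda>i j. Pr (Num i) (Num j)"])
      (simp_all add: grid_eq[unfolded One_nat_def])
  moreover have "lim_cone {Pr (Num 2) (Num 1), Pr (Num 1) (Num 1), Pr (Num 2) (Num 0)} grid (\<lambda>x. x) (Pr (Num 1) (Num 0)) X \<Longrightarrow>
      lim_cone {Pr (Num 1) (Num 1), Pr (Num 0) (Num 1), Pr (Num 1) (Num 0)} grid (\<lambda>x. x) (Pr (Num 0) (Num 0)) X \<longleftrightarrow>
      lim_cone {Pr (Num 2) (Num 1), Pr (Num 0) (Num 1), Pr (Num 2) (Num 0)} grid (\<lambda>x. x) (Pr (Num 0) (Num 0)) X"
    using kan_diagrams.univ_cocone_pasting[OF dgm_kan_diagrams_op le_rev grid_rev, of X] X by simp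
  ultimately show ?thesis
    unfolding coCartesian_face_iff[OF X] Cartesian_face_iff[OF X] ul lr
    by (simp add: numeral_2_eq_2)
qed

end
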